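(* Let $k\in\mathbb N$ and let $\{U_i,i\in\mathbb Z\}$ be the points of a Poisson process on $\mathbb R^k$ with constant intensity $\lambda>0$. Let $\{\xi_i(t),t\in\mathbb R\}$, $i\in\mathbb Z$, be independent copies, independent of the Poisson process, of the standard (two-sided, $\xi(0)=0$) Brownian motion $\{\xi(t),t\in\mathbb R\}$ in $\mathbb R^k$. Define $$X(t)=\min_{i\in\mathbb Z}|U_i+\xi_i(t)|,\quad t\in\mathbb R,$$ where $|\cdot|$ is the Euclidean norm. Then the max-i.d. process $-X$ is generated by a conservative flow for $k=1,2$ and by a dissipative flow for $k\ge3$.
   Context: $\stackrel{d}{=}$ denotes equality of finite-dimensional distributions. A process is max-i.d. if for every $n\in\mathbb N$ it equals in distribution the pointwise maximum of $n$ i.i.d. processes. For a $\sigma$-finite measure space $(\Omega,\mathcal B,\mu)$, $\mathcal L^\vee(\Omega,\mathcal B,\mu)$ is the set of measurable $f:\Omega\to\mathbb R$ with $f\ge0$ $\mu$-a.e. and $\mu\{f>a\}<\infty$ for all $a>0$ (functions equal $\mu$-a.e. are identified); $I(f):=\sup_{i\in J}f(U_i)$ ($0$ if there are no points), where $\Pi_\mu=\{U_i,i\in J\}$ is a Poisson point process on $(\Omega,\mathcal B)$ with intensity $\mu$. For a max-i.d. process $Y=\{Y(t),t\in\mathbb R\}$ with $\operatorname{essinf}Y(t)=0$ for all $t$, $\{f_t,t\in\mathbb R\}\subset\mathcal L^\vee$ is a spectral representation of $Y$ if $\{Y(t)\}\stackrel{d}{=}\{I(f_t)\}$; it has full support if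 there is no $B\in\mathcal B$ with $\mu(B)>0$ such that for every $t$, $f_t=0$ $\mu$-a.e. on $B$. A $\sigma$-finite Borel space is a measurable space isomorphic to a complete separable metric space with its Borel $\sigma$-algebra, endowed with a $\sigma$-finite measure. A measurable measure-preserving flow on it is a family $\{T_t\}_{t\in\mathbb R}$ of measure space isomorphisms (modulo null sets) $T_t:\Omega\to\Omega$ with $T_0=\mathrm{id}$, $T_t\circ T_s=T_{t+s}$ $\mu$-a.e. for all $s,t$, and $(t,\omega)\mapsto T_t(\omega)$ jointly measurable. Its conservative part is $C=\{\omega:\int_{\mathbb R}h(T_t(\omega))\,dt=\infty\}$, where $h\in L^1(\Omega,\mathcal B,\mu)$ is any function with $h>0$ $\mu$-a.e. ($C$ does not depend on $h$ modulo $\mu$), and its dissipative part is $D=\Omega\setminus C$. The flow is conservative if $\mu(D)=0$ and dissipative if $\mu(C)=0$. A stationary max-i.d. process $Y$ with $\operatorname{essinf}Y(t)=0$ is generated by a conservative (dissipative) flow if it has a spectral representation $\{f_t\}$ of full support, on a $\sigma$-finite Borel space, with $f_t=f_0\circ T_t$ $\mu$-a.e. for every $t$, for some conservative (dissipative) measurable measure-preserving flow $\{T_t\}$; this does not depend on the choice of such a flow representation. Convention: a max-i.d. process $Y$ with $\operatorname{essinf}Y(t)=-\infty$, such as $Y=-X$, is replaced by $e^{Y}$ (which is max-i.d. with essential infimum $0$); that is, a stationary max-i.d. process $Y$ with $\operatorname{essinf}Y(t)=-\infty$ is said to be generated by a conservative (dissipative) flow if the process $e^{Y}$ is generated by a conservative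 (dissipative) flow. *)

theory Defs
  imports "HOL-Probability.Probability"
begin

section \<open>Real-valued processes\<close>

definition fdd_eq ::
  "'a measure \<Rightarrow> (real \<Rightarrow> 'a \<Rightarrow> real) \<Rightarrow> 'b measure \<Rightarrow> (real \<Rightarrow> 'b \<Rightarrow> real) \<Rightarrow> bool" where
  "fdd_eq M Y N Z \<longleftrightarrow>
     (\<forall>t. Y t \<in> borel_measurable M) \<and> (\<forall>t. Z t \<in> borel_measurable N) \<and>
     (\<forall>T. finite T \<longrightarrow>
        distr M (\<Pi>\<^sub>M t\<in>T. borel) (\<lambda>\<omega>. \<lambda>t\<in>T. Y t \<omega>) =
        distr N (\<Pi>\<^sub>M t\<in>T. borel) (\<lambda>\<omega>. \<lambda>t\<in>T. Z t \<omega>))"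

definition stationary :: "'a measure \<Rightarrow> (real \<Rightarrow> 'a \<Rightarrow> real) \<Rightarrow> bool" where
  "stationary M Y \<longleftrightarrow> (\<forall>s. fdd_eq M (\<lambda>t. Y (t + s)) M Y)"

text \<open>
  The sample space of the independent copies has the type of sequences of paths. This loses no
  generality: any sequence of processes may be replaced by the coordinate process of its law.
\<close>

definition max_id :: "'a measure \<Rightarrow> (real \<Rightarrow> 'a \<Rightarrow> real) \<Rightarrow> bool" where
  "max_id M Y \<longleftrightarrow>
     (\<forall>n::nat. n \<ge> 1 \<longrightarrow>
        (\<exists>(N :: (nat \<Rightarrow> real \<Rightarrow> real) measure) (Z :: nat \<Rightarrow> real \<Rightarrow> (nat \<Rightarrow> real \<Rightarrow> real) \<Rightarrow> real).
           prob_space N \<and>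
           prob_space.indep_vars N (\<lambda>_. \<Pi>\<^sub>M t\<in>UNIV. borel) (\<lambda>j \<omega> t. Z j t \<omega>) {..<n} \<and>
           (\<forall>i<n. \<forall>j<n. fdd_eq N (Z i) N (Z j)) \<and>
           fdd_eq M Y N (\<lambda>t \<omega>. MAX j\<in>{..<n}. Z j t \<omega>)))"

definition essinf :: "'a measure \<Rightarrow> ('a \<Rightarrow> real) \<Rightarrow> ereal" where
  "essinf M f = Sup {a. AE \<omega> in M. a \<le> ereal (f \<omega>)}"


section \<open>Poisson processes and spectral representations\<close>

text \<open>
  A point process is given by an enumeration \<open>U\<close> of its points, with indices in the (random) set
  \<open>J \<omega>\<close>; a point is counted once for each of its indices.
\<close>

definition point_count ::
  "('a \<Rightarrow> 'i set) \<Rightarrow> ('i \<Rightarrow> 'a \<Rightarrow> 'w) \<Rightarrow> 'w set \<Rightarrow> 'a \<Rightarrow> ennreal" where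
  "point_count J U A \<omega> = emeasure (count_space UNIV) {i \<in> J \<omega>. U i \<omega> \<in> A}"

definition poisson_process ::
  "'a measure \<Rightarrow> 'w measure \<Rightarrow> ('a \<Rightarrow> 'i::countable set) \<Rightarrow> ('i \<Rightarrow> 'a \<Rightarrow> 'w) \<Rightarrow> bool" where
  "poisson_process M \<mu> J U \<longleftrightarrow>
     (\<forall>i. {\<omega> \<in> space M. i \<in> J \<omega>} \<in> sets M) \<and>
     (\<forall>i. U i \<in> restrict_space M {\<omega> \<in> space M. i \<in> J \<omega>} \<rightarrow>\<^sub>M \<mu>) \<and>
     (\<forall>A\<in>sets \<mu>. emeasure \<mu> A < \<infinity> \<longrightarrow>
        (\<forall>n::nat. measure M {\<omega> \<in> space M. point_count J U A \<omega> = of_nat n} =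
           exp (- measure \<mu> A) * measure \<mu> A ^ n / fact n)) \<and>
     (\<forall>A\<in>sets \<mu>. emeasure \<mu> A = \<infinity> \<longrightarrow> (AE \<omega> in M. point_count J U A \<omega> = \<infinity>)) \<and>
     (\<forall>(A :: nat \<Rightarrow> 'w set) n. A ` {..<n} \<subseteq> sets \<mu> \<and> disjoint_family_on A {..<n} \<longrightarrow>
        prob_space.indep_vars M (\<lambda>_. borel) (\<lambda>j. point_count J U (A j)) {..<n})"

definition L_vee :: "'w measure \<Rightarrow> ('w \<Rightarrow> real) set" where
  "L_vee \<mu> = {f \<in> borel_measurable \<mu>. (AE x in \<mu>. f x \<ge> 0) \<and>
     (\<forall>a>0. emeasure \<mu> {x \<in> space \<mu>. f x > a} < \<infinity>)}"

text \<open>For \<open>f \<in> L_vee \<mu>\<close> the supremum below is almost surely that of a bounded set.\<close>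

definition extremal_integral ::
  "('a \<Rightarrow> 'i set) \<Rightarrow> ('i \<Rightarrow> 'a \<Rightarrow> 'w) \<Rightarrow> ('w \<Rightarrow> real) \<Rightarrow> 'a \<Rightarrow> real" where
  "extremal_integral J U f \<omega> = (if J \<omega> = {} then 0 else (SUP i\<in>J \<omega>. f (U i \<omega>)))"

text \<open>
  The joint law of the variables \<open>I(f\<^sub>t)\<close> depends only on the intensity of the Poisson process, and
  a Poisson process with countably many points can be realised on the space of sequences of
  optional points (\<open>None\<close> for an absent point), so it is enough to look for one there.
\<close>

definition spectral_representation ::
  "'a measure \<Rightarrow> (real \<Rightarrow> 'a \<Rightarrow> real) \<Rightarrow> 'w measure \<Rightarrow> (real \<Rightarrow> 'w \<Rightarrow> real) \<Rightarrow> bool" where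
  "spectral_representation M Y \<mu> f \<longleftrightarrow>
     (\<forall>t. f t \<in> L_vee \<mu>) \<and>
     (\<exists>(N :: (nat \<Rightarrow> 'w option) measure) (J :: (nat \<Rightarrow> 'w option) \<Rightarrow> nat set)
        (U :: nat \<Rightarrow> (nat \<Rightarrow> 'w option) \<Rightarrow> 'w).
        prob_space N \<and> poisson_process N \<mu> J U \<and>
        fdd_eq M Y N (\<lambda>t. extremal_integral J U (f t)))"

definition full_support :: "'w measure \<Rightarrow> (real \<Rightarrow> 'w \<Rightarrow> real) \<Rightarrow> bool" where
  "full_support \<mu> f \<longleftrightarrow>
     \<not> (\<exists>B\<in>sets \<mu>. emeasure \<mu> B > 0 \<and> (\<forall>t. AE x in \<mu>. x \<in> B \<longrightarrow> f t x = 0))"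


section \<open>Measure-preserving flows\<close>

text \<open>The metric of the Polish space is transported to the underlying set of the measure.\<close>

definition sigma_finite_borel_space :: "'w measure \<Rightarrow> bool" where
  "sigma_finite_borel_space \<mu> \<longleftrightarrow> sigma_finite_measure \<mu> \<and>
     (\<exists>m. mspace m = space \<mu> \<and> mcomplete_of m \<and> separable_space (mtopology_of m) \<and>
        sets \<mu> = sigma_sets (space \<mu>) {G. openin (mtopology_of m) G})"

definition measure_iso_mod_null :: "'w measure \<Rightarrow> ('w \<Rightarrow> 'w) \<Rightarrow> bool" where
  "measure_iso_mod_null \<mu> T \<longleftrightarrow> T \<in> \<mu> \<rightarrow>\<^sub>M \<mu> \<and> distr \<mu> \<mu> T = \<mu> \<and>
     (\<exists>S. S \<in> \<mu> \<rightarrow>\<^sub>M \<mu> \<and> distr \<mu> \<mu> S = \<mu> \<and>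
        (AE x in \<mu>. S (T x) = x) \<and> (AE x in \<mu>. T (S x) = x))"

definition measure_preserving_flow :: "'w measure \<Rightarrow> (real \<Rightarrow> 'w \<Rightarrow> 'w) \<Rightarrow> bool" where
  "measure_preserving_flow \<mu> T \<longleftrightarrow>
     (\<forall>t. measure_iso_mod_null \<mu> (T t)) \<and>
     (\<forall>x\<in>space \<mu>. T 0 x = x) \<and>
     (\<forall>t s. AE x in \<mu>. T t (T s x) = T (t + s) x) \<and>
     (\<lambda>(t, x). T t x) \<in> borel \<Otimes>\<^sub>M \<mu> \<rightarrow>\<^sub>M \<mu>"

definition conservative_part ::
  "'w measure \<Rightarrow> (real \<Rightarrow> 'w \<Rightarrow> 'w) \<Rightarrow> ('w \<Rightarrow> real) \<Rightarrow> 'w set" where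
  "conservative_part \<mu> T h = {x \<in> space \<mu>. (\<integral>\<^sup>+t. ennreal (h (T t x)) \<partial>lborel) = \<infinity>}"

definition dissipative_part ::
  "'w measure \<Rightarrow> (real \<Rightarrow> 'w \<Rightarrow> 'w) \<Rightarrow> ('w \<Rightarrow> real) \<Rightarrow> 'w set" where
  "dissipative_part \<mu> T h = space \<mu> - conservative_part \<mu> T h"

text \<open>
  Modulo null sets the two parts do not depend on the choice of the a.e. positive integrable
  function \<open>h\<close>, and such a function exists because the measure is \<open>\<sigma>\<close>-finite; hence it does not
  matter that \<open>h\<close> is quantified existentially.
\<close>

definition conservative_flow :: "'w measure \<Rightarrow> (real \<Rightarrow> 'w \<Rightarrow> 'w) \<Rightarrow> bool" where
  "conservative_flow \<mu> T \<longleftrightarrow> measure_preserving_flow \<mu> T \<and>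
     (\<exists>h. integrable \<mu> h \<and> (AE x in \<mu>. h x > 0) \<and> dissipative_part \<mu> T h \<in> null_sets \<mu>)"

definition dissipative_flow :: "'w measure \<Rightarrow> (real \<Rightarrow> 'w \<Rightarrow> 'w) \<Rightarrow> bool" where
  "dissipative_flow \<mu> T \<longleftrightarrow> measure_preserving_flow \<mu> T \<and>
     (\<exists>h. integrable \<mu> h \<and> (AE x in \<mu>. h x > 0) \<and> conservative_part \<mu> T h \<in> null_sets \<mu>)"

text \<open>
  The space carrying the flow is any subset of \<open>nat \<Rightarrow> real\<close> with any \<open>\<sigma>\<close>-algebra that makes it a
  Borel space. Polish spaces have at most the cardinality of the continuum, so up to isomorphism
  every \<open>\<sigma>\<close>-finite Borel space is of this form.
\<close>

definition flow_represented ::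
  "((nat \<Rightarrow> real) measure \<Rightarrow> (real \<Rightarrow> (nat \<Rightarrow> real) \<Rightarrow> (nat \<Rightarrow> real)) \<Rightarrow> bool) \<Rightarrow>
   'a measure \<Rightarrow> (real \<Rightarrow> 'a \<Rightarrow> real) \<Rightarrow> bool" where
  "flow_represented P M Y \<longleftrightarrow>
     (\<exists>\<mu> f T. sigma_finite_borel_space \<mu> \<and>
        spectral_representation M Y \<mu> f \<and> full_support \<mu> f \<and>
        P \<mu> T \<and> (\<forall>t. AE x in \<mu>. f t x = f 0 (T t x)))"

text \<open>
  The second disjunct is the convention by which a process with essential infimum \<open>-\<infinity>\<close> is replaced
  by its exponential.
\<close>

definition generated_by ::
  "((nat \<Rightarrow> real) measure \<Rightarrow> (real \<Rightarrow> (nat \<Rightarrow> real) \<Rightarrow> (nat \<Rightarrow> real)) \<Rightarrow> bool) \<Rightarrow>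
   'a measure \<Rightarrow> (real \<Rightarrow> 'a \<Rightarrow> real) \<Rightarrow> bool" where
  "generated_by P M Y \<longleftrightarrow> stationary M Y \<and> max_id M Y \<and>
     ((\<forall>t. essinf M (Y t) = 0) \<and> flow_represented P M Y \<or>
      (\<forall>t. essinf M (Y t) = -\<infinity>) \<and> flow_represented P M (\<lambda>t \<omega>. exp (Y t \<omega>)))"

abbreviation generated_by_conservative_flow ::
  "'a measure \<Rightarrow> (real \<Rightarrow> 'a \<Rightarrow> real) \<Rightarrow> bool" where
  "generated_by_conservative_flow \<equiv> generated_by conservative_flow"

abbreviation generated_by_dissipative_flow ::
  "'a measure \<Rightarrow> (real \<Rightarrow> 'a \<Rightarrow> real) \<Rightarrow> bool" where
  "generated_by_dissipative_flow \<equiv> generated_by dissipative_flow"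


section \<open>Brownian motion\<close>

text \<open>
  The time axis is all of \<open>\<real>\<close>. For \<open>s < t\<close> the increment is centred Gaussian with covariance
  matrix \<open>(t - s)\<close> times the identity.
\<close>

definition standard_brownian_motion ::
  "'a measure \<Rightarrow> (real \<Rightarrow> 'a \<Rightarrow> real ^ 'k::finite) \<Rightarrow> bool" where
  "standard_brownian_motion M W \<longleftrightarrow>
     (\<forall>t. W t \<in> borel_measurable M) \<and>
     (AE \<omega> in M. W 0 \<omega> = 0) \<and>
     (AE \<omega> in M. continuous_on UNIV (\<lambda>t. W t \<omega>)) \<and>
     (\<forall>s t. s < t \<longrightarrow>
        distributed M lborel (\<lambda>\<omega>. W t \<omega> - W s \<omega>)
          (\<lambda>x. ennreal (\<Prod>i\<in>UNIV. normal_density 0 (sqrt (t - s)) (x $ i)))) \<and>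
     (\<forall>(\<tau> :: nat \<Rightarrow> real) n. strict_mono_on {..n} \<tau> \<longrightarrow>
        prob_space.indep_vars M (\<lambda>_. borel) (\<lambda>j \<omega>. W (\<tau> (Suc j)) \<omega> - W (\<tau> j) \<omega>) {..<n})"

end

theory Submission
  imports Defs
begin

text \<open>
  By the marking theorem the particle paths \<open>U\<^sub>i + \<xi>\<^sub>i\<close> form a Poisson process whose intensity is the
  image of Lebesgue measure times Wiener measure. This measure on paths is invariant under the time
  shift, because Brownian motion has stationary increments and Lebesgue measure is translation
  invariant. Hence \<open>exp (- X t)\<close> has the spectral functions \<open>f\<^sub>t x = exp (- norm (x t)) = f\<^sub>0 \<circ> T\<^sub>t\<close> with
  \<open>T\<close> the shift, and the finite-dimensional laws of \<open>X\<close> are void probabilities. Testing the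
  flow with \<open>h x = g (x 0)\<close> for a Gaussian density \<open>g\<close>, its type is decided by whether
  \<open>\<integral> g (u + \<xi>\<^sub>t) dt\<close> is finite: for \<open>k \<ge> 3\<close> already the expectation is finite since
  \<open>E g (u + \<xi>\<^sub>t) = O(t powr (- k / 2))\<close>, while for \<open>k \<le> 2\<close> the skeleton \<open>\<xi> (s + n)\<close> is recurrent by
  the argument of Chung and Fuchs.

  A path is coded by the values of its coordinates at dyadic times, so that the flow lives on the
  Polish space \<open>nat \<Rightarrow> real\<close>.
\<close>

section \<open>The extended exponential and power series\<close>

text \<open>Poisson processes are defined by counts: Poisson laws, and independence over disjoint
  sets. Marking, mapping and thinning are awkward in that form but become substitutions in the
  Laplace functional \<open>E exp (- \<Sum> g (U i)) = exp (- \<integral> 1 - exp (- g))\<close>. So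
  the functional is derived from the counts and, conversely, shown to give them back. It is stated
  with \<open>enexp\<close>, that is \<open>exp (- x)\<close> on [0, \<infinity>] with value 0 at
  \<infinity>: no integrability has to be checked, and infinite test functions give void
  probabilities. Brownian paths are continuous only almost surely, while a flow must have
  \<open>T 0 x = x\<close> everywhere; so coding and decoding are total maps, and the shift by 0 is
  the identity by definition. For max-infinite divisibility each particle gets one of n labels at
  random: the label classes are independent Poisson processes of intensity \<mu> / n, and the
  closest particle overall is the closest one over all classes. The threshold k = 2 enters because
  \<open>P (norm (\<xi> t) < 1)\<close> has order \<open>t powr (- k / 2)\<close> for large t, which
  is summable over the integers exactly for k \<ge> 3.\<close>

definition enexp :: "ennreal \<Rightarrow> ennreal" where
  "enexp x = (if x = \<infinity> then 0 else ennreal (exp (- enn2real x)))"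

lemma enexp_simps [simp]: "enexp 0 = 1" "enexp \<infinity> = 0" "enexp top = 0"
  by (auto simp: enexp_def)

lemma enexp_ennreal: "0 \<le> x \<Longrightarrow> enexp (ennreal x) = ennreal (exp (- x))"
  by (simp add: enexp_def)

lemma enexp_add: "enexp (a + b) = enexp a * enexp b"
  by (cases a; cases b) (auto simp: enexp_ennreal ennreal_mult[symmetric] exp_add[symmetric]
      simp flip: ennreal_plus)

lemma enexp_antimono: "a \<le> b \<Longrightarrow> enexp b \<le> enexp a"
  by (cases a; cases b) (auto simp: enexp_ennreal top_unique)

lemma enexp_le_1 [simp]: "enexp a \<le> 1"
  by (metis enexp_antimono enexp_simps(1) zero_le)

lemma enexp_neq_top [simp]: "enexp a \<noteq> \<top>"
  using neq_top_trans[OF _ enexp_le_1] by simp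

lemma enexp_sum: "enexp (\<Sum>i\<in>I. f i) = (\<Prod>i\<in>I. enexp (f i))"
  by (induction I rule: infinite_finite_induct) (auto simp: enexp_add)

lemma enexp_of_nat_mult: "enexp (of_nat n * c) = enexp c ^ n"
  by (induction n) (auto simp: enexp_add algebra_simps distrib_right)

text \<open>Continuity has to include the point \<infinity>, because the sums and integrals inside
  \<open>enexp\<close> may become infinite in the limit. Finite limits reduce to the real
  exponential.\<close>

lemma tendsto_enexp:
  assumes "(f \<longlongrightarrow> a) F" shows "((\<lambda>x. enexp (f x)) \<longlongrightarrow> enexp a) F"
proof (cases "a = \<infinity>")
  case False
  then have "\<forall>\<^sub>F x in F. f x < \<infinity>"
    using order_tendstoD(2)[OF assms, of \<infinity>] by (simp add: top.not_eq_extremum)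
  then have "\<forall>\<^sub>F x in F. ennreal (exp (- enn2real (f x))) = enexp (f x)"
    by eventually_elim (auto simp: enexp_def)
  moreover have "((\<lambda>x. ennreal (exp (- enn2real (f x)))) \<longlongrightarrow> ennreal (exp (- enn2real a))) F"
    using False assms by (intro tendsto_intros) (auto simp: top.not_eq_extremum ennreal_enn2real_if)
  ultimately show ?thesis
    using False by (simp add: enexp_def tendsto_cong)
next
  case True
  show ?thesis
  proof (rule order_tendstoI)
    fix y :: ennreal assume "enexp a < y"
    then have "0 < y" using True by simp
    obtain z where z: "0 < z" "z < y" using dense[OF \<open>0 < y\<close>] by blast
    then obtain r where r: "0 < r" "ennreal r < y"
      by (cases z) auto
    have "\<forall>\<^sub>F x in F. f x > ennreal (max 0 (- ln r))"
      using order_tendstoD(1)[OF assms] True by simp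
    then show "\<forall>\<^sub>F x in F. enexp (f x) < y"
    proof eventually_elim
      case (elim x)
      have "enexp (f x) \<le> enexp (ennreal (max 0 (- ln r)))"
        using elim by (intro enexp_antimono) (rule less_imp_le)
      also have "\<dots> \<le> ennreal r"
        unfolding enexp_ennreal[OF max.cobounded1]
        using r by (intro ennreal_leI) (metis exp_le_cancel_iff exp_ln max.cobounded2 minus_le_iff neg_le_iff_le)
      finally show ?case using r by simp
    qed
  qed (use True in auto)
qed

lemma isCont_enexp: "isCont enexp x"
  unfolding isCont_def by (rule tendsto_enexp) simp

lemma measurable_enexp [measurable]: "enexp \<in> borel_measurable borel"
  by (intro borel_measurable_continuous_onI continuous_at_imp_continuous_on) (simp add: isCont_enexp)

text \<open>Once the lower coefficients of the difference vanish, dividing by \<open>s ^ n\<close>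
  and letting s decrease to 0 isolates the coefficient n. Values are given on (0, 1) because s will
  be \<open>enexp c\<close> with 0 < c < \<infinity>.\<close>

lemma powser_unique:
  fixes a b :: "nat \<Rightarrow> real"
  assumes a: "\<And>s. 0 < s \<Longrightarrow> s < 1 \<Longrightarrow> (\<lambda>n. a n * s ^ n) sums f s"
    and b: "\<And>s. 0 < s \<Longrightarrow> s < 1 \<Longrightarrow> (\<lambda>n. b n * s ^ n) sums f s"
  shows "a = b"
proof -
  define d where "d n = a n - b n" for n
  have d: "(\<lambda>n. d n * s ^ n) sums 0" if "0 < s" "s < 1" for s
    using sums_diff[OF a[OF that] b[OF that]] by (simp add: d_def algebra_simps)
  have "d n = 0" for n
  proof (induction n rule: less_induct)
    case (less n)
    have *: "(\<lambda>m. d (m + n) * s ^ m) sums 0" if "0 < s" "s < 1" for s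
    proof -
      have "(\<lambda>m. d (m + n) * s ^ (m + n)) sums 0"
        using sums_split_initial_segment[OF d[OF that], of n] less by simp
      from sums_mult[OF this, of "1 / s ^ n"] show ?thesis
        using that by (simp add: power_add field_simps)
    qed
    have summ: "summable (\<lambda>m. d (m + n) * x ^ m)" if "norm x < 1/2" for x :: real
      using powser_inside[OF sums_summable[OF *[of "1/2"]], of x] that by simp
    have "((\<lambda>x. \<Sum>m. d (m + n) * x ^ m) \<longlongrightarrow> d (0 + n)) (at 0)"
      by (rule powser_limit_0[of "1/2" "\<lambda>m. d (m + n)"]) (auto intro!: summ summable_sums)
    then have "((\<lambda>x. \<Sum>m. d (m + n) * x ^ m) \<longlongrightarrow> d n) (at_right 0)"
      using tendsto_within_subset[of _ _ 0 UNIV] by simp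
    moreover have "\<forall>\<^sub>F x in at_right 0. (\<Sum>m. d (m + n) * x ^ m) = 0"
      unfolding eventually_at_right[OF zero_less_one]
      by (rule exI[of _ 1]) (auto dest: sums_unique[OF *])
    ultimately have "((\<lambda>x::real. 0) \<longlongrightarrow> d n) (at_right 0)"
      by (rule Lim_transform_eventually)
    from tendsto_unique[OF _ this tendsto_const] show ?case by simp
  qed
  then show ?thesis by (auto simp: d_def)
qed

text \<open>Finiteness of the sums makes all coefficients finite, so that the real case applies to
  them.\<close>

lemma ennreal_powser_unique:
  fixes a b :: "nat \<Rightarrow> ennreal"
  assumes "\<And>s. 0 < s \<Longrightarrow> s < 1 \<Longrightarrow> (\<Sum>n. a n * ennreal s ^ n) = (\<Sum>n. b n * ennreal s ^ n)"
    and fin: "\<And>s. 0 < s \<Longrightarrow> s < 1 \<Longrightarrow> (\<Sum>n. a n * ennreal s ^ n) < \<infinity>"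
  shows "a = b"
proof -
  have aux: "c n < \<infinity> \<and> (\<lambda>n. enn2real (c n) * s ^ n) sums enn2real (\<Sum>n. c n * ennreal s ^ n)"
    if c: "(\<Sum>n. c n * ennreal s ^ n) < \<infinity>" and s: "0 < s" "s < 1" for c :: "nat \<Rightarrow> ennreal" and s n
  proof -
    have lt: "c n * ennreal s ^ n < \<infinity>" for n
      using c sum_le_suminf[of "\<lambda>n. c n * ennreal s ^ n" "{n}"] by (auto intro: le_less_trans)
    have fin: "c n < \<infinity>" for n
      using lt[of n] s by (auto simp: ennreal_mult_less_top ennreal_power)
    have eq: "c n * ennreal s ^ n = ennreal (enn2real (c n) * s ^ n)" for n
      using fin[of n] s by (simp add: ennreal_mult ennreal_power)
    have nt: "(\<Sum>n. ennreal (enn2real (c n) * s ^ n)) \<noteq> top"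
      using c by (simp add: eq)
    have "summable (\<lambda>n. enn2real (c n) * s ^ n)"
      by (rule summable_suminf_not_top[OF _ nt]) (use s in simp)
    moreover have "enn2real (\<Sum>n. c n * ennreal s ^ n) = (\<Sum>n. enn2real (c n) * s ^ n)"
      unfolding eq using s by (subst suminf_ennreal[OF _ nt]) (simp_all add: suminf_nonneg calculation)
    ultimately show ?thesis using fin by (simp add: summable_sums)
  qed
  have "(\<lambda>n. enn2real (a n)) = (\<lambda>n. enn2real (b n))"
  proof (rule powser_unique)
    fix s :: real assume s: "0 < s" "s < 1"
    show "(\<lambda>n. enn2real (a n) * s ^ n) sums enn2real (\<Sum>n. a n * ennreal s ^ n)"
      using aux[OF fin[OF s] s] by blast
    show "(\<lambda>n. enn2real (b n) * s ^ n) sums enn2real (\<Sum>n. a n * ennreal s ^ n)"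
      using aux[of b, OF _ s] fin[OF s] assms(1)[OF s] by simp
  qed
  moreover have "a n < \<infinity>" "b n < \<infinity>" for n
    using aux[of a "1/2" n] aux[of b "1/2" n] fin[of "1/2"] assms(1)[of "1/2"] by auto
  ultimately show ?thesis
    by (metis (no_types, lifting) ext ennreal_enn2real infinity_ennreal_def)
qed

section \<open>Poisson weights with possibly infinite mean\<close>

definition poisson_weight :: "ennreal \<Rightarrow> nat \<Rightarrow> ennreal" where
  "poisson_weight m n = (if m = \<infinity> then 0 else ennreal (exp (- enn2real m) * enn2real m ^ n / fact n))"

text \<open>This is the exponential series. For mean \<infinity> all mass sits at the count
  \<infinity>, so every weight is 0; there s = 1 must be excluded, since the left side would be 0
  and the right side \<open>enexp (0 * \<infinity>) = 1\<close>.\<close>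

lemma suminf_poisson_weight:
  assumes s: "0 \<le> s" "s \<le> 1" "m = \<infinity> \<Longrightarrow> s < 1"
  shows "(\<Sum>n. poisson_weight m n * ennreal s ^ n) = enexp ((1 - ennreal s) * m)"
proof (cases "m = \<infinity>")
  case False
  then obtain r where r: "m = ennreal r" "0 \<le> r" by (cases m) auto
  have exps: "(\<lambda>n. (r * s) ^ n / fact n) sums exp (r * s)"
    using exp_converges[of "r * s"] by (simp add: field_simps)
  have "(\<Sum>n. poisson_weight m n * ennreal s ^ n) = (\<Sum>n. ennreal (exp (- r) * ((r * s) ^ n / fact n)))"
    using r s by (intro suminf_cong)
      (auto simp: poisson_weight_def ennreal_power ennreal_mult[symmetric] power_mult_distrib)
  also have "\<dots> = ennreal (exp (-r) * exp (r * s))"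
    using sums_mult[OF exps, of "exp (-r)"] r s by (intro suminf_ennreal_eq) auto
  also have "\<dots> = enexp (ennreal ((1 - s) * r))"
    using s r by (subst enexp_ennreal) (auto simp: exp_add[symmetric] algebra_simps mult_left_le)
  also have "\<dots> = enexp ((1 - ennreal s) * m)"
    using s r by (simp add: ennreal_mult ennreal_minus flip: ennreal_1)
  finally show ?thesis .
next
  case True
  have "1 - ennreal s \<noteq> 0"
    using s True by (simp add: diff_eq_0_iff_ennreal not_le)
  then show ?thesis using True by (simp add: poisson_weight_def ennreal_mult_top)
qed

text \<open>The Poisson weights sum to 1, so N is almost surely a natural number and
  \<open>enexp (N * c)\<close> is the power \<open>enexp c ^ N\<close>; what remains is the
  generating function at \<open>s = enexp c\<close>.\<close>

lemma nn_integral_enexp_poisson: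
  assumes "prob_space M" and [measurable]: "N \<in> borel_measurable M"
    and "0 \<le> m"
    and P: "\<And>n. measure M {\<omega> \<in> space M. N \<omega> = of_nat n} = exp (- m) * m ^ n / fact n"
  shows "(\<integral>\<^sup>+\<omega>. enexp (N \<omega> * c) \<partial>M) = enexp ((1 - enexp c) * ennreal m)"
proof -
  interpret prob_space M by fact
  define E where "E n = {\<omega> \<in> space M. N \<omega> = of_nat n}" for n
  have [measurable]: "E n \<in> sets M" for n unfolding E_def by measurable
  have E_weight: "emeasure M (E n) = poisson_weight (ennreal m) n" for n
    using assms(3) by (simp add: emeasure_eq_measure E_def P poisson_weight_def)
  have disj: "disjoint_family E"
    by (auto simp: disjoint_family_on_def E_def)
  have "emeasure M (\<Union>n. E n) = (\<Sum>n. emeasure M (E n))"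
    by (intro suminf_emeasure[symmetric] disj) auto
  also have "\<dots> = 1"
    using suminf_poisson_weight[of 1 "ennreal m"] by (simp add: E_weight)
  finally have "emeasure M (\<Union>n. E n) = 1" .
  then have AE: "AE \<omega> in M. \<omega> \<in> (\<Union>n. E n)"
    by (subst AE_in_set_eq_1) (simp_all add: measure_def)
  obtain s where s: "enexp c = ennreal s" "0 \<le> s" "s \<le> 1"
    using enexp_le_1[of c] by (cases "enexp c") (auto simp: top_unique)
  have "(\<integral>\<^sup>+\<omega>. enexp (N \<omega> * c) \<partial>M) = (\<integral>\<^sup>+\<omega>. (\<Sum>n. enexp c ^ n * indicator (E n) \<omega>) \<partial>M)"
  proof (rule nn_integral_cong_AE)
    from AE show "AE \<omega> in M. enexp (N \<omega> * c) = (\<Sum>n. enexp c ^ n * indicator (E n) \<omega>)"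
    proof eventually_elim
      case (elim \<omega>)
      then obtain n where n: "\<omega> \<in> E n" by auto
      then have "\<omega> \<in> E k \<longleftrightarrow> k = n" for k using disj by (auto simp: disjoint_family_on_def)
      then have "(\<Sum>n. enexp c ^ n * indicator (E n) \<omega>) = (\<Sum>k. if k = n then enexp c ^ k else 0)"
        by (intro suminf_cong) auto
      also have "\<dots> = enexp c ^ n" using suminf_finite[of "{n}"] by (subst suminf_finite[of "{n}"]) auto
      finally show ?case using n by (simp add: E_def enexp_of_nat_mult)
    qed
  qed
  also have "\<dots> = (\<Sum>n. enexp c ^ n * emeasure M (E n))"
    by (subst nn_integral_suminf) (auto simp: nn_integral_cmult_indicator)
  also have "\<dots> = enexp ((1 - enexp c) * ennreal m)"
    using suminf_poisson_weight[of s "ennreal m"] s by (simp add: E_weight mult.commute)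
  finally show ?thesis .
qed

section \<open>Laplace functionals of Poisson processes\<close>

lemma poisson_process_measurable:
  assumes "poisson_process M \<mu> (\<lambda>_. UNIV) U"
  shows "U i \<in> M \<rightarrow>\<^sub>M \<mu>"
proof -
  have "U i \<in> restrict_space M (space M) \<rightarrow>\<^sub>M \<mu>"
    using assms by (auto simp: poisson_process_def)
  moreover have "sets (restrict_space M (space M)) = sets M"
    using sets.sets_into_space by (force simp: sets_restrict_space image_iff)
  ultimately show ?thesis
    using measurable_cong_sets by blast
qed

lemma point_count_suminf:
  fixes U :: "nat \<Rightarrow> 'a \<Rightarrow> 'w"
  shows "point_count (\<lambda>_. UNIV) U A \<omega> = (\<Sum>i. indicator A (U i \<omega>))"
proof -
  have "point_count (\<lambda>_. UNIV) U A \<omega> = (\<integral>\<^sup>+i. indicator {i. U i \<omega> \<in> A} i \<partial>count_space UNIV)"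
    by (simp add: point_count_def)
  also have "\<dots> = (\<Sum>i. indicator A (U i \<omega>))"
    by (subst nn_integral_count_space_nat) (auto intro!: suminf_cong simp: indicator_def)
  finally show ?thesis .
qed

lemma point_count_cases:
  obtains n :: nat where "point_count J U A \<omega> = of_nat n" | "point_count J U A \<omega> = \<infinity>"
proof (cases "finite {i \<in> J \<omega>. U i \<omega> \<in> A}")
  case True
  then show ?thesis
    using that(1)[of "card {i \<in> J \<omega>. U i \<omega> \<in> A}"] by (simp add: point_count_def emeasure_count_space)
next
  case False
  then show ?thesis
    using that(2) by (simp add: point_count_def emeasure_count_space)
qed

lemma measurable_point_count:
  fixes U :: "nat \<Rightarrow> 'a \<Rightarrow> 'w"
  assumes "\<And>i. U i \<in> M \<rightarrow>\<^sub>M \<mu>" "A \<in> sets \<mu>"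
  shows "point_count (\<lambda>_. UNIV) U A \<in> borel_measurable M"
proof -
  note [measurable] = assms
  have "point_count (\<lambda>_. UNIV) U A = (\<lambda>\<omega>. \<Sum>i. indicator A (U i \<omega>))"
    by (auto simp: point_count_suminf)
  then show ?thesis by simp
qed

text \<open>For infinite mass the count is \<infinity> almost surely; both sides are then 1 if c = 0
  and 0 otherwise, so the formula for finite mass persists.\<close>

lemma nn_integral_enexp_point_count:
  fixes U :: "nat \<Rightarrow> 'a \<Rightarrow> 'w"
  assumes "prob_space M" and U: "poisson_process M \<mu> (\<lambda>_. UNIV) U" and A: "A \<in> sets \<mu>"
  shows "(\<integral>\<^sup>+\<omega>. enexp (point_count (\<lambda>_. UNIV) U A \<omega> * c) \<partial>M) = enexp ((1 - enexp c) * emeasure \<mu> A)"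
proof -
  interpret prob_space M by fact
  have [measurable]: "point_count (\<lambda>_. UNIV) U A \<in> borel_measurable M"
    using measurable_point_count[OF poisson_process_measurable[OF U] A] .
  show ?thesis
  proof (cases "emeasure \<mu> A = \<infinity>")
    case True
    then have "AE \<omega> in M. point_count (\<lambda>_. UNIV) U A \<omega> = \<infinity>"
      using U A by (auto simp: poisson_process_def)
    then have "(\<integral>\<^sup>+\<omega>. enexp (point_count (\<lambda>_. UNIV) U A \<omega> * c) \<partial>M) = (\<integral>\<^sup>+\<omega>. enexp (\<infinity> * c) \<partial>M)"
      by (intro nn_integral_cong_AE) auto
    also have "\<dots> = enexp ((1 - enexp c) * emeasure \<mu> A)"
    proof (cases "c = 0")
      case False
      have "1 - enexp c \<noteq> 0"
      proof (cases c)
        case (real r)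
        then have "exp (-r) < 1" using False by (auto simp: less_le)
        then have "enexp c < 1" using real by (simp add: enexp_ennreal)
        then show ?thesis by (simp add: diff_eq_0_iff_ennreal not_le)
      qed auto
      then show ?thesis using True False by (simp add: emeasure_space_1 ennreal_mult_top)
    qed (simp add: emeasure_space_1)
    finally show ?thesis .
  next
    case False
    then have "emeasure \<mu> A = ennreal (measure \<mu> A)"
      by (intro emeasure_eq_ennreal_measure) auto
    moreover have "(\<integral>\<^sup>+\<omega>. enexp (point_count (\<lambda>_. UNIV) U A \<omega> * c) \<partial>M) = enexp ((1 - enexp c) * ennreal (measure \<mu> A))"
      using U A False by (intro nn_integral_enexp_poisson assms) (auto simp: poisson_process_def top.not_eq_extremum)
    ultimately show ?thesis by simp
  qed
qed

text \<open>The points in the level set of \<open>e j\<close> contribute \<open>N j * e j\<close>,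
  and the counts \<open>N j\<close> are independent because the level sets are disjoint. The level 0
  may have infinite mass, which is harmless since 1 - enexp 0 = 0.\<close>

lemma laplace_functional_simple:
  fixes U :: "nat \<Rightarrow> 'a \<Rightarrow> 'w"
  assumes "prob_space M" and U: "poisson_process M \<mu> (\<lambda>_. UNIV) U" and h: "simple_function \<mu> h"
  shows "(\<integral>\<^sup>+\<omega>. enexp (\<Sum>i. h (U i \<omega>)) \<partial>M) = enexp (\<integral>\<^sup>+x. 1 - enexp (h x) \<partial>\<mu>)"
proof -
  interpret prob_space M by fact
  note [measurable] = poisson_process_measurable[OF U]
  have hm [measurable]: "h \<in> borel_measurable \<mu>"
    using h by (rule borel_measurable_simple_function)
  have "finite (h ` space \<mu>)" using h by (rule simple_functionD)
  then obtain e :: "nat \<Rightarrow> ennreal" and n where e: "bij_betw e {..<n} (h ` space \<mu>)"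
    using ex_bij_betw_nat_finite by (metis atLeast0LessThan)
  define A where "A j = h -` {e j} \<inter> space \<mu>" for j
  have A [measurable]: "A j \<in> sets \<mu>" for j unfolding A_def by measurable
  have disj: "disjoint_family_on A {..<n}"
    using e by (auto simp: disjoint_family_on_def A_def bij_betw_def inj_on_def)
  have ind: "\<exists>k<n. \<forall>j<n. indicator (A j) x = (if j = k then 1 else 0 :: ennreal)"
    and e_ind: "\<And>k. k < n \<Longrightarrow> x \<in> A k \<Longrightarrow> h x = e k" if "x \<in> space \<mu>" for x
  proof -
    have "h x \<in> e ` {..<n}" using e that by (auto simp: bij_betw_def)
    then obtain k where k: "k < n" "h x = e k" by auto
    then show "\<exists>k<n. \<forall>j<n. indicator (A j) x = (if j = k then 1 else 0 :: ennreal)"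
      using that e by (intro exI[of _ k]) (auto simp: A_def indicator_def bij_betw_def inj_on_def)
  qed (auto simp: A_def)
  \<comment> \<open>Stated for arbitrary F since it serves twice: for the identity and for
    \<open>1 - enexp\<close>.\<close>
  have decomp: "F (h x) = (\<Sum>j<n. indicator (A j) x * F (e j))" if x: "x \<in> space \<mu>" for x and F :: "ennreal \<Rightarrow> ennreal"
  proof -
    obtain k where k: "k < n" "\<And>j. j < n \<Longrightarrow> indicator (A j) x = (if j = k then 1 else 0 :: ennreal)"
      using ind[OF x] by blast
    then have "x \<in> A k" by (metis indicator_simps(2) zero_neq_one)
    have "(\<Sum>j<n. indicator (A j) x * F (e j)) = (\<Sum>j<n. if j = k then F (e j) else 0)"
      using k(2) by (intro sum.cong) auto
    also have "\<dots> = F (e k)" using k(1) by simp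
    finally show ?thesis using e_ind[OF x k(1) \<open>x \<in> A k\<close>] by simp
  qed
  define N where "N j = point_count (\<lambda>_. UNIV) U (A j)" for j
  have [measurable]: "N j \<in> borel_measurable M" for j
    unfolding N_def by (rule measurable_point_count[where \<mu>=\<mu>]) auto
  have "A ` {..<n} \<subseteq> sets \<mu>" using A by auto
  with U disj have indep: "indep_vars (\<lambda>_. borel) N {..<n}"
    unfolding poisson_process_def N_def by blast
  have sum_eq: "(\<Sum>i. h (U i \<omega>)) = (\<Sum>j<n. N j \<omega> * e j)" if "\<omega> \<in> space M" for \<omega>
  proof -
    have "U i \<omega> \<in> space \<mu>" for i
      using measurable_space[OF poisson_process_measurable[OF U] that] .
    then have "(\<Sum>i. h (U i \<omega>)) = (\<Sum>i. \<Sum>j<n. indicator (A j) (U i \<omega>) * e j)"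
      by (intro suminf_cong decomp[of _ "\<lambda>x. x"])
    also have "\<dots> = (\<Sum>j<n. \<Sum>i. indicator (A j) (U i \<omega>) * e j)"
      by (intro suminf_sum summableI)
    also have "\<dots> = (\<Sum>j<n. N j \<omega> * e j)"
      by (simp add: N_def point_count_suminf)
    finally show ?thesis .
  qed
  have "(\<integral>\<^sup>+\<omega>. enexp (\<Sum>i. h (U i \<omega>)) \<partial>M) = (\<integral>\<^sup>+\<omega>. (\<Prod>j<n. enexp (N j \<omega> * e j)) \<partial>M)"
    by (intro nn_integral_cong) (simp add: sum_eq enexp_sum)
  also have "\<dots> = (\<Prod>j<n. \<integral>\<^sup>+\<omega>. enexp (N j \<omega> * e j) \<partial>M)"
    by (intro indep_vars_nn_integral indep_vars_compose2[OF indep]) auto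
  also have "\<dots> = (\<Prod>j<n. enexp ((1 - enexp (e j)) * emeasure \<mu> (A j)))"
    unfolding N_def by (intro prod.cong refl nn_integral_enexp_point_count assms A)
  also have "\<dots> = enexp (\<Sum>j<n. (1 - enexp (e j)) * emeasure \<mu> (A j))"
    by (simp add: enexp_sum)
  also have "(\<Sum>j<n. (1 - enexp (e j)) * emeasure \<mu> (A j)) = (\<Sum>j<n. \<integral>\<^sup>+x. indicator (A j) x * (1 - enexp (e j)) \<partial>\<mu>)"
    by (simp add: nn_integral_multc mult.commute)
  also have "\<dots> = (\<integral>\<^sup>+x. (\<Sum>j<n. indicator (A j) x * (1 - enexp (e j))) \<partial>\<mu>)"
    by (subst nn_integral_sum) auto
  also have "\<dots> = (\<integral>\<^sup>+x. 1 - enexp (h x) \<partial>\<mu>)"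
    by (intro nn_integral_cong decomp[symmetric])
  finally show ?thesis .
qed

text \<open>Simple functions increase to h. The left side converges by domination by 1, the exponent
  on the right by monotone convergence, both with the continuity of \<open>enexp\<close> on
  [0, \<infinity>].\<close>

lemma laplace_functional:
  fixes U :: "nat \<Rightarrow> 'a \<Rightarrow> 'w"
  assumes "prob_space M" and U: "poisson_process M \<mu> (\<lambda>_. UNIV) U"
    and h [measurable]: "h \<in> borel_measurable \<mu>"
  shows "(\<integral>\<^sup>+\<omega>. enexp (\<Sum>i. h (U i \<omega>)) \<partial>M) = enexp (\<integral>\<^sup>+x. 1 - enexp (h x) \<partial>\<mu>)"
proof -
  interpret prob_space M by fact
  note [measurable] = poisson_process_measurable[OF U]
  obtain s where s: "\<And>n. simple_function \<mu> (s n)" "incseq s" "\<And>n x. s n x < top" "\<And>x. (SUP n. s n x) = h x"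
    by (rule borel_measurable_implies_simple_function_sequence'[OF h]) blast
  have [measurable]: "s n \<in> borel_measurable \<mu>" for n
    using s(1) by (rule borel_measurable_simple_function)
  have inc: "incseq (\<lambda>n. s n x)" for x using s(2) by (auto simp: incseq_def le_fun_def)
  have lim: "(\<lambda>n. s n x) \<longlonglongrightarrow> h x" for x
    using LIMSEQ_SUP[OF inc[of x]] s(4) by simp
  have "(\<lambda>n. \<integral>\<^sup>+\<omega>. enexp (\<Sum>i. s n (U i \<omega>)) \<partial>M) \<longlonglongrightarrow> (\<integral>\<^sup>+\<omega>. enexp (\<Sum>i. h (U i \<omega>)) \<partial>M)"
  proof (rule nn_integral_dominated_convergence[where w="\<lambda>_. 1"])
    show "AE \<omega> in M. (\<lambda>n. enexp (\<Sum>i. s n (U i \<omega>))) \<longlonglongrightarrow> enexp (\<Sum>i. h (U i \<omega>))"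
    proof (intro AE_I2 tendsto_enexp)
      fix \<omega>
      have "(\<Sum>i. h (U i \<omega>)) = (SUP n. \<Sum>i. s n (U i \<omega>))"
        unfolding s(4)[symmetric] by (rule ennreal_suminf_SUP_eq[OF inc])
      moreover have "incseq (\<lambda>n. \<Sum>i. s n (U i \<omega>))"
        using s(2) by (auto simp: incseq_def le_fun_def intro!: suminf_le)
      ultimately show "(\<lambda>n. \<Sum>i. s n (U i \<omega>)) \<longlonglongrightarrow> (\<Sum>i. h (U i \<omega>))"
        using LIMSEQ_SUP by simp
    qed
  qed (auto simp: emeasure_space_1)
  moreover have "(\<lambda>n. \<integral>\<^sup>+\<omega>. enexp (\<Sum>i. s n (U i \<omega>)) \<partial>M) \<longlonglongrightarrow> enexp (\<integral>\<^sup>+x. 1 - enexp (h x) \<partial>\<mu>)"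
    unfolding laplace_functional_simple[OF assms(1) U s(1)]
  proof (intro tendsto_enexp)
    have inc': "incseq (\<lambda>n x. 1 - enexp (s n x))"
      using inc by (auto simp: incseq_def le_fun_def intro!: ennreal_minus_mono enexp_antimono)
    have "(SUP n. 1 - enexp (s n x)) = 1 - enexp (h x)" for x
    proof (rule LIMSEQ_unique)
      show "(\<lambda>n. 1 - enexp (s n x)) \<longlonglongrightarrow> (SUP n. 1 - enexp (s n x))"
        using inc' by (intro LIMSEQ_SUP) (auto simp: incseq_def le_fun_def)
      show "(\<lambda>n. 1 - enexp (s n x)) \<longlonglongrightarrow> 1 - enexp (h x)"
        by (intro tendsto_diff_ennreal tendsto_enexp lim) auto
    qed
    then have "(\<integral>\<^sup>+x. 1 - enexp (h x) \<partial>\<mu>) = (SUP n. \<integral>\<^sup>+x. 1 - enexp (s n x) \<partial>\<mu>)"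
      using nn_integral_monotone_convergence_SUP[OF inc'] by simp
    moreover have "incseq (\<lambda>n. \<integral>\<^sup>+x. 1 - enexp (s n x) \<partial>\<mu>)"
      using inc' by (auto simp: incseq_def le_fun_def intro!: nn_integral_mono)
    ultimately show "(\<lambda>n. \<integral>\<^sup>+x. 1 - enexp (s n x) \<partial>\<mu>) \<longlonglongrightarrow> (\<integral>\<^sup>+x. 1 - enexp (h x) \<partial>\<mu>)"
      using LIMSEQ_SUP by simp
  qed
  ultimately show ?thesis by (rule LIMSEQ_unique)
qed

section \<open>From Laplace functionals back to Poisson counts\<close>

lemma suminf_indicator_power:
  assumes "x = \<infinity> \<or> x \<in> range of_nat" "enexp c < 1"
  shows "(\<Sum>n. indicator {of_nat n} x * enexp c ^ n) = enexp (x * c)"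
proof (cases "x = \<infinity>")
  case True
  \<comment> \<open>An infinite count lies in none of the singletons, and the right side vanishes as
    well because c > 0.\<close>
  have "c \<noteq> 0" using assms(2) by auto
  then show ?thesis using True by (simp add: ennreal_top_mult)
next
  case False
  then obtain k where k: "x = of_nat k" using assms(1) by auto
  have "(\<Sum>n. indicator {of_nat n} x * enexp c ^ n) = (\<Sum>n. if n = k then enexp c ^ n else 0)"
    by (intro suminf_cong) (auto simp: k)
  also have "\<dots> = enexp c ^ k"
    by (subst suminf_finite[of "{k}"]) auto
  finally show ?thesis by (simp add: k enexp_of_nat_mult)
qed

text \<open>Test functions that are constant on disjoint sets \<open>A j\<close> give the joint
  generating function of the counts. Coefficients are extracted one variable at a time, which yields
  the joint law on natural numbers as a product of Poisson weights, and from it every clause of the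
  definition.\<close>

lemma poisson_process_if_laplace:
  fixes U :: "nat \<Rightarrow> 'a \<Rightarrow> 'w"
  assumes "prob_space M" and U [measurable]: "\<And>i. U i \<in> M \<rightarrow>\<^sub>M \<mu>"
    and L: "\<And>g. g \<in> borel_measurable \<mu> \<Longrightarrow>
      (\<integral>\<^sup>+\<omega>. enexp (\<Sum>i. g (U i \<omega>)) \<partial>M) = enexp (\<integral>\<^sup>+x. 1 - enexp (g x) \<partial>\<mu>)"
  shows "poisson_process M \<mu> (\<lambda>_. UNIV) U"
proof -
  interpret prob_space M by fact
  let ?N = "point_count (\<lambda>_. UNIV) U"
  have [measurable]: "?N A \<in> borel_measurable M" if "A \<in> sets \<mu>" for A
    using measurable_point_count[OF U that] .
  have vals: "?N A \<omega> = \<infinity> \<or> ?N A \<omega> \<in> range of_nat" for A \<omega>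
    by (rule point_count_cases[of "\<lambda>_. UNIV" U A \<omega>]) auto
  have gf: "(\<integral>\<^sup>+\<omega>. (\<Prod>j\<in>I. enexp (?N (A j) \<omega> * c j)) \<partial>M) =
      (\<Prod>j\<in>I. enexp ((1 - enexp (c j)) * emeasure \<mu> (A j)))"
    if I: "finite I" and A: "\<And>j. j \<in> I \<Longrightarrow> A j \<in> sets \<mu>" and disj: "disjoint_family_on A I"
    for I :: "nat set" and A c
  proof -
    define g where "g x = (\<Sum>j\<in>I. indicator (A j) x * c j)" for x
    have [measurable]: "g \<in> borel_measurable \<mu>"
      unfolding g_def using A by measurable
    have sum_eq: "(\<Sum>i. g (U i \<omega>)) = (\<Sum>j\<in>I. ?N (A j) \<omega> * c j)" for \<omega>
      unfolding g_def by (subst suminf_sum) (auto simp: point_count_suminf)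
    have g_eq: "1 - enexp (g x) = (\<Sum>j\<in>I. indicator (A j) x * (1 - enexp (c j)))" for x
    proof (cases "\<exists>k\<in>I. x \<in> A k")
      case True
      then obtain k where k: "k \<in> I" "x \<in> A k" by auto
      then have "indicator (A j) x = (if j = k then 1 else 0 :: ennreal)" if "j \<in> I" for j
        using that disj by (auto simp: disjoint_family_on_def indicator_def)
      then have "(\<Sum>j\<in>I. indicator (A j) x * f j) = (\<Sum>j\<in>I. if j = k then f j else 0)" for f :: "nat \<Rightarrow> ennreal"
        by (intro sum.cong) auto
      then show ?thesis using I k by (simp add: g_def)
    next
      case False
      then have "(\<Sum>j\<in>I. indicator (A j) x * f j) = 0" for f :: "nat \<Rightarrow> ennreal"
        by (intro sum.neutral) auto
      then show ?thesis by (simp add: g_def)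
    qed
    have "(\<integral>\<^sup>+\<omega>. (\<Prod>j\<in>I. enexp (?N (A j) \<omega> * c j)) \<partial>M) = enexp (\<integral>\<^sup>+x. 1 - enexp (g x) \<partial>\<mu>)"
      by (subst L[symmetric]) (auto simp: sum_eq enexp_sum)
    also have "(\<integral>\<^sup>+x. 1 - enexp (g x) \<partial>\<mu>) = (\<Sum>j\<in>I. \<integral>\<^sup>+x. indicator (A j) x * (1 - enexp (c j)) \<partial>\<mu>)"
      unfolding g_eq using A by (subst nn_integral_sum) auto
    also have "\<dots> = (\<Sum>j\<in>I. (1 - enexp (c j)) * emeasure \<mu> (A j))"
      using A by (intro sum.cong refl) (simp add: nn_integral_multc mult.commute)
    finally show ?thesis by (simp add: enexp_sum)
  qed
  \<comment> \<open>Interpolates between the generating function (\<open>K\<close> empty) and the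
    joint law (\<open>K = I\<close>): coordinates in \<open>K\<close> already carry events, the
    others still carry exponentials. The weights c stay arbitrary in the induction, because its step
    varies the weight at k.\<close>
  have mixed: "(\<integral>\<^sup>+\<omega>. (\<Prod>j\<in>K. indicator {of_nat (m j)} (?N (A j) \<omega>)) * (\<Prod>j\<in>I - K. enexp (?N (A j) \<omega> * c j)) \<partial>M) =
      (\<Prod>j\<in>K. poisson_weight (emeasure \<mu> (A j)) (m j)) * (\<Prod>j\<in>I - K. enexp ((1 - enexp (c j)) * emeasure \<mu> (A j)))"
    if I: "finite I" and A: "\<And>j. j \<in> I \<Longrightarrow> A j \<in> sets \<mu>" and disj: "disjoint_family_on A I"
      and K: "K \<subseteq> I" for I :: "nat set" and A c K m
    using finite_subset[OF K I] K
  proof (induction K arbitrary: m c rule: finite_induct)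
    case empty
    then show ?case using gf[OF I A disj] by simp
  next
    case (insert k K)
    have k: "k \<in> I" "I - K = insert k (I - insert k K)" "k \<notin> I - insert k K" "finite (I - insert k K)"
      using insert.hyps insert.prems I by auto
    have [measurable]: "?N (A j) \<in> borel_measurable M" if "j \<in> I" for j
      using A that by simp
    define R where "R \<omega> = (\<Prod>j\<in>K. indicator {of_nat (m j)} (?N (A j) \<omega>)) *
      (\<Prod>j\<in>I - insert k K. enexp (?N (A j) \<omega> * c j))" for \<omega>
    define S where "S = (\<Prod>j\<in>K. poisson_weight (emeasure \<mu> (A j)) (m j)) *
      (\<Prod>j\<in>I - insert k K. enexp ((1 - enexp (c j)) * emeasure \<mu> (A j)))"
    have [measurable]: "A j \<in> sets \<mu>" if "j \<in> K \<or> j \<in> I - insert k K" for j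
      using A insert.prems that by auto
    have [measurable]: "R \<in> borel_measurable M"
      unfolding R_def using insert.prems by measurable
    have R_le: "R \<omega> \<le> 1" for \<omega>
      unfolding R_def by (intro mult_le_one prod_le_1) (auto simp: indicator_def)
    define a where "a n = (\<integral>\<^sup>+\<omega>. indicator {of_nat n} (?N (A k) \<omega>) * R \<omega> \<partial>M)" for n :: nat
    \<comment> \<open>With \<open>c k = - ln s\<close> the exponential in the coordinate k becomes a
      power of s, so the induction hypothesis compares two power series in s.\<close>
    have eq: "(\<Sum>n. a n * ennreal s ^ n) = (\<integral>\<^sup>+\<omega>. enexp (?N (A k) \<omega> * ennreal (- ln s)) * R \<omega> \<partial>M)"
      "(\<integral>\<^sup>+\<omega>. enexp (?N (A k) \<omega> * ennreal (- ln s)) * R \<omega> \<partial>M) = enexp ((1 - ennreal s) * emeasure \<mu> (A k)) * S"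
      if s: "0 < s" "s < 1" for s :: real
    proof -
      have es: "enexp (ennreal (- ln s)) = ennreal s"
        using s by (simp add: enexp_ennreal)
      have "(\<Sum>n. a n * ennreal s ^ n) = (\<integral>\<^sup>+\<omega>. (\<Sum>n. indicator {of_nat n} (?N (A k) \<omega>) * R \<omega> * ennreal s ^ n) \<partial>M)"
        unfolding a_def using k(1) by (subst nn_integral_suminf) (auto simp: nn_integral_multc)
      also have "\<dots> = (\<integral>\<^sup>+\<omega>. (\<Sum>n. indicator {of_nat n} (?N (A k) \<omega>) * ennreal s ^ n) * R \<omega> \<partial>M)"
        by (intro nn_integral_cong) (simp add: ac_simps flip: ennreal_suminf_multc)
      finally show "(\<Sum>n. a n * ennreal s ^ n) = (\<integral>\<^sup>+\<omega>. enexp (?N (A k) \<omega> * ennreal (- ln s)) * R \<omega> \<partial>M)"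
        using suminf_indicator_power[OF vals, of "ennreal (- ln s)"] s by (simp add: es)
      let ?c = "c(k := ennreal (- ln s))"
      have "K \<subseteq> I" using insert.prems by auto
      from insert.IH[OF this, of m ?c] have
        "(\<integral>\<^sup>+\<omega>. (\<Prod>j\<in>K. indicator {of_nat (m j)} (?N (A j) \<omega>)) * (enexp (?N (A k) \<omega> * ennreal (- ln s)) * (\<Prod>j\<in>I - insert k K. enexp (?N (A j) \<omega> * ?c j))) \<partial>M) =
        (\<Prod>j\<in>K. poisson_weight (emeasure \<mu> (A j)) (m j)) * (enexp ((1 - ennreal s) * emeasure \<mu> (A k)) * (\<Prod>j\<in>I - insert k K. enexp ((1 - enexp (?c j)) * emeasure \<mu> (A j))))"
        by (simp only: k(2) prod.insert[OF k(4,3)] fun_upd_same es)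
      moreover have "(\<Prod>j\<in>I - insert k K. enexp (?N (A j) \<omega> * ?c j)) = (\<Prod>j\<in>I - insert k K. enexp (?N (A j) \<omega> * c j))" for \<omega>
        by (intro prod.cong) auto
      moreover have "(\<Prod>j\<in>I - insert k K. enexp ((1 - enexp (?c j)) * emeasure \<mu> (A j))) = (\<Prod>j\<in>I - insert k K. enexp ((1 - enexp (c j)) * emeasure \<mu> (A j)))"
        by (intro prod.cong) auto
      ultimately show "(\<integral>\<^sup>+\<omega>. enexp (?N (A k) \<omega> * ennreal (- ln s)) * R \<omega> \<partial>M) = enexp ((1 - ennreal s) * emeasure \<mu> (A k)) * S"
        by (simp add: R_def S_def ac_simps)
    qed
    have "a = (\<lambda>n. S * poisson_weight (emeasure \<mu> (A k)) n)"
    proof (rule ennreal_powser_unique)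
      fix s :: real assume s: "0 < s" "s < 1"
      have "(\<Sum>n. S * poisson_weight (emeasure \<mu> (A k)) n * ennreal s ^ n) = S * enexp ((1 - ennreal s) * emeasure \<mu> (A k))"
        using s suminf_poisson_weight[of s "emeasure \<mu> (A k)"] by (simp add: mult.assoc)
      then show "(\<Sum>n. a n * ennreal s ^ n) = (\<Sum>n. S * poisson_weight (emeasure \<mu> (A k)) n * ennreal s ^ n)"
        using eq[OF s] by (simp add: mult.commute)
      have "(\<integral>\<^sup>+\<omega>. enexp (?N (A k) \<omega> * ennreal (- ln s)) * R \<omega> \<partial>M) \<le> (\<integral>\<^sup>+\<omega>. 1 \<partial>M)"
        by (intro nn_integral_mono mult_le_one R_le) auto
      then show "(\<Sum>n. a n * ennreal s ^ n) < \<infinity>"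
        unfolding eq(1)[OF s] by (simp add: emeasure_space_1 order_le_less_trans)
    qed
    then have "a (m k) = S * poisson_weight (emeasure \<mu> (A k)) (m k)" by simp
    then show ?case
      using insert.hyps unfolding a_def R_def S_def by (simp add: ac_simps)
  qed
  have joint: "emeasure M {\<omega>\<in>space M. \<forall>j\<in>I. ?N (A j) \<omega> = of_nat (m j)} = (\<Prod>j\<in>I. poisson_weight (emeasure \<mu> (A j)) (m j))"
    if I: "finite I" and A: "\<And>j. j \<in> I \<Longrightarrow> A j \<in> sets \<mu>" and disj: "disjoint_family_on A I"
    for I :: "nat set" and A and m :: "nat \<Rightarrow> nat"
  proof -
    have [measurable]: "?N (A j) \<in> borel_measurable M" if "j \<in> I" for j
      using A that by simp
    have "(\<Prod>j\<in>I. indicator {of_nat (m j)} (?N (A j) \<omega>)) = (indicator {\<omega>\<in>space M. \<forall>j\<in>I. ?N (A j) \<omega> = of_nat (m j)} \<omega> :: ennreal)"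
      if "\<omega> \<in> space M" for \<omega>
      using I that by (auto simp: indicator_def prod_eq_1_iff intro!: prod.neutral)
    then have "(\<integral>\<^sup>+\<omega>. (\<Prod>j\<in>I. indicator {of_nat (m j)} (?N (A j) \<omega>)) \<partial>M) =
        (\<integral>\<^sup>+\<omega>. indicator {\<omega>\<in>space M. \<forall>j\<in>I. ?N (A j) \<omega> = of_nat (m j)} \<omega> \<partial>M)"
      by (rule nn_integral_cong)
    also have "\<dots> = emeasure M {\<omega>\<in>space M. \<forall>j\<in>I. ?N (A j) \<omega> = of_nat (m j)}"
      using I by (intro nn_integral_indicator) measurable
    finally have "emeasure M {\<omega>\<in>space M. \<forall>j\<in>I. ?N (A j) \<omega> = of_nat (m j)} = (\<integral>\<^sup>+\<omega>. (\<Prod>j\<in>I. indicator {of_nat (m j)} (?N (A j) \<omega>)) \<partial>M)" ..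
    then show ?thesis
      using mixed[OF I A disj order_refl, of m] by simp
  qed
  have single: "emeasure M {\<omega>\<in>space M. ?N A \<omega> = of_nat n} = poisson_weight (emeasure \<mu> A) n" if "A \<in> sets \<mu>" for A and n :: nat
    using joint[of "{0}" "\<lambda>_. A" "\<lambda>_. n"] that by (simp add: disjoint_family_on_def)
  have law: "measure M {\<omega> \<in> space M. ?N A \<omega> = of_nat n} = exp (- measure \<mu> A) * measure \<mu> A ^ n / fact n"
    if A: "A \<in> sets \<mu>" and fin: "emeasure \<mu> A < \<infinity>" for A and n :: nat
  proof -
    have "emeasure \<mu> A \<noteq> \<top>" using fin by auto
    then show ?thesis using single[OF A, of n] by (simp add: measure_def poisson_weight_def)
  qed
  \<comment> \<open>For infinite mass every weight is 0, so almost surely no natural number is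
    attained.\<close>
  have inf: "AE \<omega> in M. ?N A \<omega> = \<infinity>" if A: "A \<in> sets \<mu>" and inf: "emeasure \<mu> A = \<infinity>" for A
  proof -
    have "AE \<omega> in M. ?N A \<omega> \<noteq> of_nat n" for n
      using single[OF A, of n] A inf by (intro AE_I[OF order_refl]) (auto simp: poisson_weight_def)
    then have "AE \<omega> in M. \<forall>n. ?N A \<omega> \<noteq> of_nat n" by (simp add: AE_all_countable)
    then show ?thesis
    proof eventually_elim
      case (elim \<omega>)
      then show ?case using vals[of A \<omega>] by auto
    qed
  qed
  have indep: "indep_vars (\<lambda>_. borel) (\<lambda>j. ?N (A j)) {..<n}"
    if A: "A ` {..<n} \<subseteq> sets \<mu>" and disj: "disjoint_family_on A {..<n}" for A and n :: nat
  proof (cases "n = 0")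
    case False
    have [measurable]: "?N (A j) \<in> borel_measurable M" if "j < n" for j
      using A that by auto
    \<comment> \<open>The counts are recoded in the countable type \<open>nat option\<close>, with
      \<open>None\<close> for \<infinity>. The sets \<open>{Some k}\<close> generate all subsets,
      and for them \<open>joint\<close> is the product formula; the event of an infinite count
      arises as a complement.\<close>
    define X where "X j \<omega> = (if ?N (A j) \<omega> = \<infinity> then None else Some (SOME k. ?N (A j) \<omega> = of_nat k))" for j \<omega>
    define E where "E = {{}, UNIV} \<union> range (\<lambda>k. {Some (k::nat)})"
    define \<phi> :: "nat option \<Rightarrow> ennreal" where "\<phi> z = (case z of None \<Rightarrow> \<infinity> | Some k \<Rightarrow> of_nat k)" for z
    have X_Some: "X j \<omega> = Some k \<longleftrightarrow> ?N (A j) \<omega> = of_nat k" for j \<omega> k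
    proof (cases "?N (A j) \<omega> = \<infinity>")
      case False
      then obtain k' where k': "?N (A j) \<omega> = of_nat k'" using vals by blast
      then show ?thesis using False by (simp add: X_def)
    qed (auto simp: X_def)
    have NX: "?N (A j) \<omega> = \<phi> (X j \<omega>)" for j \<omega>
    proof (cases "?N (A j) \<omega> = \<infinity>")
      case False
      then obtain k' where k': "?N (A j) \<omega> = of_nat k'" using vals by blast
      then show ?thesis using False by (simp add: X_def \<phi>_def)
    qed (auto simp: X_def \<phi>_def)
    have X_meas: "X j \<in> M \<rightarrow>\<^sub>M count_space UNIV" if j: "j < n" for j
    proof (subst measurable_count_space_eq2_countable)
      show "X j \<in> space M \<rightarrow> UNIV \<and> (\<forall>a\<in>UNIV. X j -` {a} \<inter> space M \<in> sets M)"
      proof (intro conjI ballI)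
        fix a show "X j -` {a} \<inter> space M \<in> sets M"
        proof (cases a)
          case None
          have "X j -` {a} \<inter> space M = {\<omega>\<in>space M. ?N (A j) \<omega> = \<infinity>}"
            by (auto simp: None X_def split: if_splits)
          then show ?thesis using j by simp
        next
          case (Some k)
          have "X j -` {a} \<inter> space M = {\<omega>\<in>space M. ?N (A j) \<omega> = of_nat k}"
            by (auto simp: Some X_Some)
          then show ?thesis using j by simp
        qed
      qed auto
    qed
    have "indep_vars (\<lambda>_. count_space UNIV) X {..<n}"
    proof (subst indep_vars_finite[where E="\<lambda>_. E"])
      show "Int_stable E" by (auto simp: Int_stable_def E_def)
      show "sets (count_space UNIV) = sigma_sets (space (count_space UNIV)) E"
      proof (intro antisym subsetI)
        fix Z :: "nat option set" assume "Z \<in> sets (count_space UNIV)"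
        have sing: "{Some k} \<in> sigma_sets UNIV E" for k by (auto simp: E_def)
        have "(\<Union>k\<in>{k. Some k \<in> Y}. {Some k}) \<in> sigma_sets UNIV E" for Y
        proof -
          interpret sigma_algebra UNIV "sigma_sets UNIV E" by (rule sigma_algebra_sigma_sets) simp
          show ?thesis by (intro countable_UN'') (auto intro: sing)
        qed
        note * = this
        show "Z \<in> sigma_sets (space (count_space UNIV)) E"
        proof (cases "None \<in> Z")
          case False
          then have "Z = (\<Union>k\<in>{k. Some k \<in> Z}. {Some k})"
            by (auto, metis not_None_eq)
          then show ?thesis using *[of Z] by simp
        next
          case True
          have "UNIV - (\<Union>k\<in>{k. Some k \<in> - Z}. {Some k}) \<in> sigma_sets UNIV E"
            by (rule sigma_sets.Compl[OF *])
          also have "UNIV - (\<Union>k\<in>{k. Some k \<in> - Z}. {Some k}) = Z"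
            using True by (auto, metis not_None_eq)
          finally show ?thesis by simp
        qed
      qed auto
      show "\<forall>B\<in>{..<n} \<rightarrow> E. prob (\<Inter>j\<in>{..<n}. X j -` B j \<inter> space M) = (\<Prod>j<n. prob (X j -` B j \<inter> space M))"
      proof
        fix B assume B: "B \<in> {..<n} \<rightarrow> E"
        show "prob (\<Inter>j\<in>{..<n}. X j -` B j \<inter> space M) = (\<Prod>j<n. prob (X j -` B j \<inter> space M))"
        proof (cases "\<exists>j<n. B j = {}")
          case True
          then obtain j where j: "j < n" "B j = {}" by auto
          then have "(\<Inter>j\<in>{..<n}. X j -` B j \<inter> space M) = {}" by blast
          moreover have "(\<Prod>j<n. prob (X j -` B j \<inter> space M)) = 0"
            using j by (intro prod_zero bexI[of _ j]) auto
          ultimately show ?thesis by simp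
        next
          case False
          \<comment> \<open>Indices with \<open>B j = UNIV\<close> impose no condition and
            contribute factors 1, so only those in \<open>I\<close> enter
            \<open>joint\<close>.\<close>
          define I where "I = {j. j < n \<and> B j \<noteq> UNIV}"
          have "\<exists>k. B j = {Some k}" if "j \<in> I" for j
            using B False that by (auto simp: I_def E_def Pi_iff)
          then obtain m where m: "\<And>j. j \<in> I \<Longrightarrow> B j = {Some (m j)}" by metis
          have I: "finite I" "\<And>j. j \<in> I \<Longrightarrow> A j \<in> sets \<mu>" "disjoint_family_on A I"
            using A disj by (auto simp: I_def disjoint_family_on_def)
          have "(\<Inter>j\<in>{..<n}. X j -` B j \<inter> space M) = {\<omega>\<in>space M. \<forall>j<n. X j \<omega> \<in> B j}"
            using \<open>n \<noteq> 0\<close> by auto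
          moreover have "(\<forall>j<n. X j \<omega> \<in> B j) \<longleftrightarrow> (\<forall>j\<in>I. X j \<omega> = Some (m j))" for \<omega>
            using m unfolding I_def by (smt (verit) UNIV_I mem_Collect_eq singleton_iff)
          ultimately have "(\<Inter>j\<in>{..<n}. X j -` B j \<inter> space M) = {\<omega>\<in>space M. \<forall>j\<in>I. ?N (A j) \<omega> = of_nat (m j)}"
            by (simp add: X_Some)
          then have "ennreal (prob (\<Inter>j\<in>{..<n}. X j -` B j \<inter> space M)) = (\<Prod>j\<in>I. poisson_weight (emeasure \<mu> (A j)) (m j))"
            using joint[OF I] by (simp add: emeasure_eq_measure)
          also have "\<dots> = (\<Prod>j\<in>I. ennreal (prob (X j -` B j \<inter> space M)))"
          proof (intro prod.cong refl)
            fix j assume j: "j \<in> I"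
            have "X j -` B j \<inter> space M = {\<omega>\<in>space M. ?N (A j) \<omega> = of_nat (m j)}"
              using m[OF j] X_Some by auto
            then show "poisson_weight (emeasure \<mu> (A j)) (m j) = ennreal (prob (X j -` B j \<inter> space M))"
              using single[OF I(2)[OF j]] by (simp add: emeasure_eq_measure)
          qed
          also have "\<dots> = (\<Prod>j<n. ennreal (prob (X j -` B j \<inter> space M)))"
            by (intro prod.mono_neutral_left) (auto simp: I_def prob_space)
          finally show ?thesis by (simp add: prod_ennreal prod_nonneg)
        qed
      qed
    qed (use False X_meas in \<open>auto simp: E_def\<close>)
    then have "indep_vars (\<lambda>_. borel) (\<lambda>j \<omega>. \<phi> (X j \<omega>)) {..<n}"
      by (rule indep_vars_compose2) auto
    then show ?thesis unfolding NX[symmetric] .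
  qed (simp add: indep_vars_def2 indep_sets_def)
  show ?thesis
    unfolding poisson_process_def
  proof (intro conjI allI ballI impI)
    fix i show "U i \<in> restrict_space M {\<omega> \<in> space M. i \<in> UNIV} \<rightarrow>\<^sub>M \<mu>"
      by (intro measurable_restrict_space1) auto
  qed (use law inf indep in auto)
qed

section \<open>Marking, mapping and pulling back\<close>

text \<open>Inverse of \<open>enexp\<close> on [0, 1]. It brings an averaged factor back into
  exponential form, so that a Laplace functional can be applied to it once more.\<close>

definition enexp_inv :: "ennreal \<Rightarrow> ennreal" where
  "enexp_inv y = (if y = 0 then \<infinity> else ennreal (- ln (enn2real y)))"

lemma enexp_inv: "y \<le> 1 \<Longrightarrow> enexp (enexp_inv y) = y"
proof (cases "y = 0")
  case False
  assume "y \<le> 1"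
  then obtain r where r: "y = ennreal r" "0 < r" "r \<le> 1"
    using False by (cases y) (auto simp: top_unique)
  then show ?thesis
    by (auto simp: enexp_inv_def enexp_ennreal)
qed (auto simp: enexp_inv_def)

lemma measurable_enexp_inv [measurable]: "enexp_inv \<in> borel_measurable borel"
  unfolding enexp_inv_def by measurable

text \<open>Independence gives a product of integrals for finitely many coordinates;
  \<open>enexp_inv\<close> writes it as the exponential of a sum, so that the passage to infinitely
  many coordinates is a limit of sums instead of an infinite product.\<close>

lemma nn_integral_enexp_PiM:
  fixes f :: "nat \<Rightarrow> 's \<Rightarrow> ennreal"
  assumes "prob_space \<kappa>" and [measurable]: "\<And>i. f i \<in> borel_measurable \<kappa>"
  shows "(\<integral>\<^sup>+v. enexp (\<Sum>i. f i (v i)) \<partial>(\<Pi>\<^sub>M i\<in>UNIV. \<kappa>)) =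
    enexp (\<Sum>i. enexp_inv (\<integral>\<^sup>+x. enexp (f i x) \<partial>\<kappa>))"
proof -
  interpret K: prob_space \<kappa> by fact
  define P where "P = (\<Pi>\<^sub>M i\<in>(UNIV::nat set). \<kappa>)"
  interpret P: prob_space P unfolding P_def by (intro prob_space_PiM assms(1))
  have [measurable]: "(\<lambda>v. v i) \<in> P \<rightarrow>\<^sub>M \<kappa>" for i unfolding P_def by simp
  have indep: "P.indep_vars (\<lambda>_. \<kappa>) (\<lambda>i v. v i) UNIV"
  proof (subst P.indep_vars_iff_distr_eq_PiM)
    have "distr P \<kappa> (\<lambda>v. v i) = \<kappa>" for i
      unfolding P_def by (rule distr_PiM_component) (auto simp: assms(1))
    moreover have "distr P (\<Pi>\<^sub>M i\<in>(UNIV::nat set). \<kappa>) (\<lambda>x. \<lambda>i\<in>UNIV. x i) = P"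
      unfolding P_def by (simp add: restrict_UNIV distr_id)
    ultimately show "distr P (\<Pi>\<^sub>M i\<in>(UNIV::nat set). \<kappa>) (\<lambda>x. \<lambda>i\<in>UNIV. x i) = (\<Pi>\<^sub>M i\<in>UNIV. distr P \<kappa> (\<lambda>v. v i))"
      by (simp add: P_def)
  qed auto
  have phi_le: "(\<integral>\<^sup>+x. enexp (f i x) \<partial>\<kappa>) \<le> 1" for i
    using nn_integral_mono[of \<kappa> "\<lambda>x. enexp (f i x)" "\<lambda>_. 1"] by (simp add: K.emeasure_space_1)
  have fin: "(\<integral>\<^sup>+v. enexp (\<Sum>i<n. f i (v i)) \<partial>P) = enexp (\<Sum>i<n. enexp_inv (\<integral>\<^sup>+x. enexp (f i x) \<partial>\<kappa>))" for n
  proof -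
    have "(\<integral>\<^sup>+v. enexp (\<Sum>i<n. f i (v i)) \<partial>P) = (\<integral>\<^sup>+v. (\<Prod>i<n. enexp (f i (v i))) \<partial>P)"
      by (simp add: enexp_sum)
    also have "\<dots> = (\<Prod>i<n. \<integral>\<^sup>+v. enexp (f i (v i)) \<partial>P)"
      by (intro P.indep_vars_nn_integral P.indep_vars_compose2[OF P.indep_vars_subset[OF indep]]) auto
    also have "\<dots> = (\<Prod>i<n. \<integral>\<^sup>+x. enexp (f i x) \<partial>\<kappa>)"
    proof (intro prod.cong refl)
      fix i
      have "(\<integral>\<^sup>+x. enexp (f i x) \<partial>distr P \<kappa> (\<lambda>v. v i)) = (\<integral>\<^sup>+v. enexp (f i (v i)) \<partial>P)"
        by (rule nn_integral_distr) auto
      moreover have "distr P \<kappa> (\<lambda>v. v i) = \<kappa>"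
        unfolding P_def by (rule distr_PiM_component) (auto simp: assms(1))
      ultimately show "(\<integral>\<^sup>+v. enexp (f i (v i)) \<partial>P) = (\<integral>\<^sup>+x. enexp (f i x) \<partial>\<kappa>)" by simp
    qed
    finally show ?thesis by (simp add: enexp_sum enexp_inv phi_le)
  qed
  have lim: "(\<lambda>n. \<Sum>i<n. g i) \<longlonglongrightarrow> (\<Sum>i. g i)" for g :: "nat \<Rightarrow> ennreal"
    by (rule summable_LIMSEQ) simp
  have "(\<lambda>n. \<integral>\<^sup>+v. enexp (\<Sum>i<n. f i (v i)) \<partial>P) \<longlonglongrightarrow> (\<integral>\<^sup>+v. enexp (\<Sum>i. f i (v i)) \<partial>P)"
    by (rule nn_integral_dominated_convergence[where w="\<lambda>_. 1"])
      (auto simp: P.emeasure_space_1 intro!: tendsto_enexp lim)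
  moreover have "(\<lambda>n. \<integral>\<^sup>+v. enexp (\<Sum>i<n. f i (v i)) \<partial>P) \<longlonglongrightarrow> enexp (\<Sum>i. enexp_inv (\<integral>\<^sup>+x. enexp (f i x) \<partial>\<kappa>))"
    unfolding fin by (intro tendsto_enexp lim)
  ultimately show ?thesis unfolding P_def by (rule LIMSEQ_unique)
qed

text \<open>Given the points, the independent marks integrate out to factors
  \<open>\<phi> (U i)\<close>, where \<open>\<phi> x\<close> averages
  \<open>enexp (g (x, v))\<close> over a mark v. The Laplace functional of the points at
  \<open>enexp_inv (\<phi> x)\<close> has the exponent \<open>\<integral> 1 - \<phi>\<close>, and
  this is the exponent that belongs to the product intensity.\<close>

lemma poisson_process_marking:
  fixes U :: "nat \<Rightarrow> 'a \<Rightarrow> 'e" and V :: "nat \<Rightarrow> 'a \<Rightarrow> 's"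
  assumes "prob_space M" and U: "poisson_process M \<nu> (\<lambda>_. UNIV) U"
    and V: "prob_space.indep_vars M (\<lambda>_. \<kappa>) V UNIV" "\<And>i. distr M \<kappa> (V i) = \<kappa>"
    and UV: "distr M ((\<Pi>\<^sub>M i\<in>UNIV. \<nu>) \<Otimes>\<^sub>M (\<Pi>\<^sub>M i\<in>UNIV. \<kappa>)) (\<lambda>\<omega>. (\<lambda>i. U i \<omega>, \<lambda>i. V i \<omega>)) =
      distr M (\<Pi>\<^sub>M i\<in>UNIV. \<nu>) (\<lambda>\<omega> i. U i \<omega>) \<Otimes>\<^sub>M distr M (\<Pi>\<^sub>M i\<in>UNIV. \<kappa>) (\<lambda>\<omega> i. V i \<omega>)"
  shows "poisson_process M (\<nu> \<Otimes>\<^sub>M \<kappa>) (\<lambda>_. UNIV) (\<lambda>i \<omega>. (U i \<omega>, V i \<omega>))"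
proof -
  interpret prob_space M by fact
  have Vm [measurable]: "V i \<in> M \<rightarrow>\<^sub>M \<kappa>" for i
    using V(1) by (auto simp: indep_vars_def2)
  note Um [measurable] = poisson_process_measurable[OF U]
  have "prob_space \<kappa>"
    using prob_space_distr[OF Vm[of 0]] unfolding V(2) .
  then interpret K: prob_space \<kappa> .
  define PU where "PU = distr M (\<Pi>\<^sub>M i\<in>UNIV. \<nu>) (\<lambda>\<omega> i. U i \<omega>)"
  define PV where "PV = (\<Pi>\<^sub>M i\<in>(UNIV::nat set). \<kappa>)"
  have Us [measurable]: "(\<lambda>\<omega> i. U i \<omega>) \<in> M \<rightarrow>\<^sub>M (\<Pi>\<^sub>M i\<in>UNIV. \<nu>)" and Vs [measurable]: "(\<lambda>\<omega> i. V i \<omega>) \<in> M \<rightarrow>\<^sub>M (\<Pi>\<^sub>M i\<in>UNIV. \<kappa>)"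
    by (auto intro!: measurable_abs_UNIV Um Vm)
  have PV: "distr M (\<Pi>\<^sub>M i\<in>UNIV. \<kappa>) (\<lambda>\<omega> i. V i \<omega>) = PV"
    using indep_vars_iff_distr_eq_PiM[of UNIV V "\<lambda>_. \<kappa>"] V(1) unfolding PV_def
    by (simp add: V(2) restrict_UNIV)
  interpret PV: prob_space PV unfolding PV_def by (intro prob_space_PiM K.prob_space_axioms)
  have joint: "distr M ((\<Pi>\<^sub>M i\<in>UNIV. \<nu>) \<Otimes>\<^sub>M (\<Pi>\<^sub>M i\<in>UNIV. \<kappa>)) (\<lambda>\<omega>. (\<lambda>i. U i \<omega>, \<lambda>i. V i \<omega>)) = PU \<Otimes>\<^sub>M PV"
    using UV unfolding PV PU_def by simp
  have sets [measurable_cong, simp]: "sets PU = sets (\<Pi>\<^sub>M i\<in>UNIV. \<nu>)" "sets PV = sets (\<Pi>\<^sub>M i\<in>UNIV. \<kappa>)"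
    by (auto simp: PU_def PV_def)
  show ?thesis
  proof (rule poisson_process_if_laplace[OF assms(1)])
    fix g :: "'e \<times> 's \<Rightarrow> ennreal" assume g [measurable]: "g \<in> borel_measurable (\<nu> \<Otimes>\<^sub>M \<kappa>)"
    define \<phi> where "\<phi> x = (\<integral>\<^sup>+v. enexp (g (x, v)) \<partial>\<kappa>)" for x
    have [measurable]: "\<phi> \<in> borel_measurable \<nu>"
      unfolding \<phi>_def by measurable
    have phi_le: "\<phi> x \<le> 1" for x
      unfolding \<phi>_def using nn_integral_mono[of \<kappa> "\<lambda>v. enexp (g (x, v))" "\<lambda>_. 1"] by (simp add: K.emeasure_space_1)
    have G [measurable]: "(\<lambda>(u, v). enexp (\<Sum>i. g (u i, v i))) \<in> borel_measurable ((\<Pi>\<^sub>M i\<in>UNIV. \<nu>) \<Otimes>\<^sub>M (\<Pi>\<^sub>M i\<in>UNIV. \<kappa>))"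
      by measurable
    have "(\<integral>\<^sup>+\<omega>. enexp (\<Sum>i. g (U i \<omega>, V i \<omega>)) \<partial>M) = (\<integral>\<^sup>+(u, v). enexp (\<Sum>i. g (u i, v i)) \<partial>(PU \<Otimes>\<^sub>M PV))"
      unfolding joint[symmetric] by (subst nn_integral_distr) auto
    also have "\<dots> = (\<integral>\<^sup>+u. \<integral>\<^sup>+v. enexp (\<Sum>i. g (u i, v i)) \<partial>PV \<partial>PU)"
      by (subst PV.nn_integral_fst[symmetric]) auto
    also have "\<dots> = (\<integral>\<^sup>+u. enexp (\<Sum>i. enexp_inv (\<phi> (u i))) \<partial>PU)"
    proof (intro nn_integral_cong)
      fix u assume "u \<in> space PU"
      then have u: "u i \<in> space \<nu>" for i
        by (auto simp: PU_def space_PiM)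
      show "(\<integral>\<^sup>+v. enexp (\<Sum>i. g (u i, v i)) \<partial>PV) = enexp (\<Sum>i. enexp_inv (\<phi> (u i)))"
        unfolding PV_def \<phi>_def using u
        by (intro nn_integral_enexp_PiM[of \<kappa> "\<lambda>i x. g (u i, x)"] K.prob_space_axioms) simp
    qed
    also have "\<dots> = (\<integral>\<^sup>+\<omega>. enexp (\<Sum>i. enexp_inv (\<phi> (U i \<omega>))) \<partial>M)"
      unfolding PU_def by (subst nn_integral_distr) auto
    also have "\<dots> = enexp (\<integral>\<^sup>+x. 1 - enexp (enexp_inv (\<phi> x)) \<partial>\<nu>)"
      by (rule laplace_functional[OF assms(1) U]) simp
    also have "(\<integral>\<^sup>+x. 1 - enexp (enexp_inv (\<phi> x)) \<partial>\<nu>) = (\<integral>\<^sup>+x. \<integral>\<^sup>+v. 1 - enexp (g (x, v)) \<partial>\<kappa> \<partial>\<nu>)"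
    proof (intro nn_integral_cong)
      fix x assume [simp]: "x \<in> space \<nu>"
      have "(\<integral>\<^sup>+v. 1 - enexp (g (x, v)) \<partial>\<kappa>) = (\<integral>\<^sup>+v. 1 \<partial>\<kappa>) - \<phi> x"
        unfolding \<phi>_def using phi_le[of x]
        by (intro nn_integral_diff) (auto simp: \<phi>_def top_unique)
      then show "1 - enexp (enexp_inv (\<phi> x)) = (\<integral>\<^sup>+v. 1 - enexp (g (x, v)) \<partial>\<kappa>)"
        by (simp add: enexp_inv phi_le K.emeasure_space_1)
    qed
    also have "\<dots> = (\<integral>\<^sup>+z. 1 - enexp (g z) \<partial>(\<nu> \<Otimes>\<^sub>M \<kappa>))"
      by (subst K.nn_integral_fst) auto
    finally show "(\<integral>\<^sup>+\<omega>. enexp (\<Sum>i. g (U i \<omega>, V i \<omega>)) \<partial>M) = enexp (\<integral>\<^sup>+z. 1 - enexp (g z) \<partial>(\<nu> \<Otimes>\<^sub>M \<kappa>))" .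
  qed simp
qed

lemma poisson_process_map:
  fixes U :: "nat \<Rightarrow> 'a \<Rightarrow> 'w" and F :: "'w \<Rightarrow> 'v"
  assumes "prob_space M" and U: "poisson_process M \<mu> (\<lambda>_. UNIV) U" and [measurable]: "F \<in> \<mu> \<rightarrow>\<^sub>M \<mu>'"
  shows "poisson_process M (distr \<mu> \<mu>' F) (\<lambda>_. UNIV) (\<lambda>i \<omega>. F (U i \<omega>))"
proof (rule poisson_process_if_laplace[OF assms(1)])
  note [measurable] = poisson_process_measurable[OF U]
  fix g :: "'v \<Rightarrow> ennreal" assume "g \<in> borel_measurable (distr \<mu> \<mu>' F)"
  then have [measurable]: "g \<in> borel_measurable \<mu>'" by simp
  show "(\<integral>\<^sup>+\<omega>. enexp (\<Sum>i. g (F (U i \<omega>))) \<partial>M) = enexp (\<integral>\<^sup>+x. 1 - enexp (g x) \<partial>distr \<mu> \<mu>' F)"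
    by (subst laplace_functional[OF assms(1) U, of "\<lambda>x. g (F x)"]) (auto simp: nn_integral_distr)
next
  note [measurable] = poisson_process_measurable[OF U]
  show "(\<lambda>\<omega>. F (U i \<omega>)) \<in> M \<rightarrow>\<^sub>M distr \<mu> \<mu>' F" for i by simp
qed

text \<open>Being a Poisson process depends only on the joint law of the points, as the Laplace
  functional does. This permits a change of the probability space: to sequences of optional points
  for the spectral representation, and to a product space for the thinning.\<close>

lemma poisson_process_distr_iff:
  fixes U :: "nat \<Rightarrow> 'b \<Rightarrow> 'w"
  assumes "prob_space M" and [measurable]: "\<phi> \<in> M \<rightarrow>\<^sub>M N" and [measurable]: "\<And>i. U i \<in> N \<rightarrow>\<^sub>M \<mu>"
  shows "poisson_process (distr M N \<phi>) \<mu> (\<lambda>_. UNIV) U \<longleftrightarrow> poisson_process M \<mu> (\<lambda>_. UNIV) (\<lambda>i \<omega>. U i (\<phi> \<omega>))"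
proof -
  have P: "prob_space (distr M N \<phi>)" by (rule prob_space.prob_space_distr) fact+
  have eq: "(\<integral>\<^sup>+\<omega>. enexp (\<Sum>i. g (U i \<omega>)) \<partial>distr M N \<phi>) = (\<integral>\<^sup>+\<omega>. enexp (\<Sum>i. g (U i (\<phi> \<omega>))) \<partial>M)"
    if [measurable]: "g \<in> borel_measurable \<mu>" for g
    by (subst nn_integral_distr) auto
  show ?thesis
  proof
    assume "poisson_process (distr M N \<phi>) \<mu> (\<lambda>_. UNIV) U"
    from laplace_functional[OF P this] show "poisson_process M \<mu> (\<lambda>_. UNIV) (\<lambda>i \<omega>. U i (\<phi> \<omega>))"
      by (intro poisson_process_if_laplace assms(1)) (auto simp: eq)
  next
    assume "poisson_process M \<mu> (\<lambda>_. UNIV) (\<lambda>i \<omega>. U i (\<phi> \<omega>))"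
    from laplace_functional[OF assms(1) this] show "poisson_process (distr M N \<phi>) \<mu> (\<lambda>_. UNIV) U"
      by (intro poisson_process_if_laplace P) (auto simp: eq)
  qed
qed

lemma poisson_process_reindex:
  assumes "poisson_process M \<mu> (\<lambda>_. UNIV) U" and b: "bij (b :: 'j::countable \<Rightarrow> 'i::countable)"
  shows "poisson_process M \<mu> (\<lambda>_. UNIV) (\<lambda>j. U (b j))"
proof -
  have "point_count (\<lambda>_. UNIV) (\<lambda>j. U (b j)) A \<omega> = point_count (\<lambda>_. UNIV) U A \<omega>" for A \<omega>
  proof -
    have "bij_betw b {j. U (b j) \<omega> \<in> A} {i. U i \<omega> \<in> A}"
      using b by (auto simp: bij_betw_def bij_def inj_on_def surj_def image_iff)
    then show ?thesis
      by (auto simp: point_count_def emeasure_count_space dest: bij_betw_finite bij_betw_same_card)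
  qed
  then have "point_count (\<lambda>_. UNIV) (\<lambda>j. U (b j)) = point_count (\<lambda>_. UNIV) U"
    by (intro ext)
  then show ?thesis
    using assms(1) unfolding poisson_process_def by auto
qed

section \<open>Brownian motion\<close>

lemma sorted_enumeration:
  fixes J :: "real set"
  assumes "finite J" "J \<noteq> {}"
  obtains \<tau> :: "nat \<Rightarrow> real" and n where "strict_mono_on {..n} \<tau>" "\<tau> ` {..n} = J" "card J = Suc n"
proof -
  define xs where "xs = sorted_list_of_set J"
  have xs: "sorted_wrt (<) xs" "set xs = J" "length xs = card J"
    using assms by (auto simp: xs_def)
  have len: "length xs = Suc (card J - 1)"
    using assms xs(3) by (simp add: card_gt_0_iff)
  have "strict_mono_on {..card J - 1} ((!) xs)"
    using xs(1) len by (auto intro!: strict_mono_onI simp: sorted_wrt_iff_nth_less)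
  moreover have "(!) xs ` {..card J - 1} = J"
    using xs(2) len by (auto simp: set_conv_nth image_iff less_Suc_eq_le)
  ultimately show ?thesis using that len xs(3) by metis
qed

abbreviation gauss_density :: "real \<Rightarrow> real ^ 'k::finite \<Rightarrow> ennreal" where
  "gauss_density v x \<equiv> ennreal (\<Prod>i\<in>UNIV. normal_density 0 (sqrt v) (x $ i))"

lemma bm_measurable: "standard_brownian_motion M W \<Longrightarrow> W t \<in> borel_measurable M"
  by (auto simp: standard_brownian_motion_def)

text \<open>As W vanishes at time 0, its value at j is the sum of the increments up to j minus the
  sum of those up to time 0; this treats negative and positive times alike. The right side involves
  only Gaussian laws and not W, and therefore determines the law of the path.\<close>

lemma bm_emeasure_cylinder:
  fixes W :: "real \<Rightarrow> 'a \<Rightarrow> real ^ 'k::finite"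
  assumes "prob_space M" and bm: "standard_brownian_motion M W"
    and \<tau>: "strict_mono_on {..n} \<tau>" "0 < n" and m: "m \<le> n" "\<tau> m = 0"
    and J: "finite J" "\<And>j. j \<in> J \<Longrightarrow> idx j \<le> n \<and> \<tau> (idx j) = j"
    and A [measurable]: "\<And>j. j \<in> J \<Longrightarrow> A j \<in> sets borel"
  shows "emeasure M {\<omega>\<in>space M. \<forall>j\<in>J. W j \<omega> \<in> A j} =
    emeasure (\<Pi>\<^sub>M i\<in>{..<n}. density lborel (gauss_density (\<tau> (Suc i) - \<tau> i)))
      {x\<in>space (\<Pi>\<^sub>M i\<in>{..<n}. borel). \<forall>j\<in>J. (\<Sum>i<idx j. x i) - (\<Sum>i<m. x i) \<in> A j}"
proof -
  interpret prob_space M by fact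
  note [measurable] = bm_measurable[OF bm]
  define \<Delta> where "\<Delta> i \<omega> = W (\<tau> (Suc i)) \<omega> - W (\<tau> i) \<omega>" for i \<omega>
  have [measurable]: "\<Delta> i \<in> borel_measurable M" for i
    unfolding \<Delta>_def by measurable
  let ?D = "\<Pi>\<^sub>M i\<in>{..<n}. density lborel (gauss_density (\<tau> (Suc i) - \<tau> i) :: real ^ 'k \<Rightarrow> _)"
  let ?S = "{x\<in>space (\<Pi>\<^sub>M i\<in>{..<n}. borel :: (real ^ 'k) measure). \<forall>j\<in>J. (\<Sum>i<idx j. x i) - (\<Sum>i<m. x i) \<in> A j}"
  have "indep_vars (\<lambda>_. borel) \<Delta> {..<n}"
    using bm \<tau>(1) unfolding standard_brownian_motion_def \<Delta>_def by blast
  then have "distr M (\<Pi>\<^sub>M i\<in>{..<n}. borel) (\<lambda>\<omega>. \<lambda>i\<in>{..<n}. \<Delta> i \<omega>) = (\<Pi>\<^sub>M i\<in>{..<n}. distr M borel (\<Delta> i))"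
    using \<tau>(2) by (subst (asm) indep_vars_iff_distr_eq_PiM) auto
  also have "\<dots> = ?D"
  proof (intro PiM_cong refl)
    fix i assume "i \<in> {..<n}"
    then have "\<tau> i < \<tau> (Suc i)"
      using \<tau>(1) by (auto simp: strict_mono_on_def)
    then have "distributed M lborel (\<Delta> i) (gauss_density (\<tau> (Suc i) - \<tau> i))"
      using bm unfolding standard_brownian_motion_def \<Delta>_def by blast
    then have "distr M lborel (\<Delta> i) = density lborel (gauss_density (\<tau> (Suc i) - \<tau> i))"
      by (rule distributed_distr_eq_density)
    then show "distr M borel (\<Delta> i) = density lborel (gauss_density (\<tau> (Suc i) - \<tau> i))"
      by (metis distr_cong sets_lborel)
  qed
  finally have law: "distr M (\<Pi>\<^sub>M i\<in>{..<n}. borel) (\<lambda>\<omega>. \<lambda>i\<in>{..<n}. \<Delta> i \<omega>) = ?D" .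
  have S: "?S \<in> sets (\<Pi>\<^sub>M i\<in>{..<n}. borel)"
  proof -
    have "(\<lambda>x. \<Sum>i<k. x i) \<in> borel_measurable (\<Pi>\<^sub>M i\<in>{..<n}. borel :: (real ^ 'k) measure)" if "k \<le> n" for k
      using that by (intro borel_measurable_sum measurable_component_singleton) auto
    then have f: "(\<lambda>x. (\<Sum>i<idx j. x i) - (\<Sum>i<m. x i)) \<in> borel_measurable (\<Pi>\<^sub>M i\<in>{..<n}. borel :: (real ^ 'k) measure)" if "j \<in> J" for j
      using J(2)[OF that] m(1) by (intro borel_measurable_diff) auto
    have "{x\<in>space (\<Pi>\<^sub>M i\<in>{..<n}. borel :: (real ^ 'k) measure). (\<Sum>i<idx j. x i) - (\<Sum>i<m. x i) \<in> A j} \<in> sets (\<Pi>\<^sub>M i\<in>{..<n}. borel)" if "j \<in> J" for j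
      using measurable_sets[OF f[OF that] A[OF that]] by (simp add: vimage_def Int_def conj_commute)
    then show ?thesis
      using J(1) by (intro sets.sets_Collect_finite_All) auto
  qed
  have \<Delta>_meas: "(\<lambda>\<omega>. \<lambda>i\<in>{..<n}. \<Delta> i \<omega>) \<in> M \<rightarrow>\<^sub>M (\<Pi>\<^sub>M i\<in>{..<n}. borel)"
    by (intro measurable_restrict) simp
  have "AE \<omega> in M. W 0 \<omega> = 0"
    using bm by (auto simp: standard_brownian_motion_def)
  then have "emeasure M {\<omega>\<in>space M. \<forall>j\<in>J. W j \<omega> \<in> A j} =
      emeasure M ((\<lambda>\<omega>. \<lambda>i\<in>{..<n}. \<Delta> i \<omega>) -` ?S \<inter> space M)"
  proof (intro emeasure_eq_AE, eventually_elim)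
    case (elim \<omega>)
    have "(\<Sum>i<k. (\<lambda>i\<in>{..<n}. \<Delta> i \<omega>) i) = W (\<tau> k) \<omega> - W (\<tau> 0) \<omega>" if "k \<le> n" for k
    proof -
      have "(\<Sum>i<k. (\<lambda>i\<in>{..<n}. \<Delta> i \<omega>) i) = (\<Sum>i<k. W (\<tau> (Suc i)) \<omega> - W (\<tau> i) \<omega>)"
        using that by (intro sum.cong) (auto simp: \<Delta>_def)
      then show ?thesis using sum_lessThan_telescope[of "\<lambda>i. W (\<tau> i) \<omega>" k] by simp
    qed
    then have "(\<Sum>i<idx j. (\<lambda>i\<in>{..<n}. \<Delta> i \<omega>) i) - (\<Sum>i<m. (\<lambda>i\<in>{..<n}. \<Delta> i \<omega>) i) = W j \<omega>" if "j \<in> J" for j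
      using J(2)[OF that] m elim by simp
    then show ?case by (auto simp: space_PiM)
  next
    show "{\<omega>\<in>space M. \<forall>j\<in>J. W j \<omega> \<in> A j} \<in> sets M"
      using J(1) by measurable
    show "(\<lambda>\<omega>. \<lambda>i\<in>{..<n}. \<Delta> i \<omega>) -` ?S \<inter> space M \<in> sets M"
      using S by (rule measurable_sets[rotated]) measurable
  qed
  also have "\<dots> = emeasure ?D ?S"
    unfolding law[symmetric] by (rule emeasure_distr[OF \<Delta>_meas S, symmetric])
  finally show ?thesis .
qed

lemma bm_path_measurable:
  fixes W :: "real \<Rightarrow> 'a \<Rightarrow> real ^ 'k::finite"
  assumes "standard_brownian_motion M W"
  shows "(\<lambda>\<omega> t. W t \<omega>) \<in> M \<rightarrow>\<^sub>M (\<Pi>\<^sub>M t\<in>UNIV. borel)"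
  by (intro measurable_abs_UNIV bm_measurable[OF assms])

lemma emeasure_distr_cylinder:
  assumes "(\<lambda>\<omega> t. V t \<omega>) \<in> N \<rightarrow>\<^sub>M (\<Pi>\<^sub>M t\<in>UNIV. borel)" "{w. \<forall>j\<in>J. w j \<in> A j} \<in> sets (\<Pi>\<^sub>M t\<in>UNIV. borel)"
  shows "emeasure (distr N (\<Pi>\<^sub>M t\<in>UNIV. borel) (\<lambda>\<omega> t. V t \<omega>)) {w. \<forall>j\<in>J. w j \<in> A j} =
    emeasure N {\<omega>\<in>space N. \<forall>j\<in>J. V j \<omega> \<in> A j}"
  using assms by (subst emeasure_distr) (auto intro!: arg_cong2[where f=emeasure])

lemma bm_law_unique:
  fixes W W' :: "real \<Rightarrow> _ \<Rightarrow> real ^ 'k::finite"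
  assumes "prob_space M" "standard_brownian_motion M W"
    and "prob_space M'" "standard_brownian_motion M' W'"
  shows "distr M (\<Pi>\<^sub>M t\<in>UNIV. borel) (\<lambda>\<omega> t. W t \<omega>) = distr M' (\<Pi>\<^sub>M t\<in>UNIV. borel) (\<lambda>\<omega> t. W' t \<omega>)"
proof (rule measure_eqI_PiM_infinite[where I=UNIV and M="\<lambda>_. borel"])
  note [measurable] = bm_path_measurable[OF assms(2)] bm_path_measurable[OF assms(4)]
  fix J :: "real set" and A :: "real \<Rightarrow> (real ^ 'k) set"
  assume J: "finite J" and A: "\<And>i. i \<in> J \<Longrightarrow> A i \<in> sets borel"
  \<comment> \<open>The time 0 anchors the path, and the time 1 guarantees at least one
    increment.\<close>
  obtain \<tau> n where \<tau>: "strict_mono_on {..n} \<tau>" "\<tau> ` {..n} = insert 0 (insert 1 J)" "card (insert 0 (insert 1 J)) = Suc n"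
    using sorted_enumeration[of "insert 0 (insert 1 J)"] J by (metis finite_insert insert_not_empty)
  have "card {0, 1::real} \<le> card (insert 0 (insert 1 J))"
    using J by (intro card_mono) auto
  then have n: "0 < n" using \<tau>(3) by simp
  have "0 \<in> \<tau> ` {..n}" using \<tau>(2) by simp
  then obtain m where m: "m \<le> n" "\<tau> m = 0" by auto
  have "\<forall>j\<in>J. \<exists>i. i \<le> n \<and> \<tau> i = j"
  proof
    fix j assume "j \<in> J"
    then have "j \<in> \<tau> ` {..n}" using \<tau>(2) by simp
    then show "\<exists>i. i \<le> n \<and> \<tau> i = j" by auto
  qed
  then obtain idx where idx: "\<And>j. j \<in> J \<Longrightarrow> idx j \<le> n \<and> \<tau> (idx j) = j" by metis
  have *: "prod_emb UNIV (\<lambda>_. borel) J (Pi\<^sub>E J A) = {w. \<forall>j\<in>J. w j \<in> A j}"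
    by (auto simp: prod_emb_def space_PiM PiE_iff restrict_def extensional_def)
  have **: "{w. \<forall>j\<in>J. w j \<in> A j} \<in> sets (\<Pi>\<^sub>M t\<in>UNIV. borel)"
    unfolding *[symmetric] using J A by (intro sets_PiM_I) auto
  show "emeasure (distr M (\<Pi>\<^sub>M t\<in>UNIV. borel) (\<lambda>\<omega> t. W t \<omega>)) (prod_emb UNIV (\<lambda>_. borel) J (Pi\<^sub>E J A)) =
      emeasure (distr M' (\<Pi>\<^sub>M t\<in>UNIV. borel) (\<lambda>\<omega> t. W' t \<omega>)) (prod_emb UNIV (\<lambda>_. borel) J (Pi\<^sub>E J A))"
    unfolding * emeasure_distr_cylinder[OF bm_path_measurable[OF assms(2)] **] emeasure_distr_cylinder[OF bm_path_measurable[OF assms(4)] **]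
    by (rule trans[OF bm_emeasure_cylinder[OF assms(1,2) \<tau>(1) n m J idx A]
          bm_emeasure_cylinder[OF assms(3,4) \<tau>(1) n m J idx A, symmetric]])
next
  interpret M: prob_space M by fact
  show "finite_measure (distr M (\<Pi>\<^sub>M t\<in>UNIV. borel) (\<lambda>\<omega> t. W t \<omega>))"
    using M.prob_space_distr[OF bm_path_measurable[OF assms(2)]] by (simp add: prob_space_def)
qed auto

text \<open>Combined with the uniqueness of the law, it gives the invariance of the path measure
  under the shift and the restart of the random walk in the recurrence argument.\<close>

lemma bm_shift:
  fixes W :: "real \<Rightarrow> 'a \<Rightarrow> real ^ 'k::finite"
  assumes "standard_brownian_motion M W"
  shows "standard_brownian_motion M (\<lambda>t \<omega>. W (t + s) \<omega> - W s \<omega>)"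
  unfolding standard_brownian_motion_def
proof (intro conjI allI impI)
  note [measurable] = bm_measurable[OF assms]
  show "(\<lambda>\<omega>. W (t + s) \<omega> - W s \<omega>) \<in> borel_measurable M" for t by measurable
  have "AE \<omega> in M. continuous_on UNIV (\<lambda>t. W t \<omega>)"
    using assms by (auto simp: standard_brownian_motion_def)
  then show "AE \<omega> in M. continuous_on UNIV (\<lambda>t. W (t + s) \<omega> - W s \<omega>)"
  proof eventually_elim
    case (elim \<omega>)
    have "continuous_on UNIV (\<lambda>t. W (t + s) \<omega>)"
      by (rule continuous_on_compose2[OF elim]) (auto intro!: continuous_intros)
    then show ?case by (intro continuous_intros)
  qed
  show "distributed M lborel (\<lambda>\<omega>. W (t + s) \<omega> - W s \<omega> - (W (u + s) \<omega> - W s \<omega>)) (gauss_density (t - u))"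
    if "u < t" for u t
  proof -
    have "distributed M lborel (\<lambda>\<omega>. W (t + s) \<omega> - W (u + s) \<omega>) (gauss_density ((t + s) - (u + s)))"
      using assms that unfolding standard_brownian_motion_def by (meson add_strict_right_mono)
    then show ?thesis by simp
  qed
  show "prob_space.indep_vars M (\<lambda>_. borel) (\<lambda>j \<omega>. W (\<tau> (Suc j) + s) \<omega> - W s \<omega> - (W (\<tau> j + s) \<omega> - W s \<omega>)) {..<n}"
    if "strict_mono_on {..n} \<tau>" for \<tau> :: "nat \<Rightarrow> real" and n
  proof -
    have "strict_mono_on {..n} (\<lambda>j. \<tau> j + s)"
      using that by (auto simp: strict_mono_on_def)
    then have "prob_space.indep_vars M (\<lambda>_. borel) (\<lambda>j \<omega>. W (\<tau> (Suc j) + s) \<omega> - W (\<tau> j + s) \<omega>) {..<n}"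
      using assms unfolding standard_brownian_motion_def by blast
    then show ?thesis by simp
  qed
qed simp

section \<open>Coded paths and the shift flow\<close>

text \<open>The index n enumerates integer numerator m, dyadic level j and coordinate i. A dyadic
  time occurs at infinitely many levels; this redundancy is harmless, since the path measure will be
  an image under this map.\<close>

definition path_code :: "(real \<Rightarrow> real ^ 'k::finite) \<Rightarrow> nat \<Rightarrow> real" where
  "path_code p n = (case from_nat n of ((m::int, j::nat), i::'k) \<Rightarrow> p (of_int m / 2 ^ j) $ i)"

text \<open>The dyadic times below s converge to s, so a continuous path is recovered from its code.
  On other sequences \<open>lim\<close> still has some value, which keeps the evaluation total and
  measurable.\<close>

definition path_eval :: "(nat \<Rightarrow> real) \<Rightarrow> real \<Rightarrow> real ^ 'k::finite" where
  "path_eval x s = lim (\<lambda>j. \<chi> i. x (to_nat ((\<lfloor>2 ^ j * s\<rfloor>, j), i)))"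

text \<open>Decoding and recoding is guaranteed to return x only for codes of continuous paths,
  whereas a flow must fix every x at time 0; hence the separate case. The type argument fixes the
  dimension, which a code does not show.\<close>

definition path_shift :: "'k::finite itself \<Rightarrow> real \<Rightarrow> (nat \<Rightarrow> real) \<Rightarrow> nat \<Rightarrow> real" where
  "path_shift _ t x = (if t = 0 then x else path_code (\<lambda>s. path_eval x (s + t) :: real ^ 'k))"

lemma path_code_to_nat: "path_code p (to_nat ((m, j), i)) = p (of_int m / 2 ^ j) $ i"
  by (simp add: path_code_def)

lemma dyadic_floor_tendsto: "(\<lambda>j. of_int \<lfloor>2 ^ j * s\<rfloor> / 2 ^ j) \<longlonglongrightarrow> (s::real)"
proof (rule tendsto_sandwich[where f="\<lambda>j. s - (1 / 2) ^ j" and h="\<lambda>_. s"])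
  show "(\<lambda>j. s - (1 / 2) ^ j) \<longlonglongrightarrow> s"
    using tendsto_diff[OF tendsto_const LIMSEQ_realpow_zero[of "1 / 2"], of s] by simp
  show "\<forall>\<^sub>F j in sequentially. s - (1 / 2) ^ j \<le> of_int \<lfloor>2 ^ j * s\<rfloor> / 2 ^ j"
  proof (intro always_eventually allI)
    fix j :: nat
    have "2 ^ j * s - 1 \<le> of_int \<lfloor>2 ^ j * s\<rfloor>" by linarith
    then have "(2 ^ j * s - 1) / 2 ^ j \<le> of_int \<lfloor>2 ^ j * s\<rfloor> / 2 ^ j"
      by (rule divide_right_mono) simp
    then show "s - (1 / 2) ^ j \<le> of_int \<lfloor>2 ^ j * s\<rfloor> / 2 ^ j"
      by (simp add: diff_divide_distrib power_one_over)
  qed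
  show "\<forall>\<^sub>F j in sequentially. of_int \<lfloor>2 ^ j * s\<rfloor> / 2 ^ j \<le> s"
  proof (intro always_eventually allI)
    fix j :: nat
    have "of_int \<lfloor>2 ^ j * s\<rfloor> \<le> 2 ^ j * s" by linarith
    then show "of_int \<lfloor>2 ^ j * s\<rfloor> / 2 ^ j \<le> s"
      by (simp add: field_simps)
  qed
qed simp

lemma path_eval_path_code:
  assumes "continuous_on UNIV p"
  shows "path_eval (path_code p) s = p s"
proof -
  have "(\<lambda>j. \<chi> i. path_code p (to_nat ((\<lfloor>2 ^ j * s\<rfloor>, j), i))) = (\<lambda>j. p (of_int \<lfloor>2 ^ j * s\<rfloor> / 2 ^ j))"
    by (simp add: path_code_to_nat)
  moreover have "(\<lambda>j. p (of_int \<lfloor>2 ^ j * s\<rfloor> / 2 ^ j)) \<longlonglongrightarrow> p s"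
    by (rule continuous_on_tendsto_compose[OF assms dyadic_floor_tendsto]) auto
  ultimately show ?thesis
    by (simp add: path_eval_def limI)
qed

text \<open>All dyadic approximations of time 0 are exact, so this holds for discontinuous paths
  too. Consequently \<open>f t = f 0 \<circ> T t\<close> will hold at every point of the path space,
  not merely almost everywhere.\<close>

lemma path_eval_zero: "path_eval (path_code p) 0 = p 0"
proof -
  have "(\<lambda>j. \<chi> i. path_code p (to_nat ((\<lfloor>2 ^ j * (0::real)\<rfloor>, j), i))) = (\<lambda>j::nat. p 0)"
    by (simp add: path_code_to_nat)
  then show ?thesis
    unfolding path_eval_def by (simp add: limI)
qed

lemma path_shift_zero: "path_shift k 0 x = x"
  by (simp add: path_shift_def)

lemma path_eval_path_shift: "path_eval (path_shift TYPE('k::finite) t x) 0 = (path_eval x t :: real ^ 'k)"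
  by (simp add: path_shift_def path_eval_zero)

lemma path_shift_path_code:
  fixes p :: "real \<Rightarrow> real ^ 'k::finite"
  assumes "continuous_on UNIV p"
  shows "path_shift TYPE('k) t (path_code p) = path_code (\<lambda>s. p (s + t))"
  using assms by (simp add: path_shift_def path_eval_path_code)

lemma measurable_vec_lambda:
  assumes "\<And>i. (\<lambda>x. f x i) \<in> borel_measurable M"
  shows "(\<lambda>x. (\<chi> i. f x i) :: real ^ 'k::finite) \<in> borel_measurable M"
  using assms by (subst borel_measurable_euclidean_space) (auto simp: Basis_vec_def inner_axis)

lemma measurable_vec_nth [measurable (raw)]:
  "f \<in> borel_measurable M \<Longrightarrow> (\<lambda>x. f x $ i) \<in> borel_measurable M" for f :: "_ \<Rightarrow> real ^ 'k::finite"
  by (rule measurable_compose[of _ _ borel]) (auto intro!: borel_measurable_continuous_onI continuous_intros)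

text \<open>At a fixed level the dyadic index takes countably many values as s varies, so each
  approximation is jointly measurable, and limits preserve this.\<close>

lemma measurable_path_eval [measurable]:
  "(\<lambda>(x, s). path_eval x s :: real ^ 'k::finite) \<in> borel_measurable (borel \<Otimes>\<^sub>M borel)"
proof -
  have [measurable]: "(\<lambda>z. fst z (to_nat ((\<lfloor>2 ^ j * snd z\<rfloor>, j), i))) \<in> borel_measurable (borel \<Otimes>\<^sub>M borel :: ((nat \<Rightarrow> real) \<times> real) measure)"
    for j :: nat and i :: 'k
    by (rule measurable_compose_countable'[where I=UNIV and f="\<lambda>m z. fst z (to_nat ((m, j), i))"
          and g="\<lambda>z. \<lfloor>2 ^ j * snd z\<rfloor>"])
      (auto intro: measurable_compose[OF measurable_fst measurable_product_coordinates])
  show ?thesis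
    unfolding path_eval_def case_prod_beta
    by (intro borel_measurable_lim_metric measurable_vec_lambda) measurable
qed

lemma measurable_path_code:
  assumes [measurable]: "\<And>t. (\<lambda>x. f x t :: real ^ 'k::finite) \<in> borel_measurable M"
  shows "(\<lambda>x. path_code (f x)) \<in> borel_measurable M"
proof (rule measurable_coordinatewise_then_product)
  fix n
  obtain m j i where "(from_nat n :: (int \<times> nat) \<times> 'k) = ((m, j), i)"
    by (metis surj_pair)
  then show "(\<lambda>x. path_code (f x) n) \<in> borel_measurable M"
    by (simp add: path_code_def) measurable
qed

lemma measurable_path_shift:
  "(\<lambda>(t, x). path_shift TYPE('k::finite) t x) \<in> borel_measurable (borel \<Otimes>\<^sub>M borel)"
proof -
  have "(\<lambda>z. path_code (\<lambda>s. path_eval (snd z) (s + fst z) :: real ^ 'k)) \<in> borel_measurable (borel \<Otimes>\<^sub>M borel)"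
    by (intro measurable_path_code) measurable
  then show ?thesis
    unfolding path_shift_def case_prod_beta by measurable
qed

lemma measurable_path_shift' [measurable (raw)]:
  assumes "f \<in> borel_measurable M" "g \<in> M \<rightarrow>\<^sub>M borel"
  shows "(\<lambda>x. path_shift TYPE('k::finite) (f x) (g x)) \<in> M \<rightarrow>\<^sub>M borel"
  using measurable_compose[OF measurable_Pair[OF assms] measurable_path_shift] by simp

section \<open>The shift-invariant measure on coded paths\<close>

lemma nn_integral_lborel_translate:
  fixes c :: "'b::euclidean_space"
  assumes [measurable]: "f \<in> borel_measurable borel"
  shows "(\<integral>\<^sup>+x. f (c + x) \<partial>lborel) = (\<integral>\<^sup>+x. f x \<partial>lborel)"
proof -
  have "(\<integral>\<^sup>+x. f x \<partial>lborel) = (\<integral>\<^sup>+x. f x \<partial>distr lborel borel ((+) c))"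
    by (simp add: lborel_distr_plus)
  also have "\<dots> = (\<integral>\<^sup>+x. f (c + x) \<partial>lborel)"
    by (subst nn_integral_distr) auto
  finally show ?thesis by simp
qed

locale brownian_paths = prob_space M for M :: "'a measure" +
  fixes W :: "real \<Rightarrow> 'a \<Rightarrow> real ^ 'k::finite" and l :: real
  assumes bm: "standard_brownian_motion M W" and l: "0 < l"
begin

abbreviation \<nu> :: "(real ^ 'k) measure" where
  "\<nu> \<equiv> density lborel (\<lambda>_. ennreal l)"

definition path_measure :: "(nat \<Rightarrow> real) measure" where
  "path_measure = distr (\<nu> \<Otimes>\<^sub>M M) borel (\<lambda>(u, \<omega>). path_code (\<lambda>t. u + W t \<omega>))"

abbreviation pos :: "(nat \<Rightarrow> real) \<Rightarrow> real \<Rightarrow> real ^ 'k" where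
  "pos \<equiv> path_eval"

lemma sets_path_measure [measurable_cong, simp]: "sets path_measure = sets borel"
  and space_path_measure [simp]: "space path_measure = UNIV"
  by (simp_all add: path_measure_def)

lemma W_measurable [measurable]: "W t \<in> borel_measurable M"
  using bm by (rule bm_measurable)

lemma continuous_W: "AE \<omega> in M. continuous_on UNIV (\<lambda>t. W t \<omega>)"
  using bm by (auto simp: standard_brownian_motion_def)

lemma measurable_coded_path [measurable]:
  "(\<lambda>(u, \<omega>). path_code (\<lambda>t. u + W t \<omega>)) \<in> \<nu> \<Otimes>\<^sub>M M \<rightarrow>\<^sub>M borel"
  unfolding case_prod_beta by (intro measurable_path_code) measurable

lemma sigma_finite_\<nu>: "sigma_finite_measure \<nu>"
  by (subst sigma_finite_measure.sigma_finite_iff_density_finite[OF sigma_finite_lborel]) auto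

lemma nn_integral_\<nu>_translate:
  assumes [measurable]: "F \<in> borel_measurable borel"
  shows "(\<integral>\<^sup>+u. F (u + c) \<partial>\<nu>) = (\<integral>\<^sup>+u. F u \<partial>\<nu>)"
  using nn_integral_lborel_translate[OF assms, of c]
  by (simp add: nn_integral_density nn_integral_cmult add.commute)

text \<open>The starting point is integrated first, with the Brownian path held fixed, so that
  translation invariance can absorb a random displacement.\<close>

lemma nn_integral_path_measure:
  assumes [measurable]: "F \<in> borel_measurable borel"
  shows "(\<integral>\<^sup>+x. F x \<partial>path_measure) = (\<integral>\<^sup>+\<omega>. \<integral>\<^sup>+u. F (path_code (\<lambda>t. u + W t \<omega>)) \<partial>\<nu> \<partial>M)"
proof -
  interpret \<nu>: sigma_finite_measure \<nu> by (rule sigma_finite_\<nu>)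
  interpret P: pair_sigma_finite \<nu> M ..
  have "(\<integral>\<^sup>+x. F x \<partial>path_measure) = (\<integral>\<^sup>+z. F (case z of (u, \<omega>) \<Rightarrow> path_code (\<lambda>t. u + W t \<omega>)) \<partial>(\<nu> \<Otimes>\<^sub>M M))"
    unfolding path_measure_def by (rule nn_integral_distr) auto
  also have "\<dots> = (\<integral>\<^sup>+\<omega>. \<integral>\<^sup>+u. F (path_code (\<lambda>t. u + W t \<omega>)) \<partial>\<nu> \<partial>M)"
    by (subst P.nn_integral_snd[symmetric]) (auto intro: measurable_compose[OF measurable_coded_path])
  finally show ?thesis .
qed

text \<open>Almost every Brownian path is continuous, so a measurable statement about codes has to
  be checked only on codes of continuous paths, where evaluation and shift are exact.\<close>

lemma AE_path_measure:
  assumes "{x. P x} \<in> sets borel" "\<And>p. continuous_on UNIV p \<Longrightarrow> P (path_code (p :: real \<Rightarrow> real ^ 'k))"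
  shows "AE x in path_measure. P x"
proof -
  interpret \<nu>: sigma_finite_measure \<nu> by (rule sigma_finite_\<nu>)
  interpret P: pair_sigma_finite \<nu> M ..
  have [measurable]: "Measurable.pred borel P" using assms(1) by (simp add: pred_def)
  have "(\<integral>\<^sup>+x. indicator {x. \<not> P x} x \<partial>path_measure) = (\<integral>\<^sup>+\<omega>. \<integral>\<^sup>+u. indicator {x. \<not> P x} (path_code (\<lambda>t. u + W t \<omega>)) \<partial>\<nu> \<partial>M)"
    by (rule nn_integral_path_measure) measurable
  also have "\<dots> = (\<integral>\<^sup>+\<omega>. \<integral>\<^sup>+u. 0 \<partial>\<nu> \<partial>M)"
    using continuous_W
  proof (intro nn_integral_cong_AE, eventually_elim)
    case (elim \<omega>)
    then have "P (path_code (\<lambda>t. u + W t \<omega>))" for u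
      by (intro assms(2) continuous_intros)
    then show ?case by simp
  qed
  finally have "emeasure path_measure {x. \<not> P x} = 0"
    by (subst (asm) nn_integral_indicator) auto
  then show ?thesis
    by (intro AE_I[of _ _ "{x. \<not> P x}"]) auto
qed

text \<open>For a fixed path the position at t is a translate of the start u, so its intensity is
  again \<nu> at every time.\<close>

lemma nn_integral_path_eval:
  assumes [measurable]: "F \<in> borel_measurable borel"
  shows "(\<integral>\<^sup>+x. F (pos x t) \<partial>path_measure) = (\<integral>\<^sup>+u. F u \<partial>\<nu>)"
proof -
  have "(\<integral>\<^sup>+x. F (pos x t) \<partial>path_measure) = (\<integral>\<^sup>+\<omega>. \<integral>\<^sup>+u. F (pos (path_code (\<lambda>t. u + W t \<omega>)) t) \<partial>\<nu> \<partial>M)"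
    by (rule nn_integral_path_measure) measurable
  also have "\<dots> = (\<integral>\<^sup>+\<omega>. \<integral>\<^sup>+u. F u \<partial>\<nu> \<partial>M)"
    using continuous_W
  proof (intro nn_integral_cong_AE, eventually_elim)
    case (elim \<omega>)
    then have "pos (path_code (\<lambda>t. u + W t \<omega>)) t = u + W t \<omega>" for u
      by (intro path_eval_path_code continuous_intros)
    then show ?case by (simp add: nn_integral_\<nu>_translate)
  qed
  finally show ?thesis by (simp add: emeasure_space_1)
qed

lemma emeasure_path_eval:
  assumes [measurable]: "A \<in> sets borel"
  shows "emeasure path_measure {x. pos x t \<in> A} = emeasure \<nu> A"
proof -
  have "emeasure path_measure {x. pos x t \<in> A} = (\<integral>\<^sup>+x. indicator A (pos x t) \<partial>path_measure)"
  proof -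
    have "{x \<in> space path_measure. pos x t \<in> A} \<in> sets path_measure" by measurable
    from nn_integral_indicator[OF this] show ?thesis by (simp add: indicator_def)
  qed
  also have "\<dots> = emeasure \<nu> A"
    by (subst nn_integral_path_eval) auto
  finally show ?thesis .
qed

lemma emeasure_\<nu>: "A \<in> sets borel \<Longrightarrow> emeasure \<nu> A = ennreal l * emeasure lborel A"
  by (subst emeasure_density) (auto simp: nn_integral_cmult_indicator)

lemma emeasure_\<nu>_ball: "emeasure \<nu> (ball 0 r) < \<infinity>"
  using emeasure_lborel_ball_finite[of "0 :: real ^ 'k" r]
  by (subst emeasure_\<nu>) (auto simp: ennreal_mult_less_top)

lemma sigma_finite_path_measure: "sigma_finite_measure path_measure"
proof
  let ?A = "range (\<lambda>n::nat. {x. pos x 0 \<in> ball 0 (real n)})"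
  have "x \<in> \<Union>?A" for x
    using reals_Archimedean2[of "norm (pos x 0)"] by (auto simp: dist_norm)
  moreover have "emeasure path_measure {x. pos x 0 \<in> ball 0 (real n)} \<noteq> \<infinity>" for n
    using emeasure_\<nu>_ball[of "real n"] by (subst emeasure_path_eval) auto
  ultimately show "\<exists>A. countable A \<and> A \<subseteq> sets path_measure \<and> \<Union> A = space path_measure \<and> (\<forall>a\<in>A. emeasure path_measure a \<noteq> \<infinity>)"
    by (intro exI[of _ ?A]) (auto simp del: mem_ball)
qed

lemma sigma_finite_borel_space_path_measure: "sigma_finite_borel_space path_measure"
  unfolding sigma_finite_borel_space_def
proof (intro conjI exI[of _ euclidean_metric])
  show "mcomplete_of (euclidean_metric :: (nat \<Rightarrow> real) metric)"
    unfolding euclidean_metric_def by (simp add: Met_TC.mcomplete_of complete_UNIV)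
  show "separable_space (mtopology_of (euclidean_metric :: (nat \<Rightarrow> real) metric))"
  proof -
    obtain D :: "(nat \<Rightarrow> real) set" where D: "countable D" "\<And>X. open X \<Longrightarrow> X \<noteq> {} \<Longrightarrow> \<exists>d\<in>D. d \<in> X"
      by (rule countable_dense_setE) blast
    then have "x \<in> closure D" for x
      unfolding closure_iff_nhds_not_empty by blast
    then have "euclidean closure_of D = topspace euclidean"
      by auto
    then show ?thesis
      using D(1) by (auto simp: separable_space_def)
  qed
  show "sets path_measure = sigma_sets (space path_measure) {G. openin (mtopology_of euclidean_metric) G}"
    by (simp add: borel_def)
qed (use sigma_finite_path_measure in auto)

text \<open>Shifting by t replaces the start u by \<open>u + W t\<close> and the Brownian path by
  its increments V from time t. Translation invariance removes \<open>W t\<close> for each fixed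
  \<omega>, before the expectation is taken, so the dependence between \<open>W t\<close> and V does
  not matter; then V may be replaced by W, which has the same law.\<close>

lemma distr_path_shift: "distr path_measure path_measure (path_shift TYPE('k) t) = path_measure"
proof (rule measure_eqI)
  fix A assume "A \<in> sets (distr path_measure path_measure (path_shift TYPE('k) t))"
  then have A [measurable]: "A \<in> sets borel" by simp
  let ?F = "indicator A :: _ \<Rightarrow> ennreal"
  let ?G = "\<lambda>w. \<integral>\<^sup>+u. ?F (path_code (\<lambda>s. u + w s)) \<partial>\<nu>"
  define V where "V s \<omega> = W (s + t) \<omega> - W t \<omega>" for s \<omega>
  have V: "standard_brownian_motion M V"
    using bm_shift[OF bm] unfolding V_def by simp
  interpret \<nu>: sigma_finite_measure \<nu> by (rule sigma_finite_\<nu>)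
  have comp: "(\<lambda>w. w s) \<in> (\<Pi>\<^sub>M s\<in>UNIV. borel :: (real ^ 'k) measure) \<rightarrow>\<^sub>M borel" for s
    by (rule measurable_component_singleton) simp
  have "(\<lambda>(w, u). ?F (path_code (\<lambda>s. u + w s))) \<in> borel_measurable ((\<Pi>\<^sub>M s\<in>UNIV. borel) \<Otimes>\<^sub>M \<nu>)"
    unfolding case_prod_beta
    by (intro measurable_compose[OF measurable_path_code borel_measurable_indicator[OF A]]
        borel_measurable_add measurable_compose[OF measurable_fst comp] measurable_compose[OF measurable_snd]) auto
  then have G: "?G \<in> borel_measurable (\<Pi>\<^sub>M s\<in>UNIV. borel)"
    by (rule \<nu>.borel_measurable_nn_integral)
  have "emeasure (distr path_measure path_measure (path_shift TYPE('k) t)) A = (\<integral>\<^sup>+x. ?F x \<partial>distr path_measure path_measure (path_shift TYPE('k) t))"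
    by simp
  also have "\<dots> = (\<integral>\<^sup>+x. ?F (path_shift TYPE('k) t x) \<partial>path_measure)"
    by (rule nn_integral_distr) auto
  also have "\<dots> = (\<integral>\<^sup>+\<omega>. \<integral>\<^sup>+u. ?F (path_shift TYPE('k) t (path_code (\<lambda>t. u + W t \<omega>))) \<partial>\<nu> \<partial>M)"
    by (rule nn_integral_path_measure) measurable
  also have "\<dots> = (\<integral>\<^sup>+\<omega>. ?G (\<lambda>s. V s \<omega>) \<partial>M)"
    using continuous_W
  proof (intro nn_integral_cong_AE, eventually_elim)
    case (elim \<omega>)
    have "(\<integral>\<^sup>+u. ?F (path_shift TYPE('k) t (path_code (\<lambda>t. u + W t \<omega>))) \<partial>\<nu>) = (\<integral>\<^sup>+u. ?F (path_code (\<lambda>s. (u + W t \<omega>) + V s \<omega>)) \<partial>\<nu>)"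
      using elim by (subst path_shift_path_code) (auto intro!: continuous_intros simp: V_def)
    also have "\<dots> = ?G (\<lambda>s. V s \<omega>)"
    proof (rule nn_integral_\<nu>_translate)
      show "(\<lambda>u. ?F (path_code (\<lambda>s. u + V s \<omega>))) \<in> borel_measurable borel"
        by (intro measurable_compose[OF measurable_path_code borel_measurable_indicator[OF A]]) auto
    qed
    finally show ?case .
  qed
  also have "\<dots> = (\<integral>\<^sup>+w. ?G w \<partial>distr M (\<Pi>\<^sub>M s\<in>UNIV. borel) (\<lambda>\<omega> s. V s \<omega>))"
    by (subst nn_integral_distr[OF bm_path_measurable[OF V]]) (simp_all add: G)
  also have "\<dots> = (\<integral>\<^sup>+w. ?G w \<partial>distr M (\<Pi>\<^sub>M s\<in>UNIV. borel) (\<lambda>\<omega> s. W s \<omega>))"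
    by (subst bm_law_unique[OF prob_space_axioms V prob_space_axioms bm]) simp
  also have "\<dots> = (\<integral>\<^sup>+\<omega>. ?G (\<lambda>s. W s \<omega>) \<partial>M)"
    by (subst nn_integral_distr[OF bm_path_measurable[OF bm]]) (simp_all add: G)
  also have "\<dots> = (\<integral>\<^sup>+x. ?F x \<partial>path_measure)"
    by (rule nn_integral_path_measure[symmetric]) measurable
  finally show "emeasure (distr path_measure path_measure (path_shift TYPE('k) t)) A = emeasure path_measure A" by simp
qed simp

lemma AE_path_shift_add: "AE x in path_measure. path_shift TYPE('k) t (path_shift TYPE('k) s x) = path_shift TYPE('k) (t + s) x"
proof (rule AE_path_measure)
  have "{x \<in> space borel. \<forall>n. path_shift TYPE('k) t (path_shift TYPE('k) s x) n = path_shift TYPE('k) (t + s) x n} \<in> sets (borel :: (nat \<Rightarrow> real) measure)"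
  proof -
    have "(\<lambda>x. path_shift TYPE('k) t (path_shift TYPE('k) s x) n) \<in> borel_measurable borel"
      "(\<lambda>x. path_shift TYPE('k) (t + s) x n) \<in> borel_measurable borel" for n
      by (rule measurable_compose[OF _ measurable_product_coordinates], measurable)+
    then show ?thesis
      by (intro sets.sets_Collect_countable_All borel_measurable_eq)
  qed
  then show "{x. path_shift TYPE('k) t (path_shift TYPE('k) s x) = path_shift TYPE('k) (t + s) x} \<in> sets borel"
    by (simp add: fun_eq_iff)
  fix p :: "real \<Rightarrow> real ^ 'k" assume p: "continuous_on UNIV p"
  have "continuous_on UNIV (\<lambda>r. p (r + s))"
    by (rule continuous_on_compose2[OF p]) (auto intro!: continuous_intros)
  then show "path_shift TYPE('k) t (path_shift TYPE('k) s (path_code p)) = path_shift TYPE('k) (t + s) (path_code p)"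
    using p by (simp add: path_shift_path_code add.assoc add.commute[of s])
qed

lemma measure_preserving_flow_shift: "measure_preserving_flow path_measure (path_shift TYPE('k))"
  unfolding measure_preserving_flow_def measure_iso_mod_null_def
proof (intro conjI allI ballI)
  have [measurable]: "path_shift TYPE('k) t \<in> path_measure \<rightarrow>\<^sub>M path_measure" for t by measurable
  fix t
  show "\<exists>S. S \<in> path_measure \<rightarrow>\<^sub>M path_measure \<and> distr path_measure path_measure S = path_measure \<and>
      (AE x in path_measure. S (path_shift TYPE('k) t x) = x) \<and> (AE x in path_measure. path_shift TYPE('k) t (S x) = x)"
    using AE_path_shift_add[of "- t" t] AE_path_shift_add[of t "- t"]
    by (intro exI[of _ "path_shift TYPE('k) (- t)"]) (simp add: distr_path_shift path_shift_zero)
  show "(\<lambda>(t, x). path_shift TYPE('k) t x) \<in> borel \<Otimes>\<^sub>M path_measure \<rightarrow>\<^sub>M path_measure"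
    using measurable_path_shift by measurable
qed (simp_all add: distr_path_shift AE_path_shift_add path_shift_zero)

end

section \<open>The stationary process of closest distances\<close>

lemma enexp_eq_0_iff: "enexp x = 0 \<longleftrightarrow> x = \<infinity>"
  by (cases x) (auto simp: enexp_ennreal)

lemma enexp_mult_top: "enexp (x * \<top>) = (if x = 0 then 1 else 0)"
  by (auto simp: ennreal_mult_top)

text \<open>Taking the weight \<infinity> in the generating function turns
  \<open>enexp (N * c)\<close> into the indicator of N = 0.\<close>

lemma void_probability:
  fixes U :: "nat \<Rightarrow> 'a \<Rightarrow> 'w"
  assumes "prob_space M" and U: "poisson_process M \<mu> (\<lambda>_. UNIV) U" and B: "B \<in> sets \<mu>"
  shows "emeasure M {\<omega>\<in>space M. \<forall>i. U i \<omega> \<notin> B} = enexp (emeasure \<mu> B)"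
proof -
  note [measurable] = poisson_process_measurable[OF U] B
  have iff: "point_count (\<lambda>_. UNIV) U B \<omega> = 0 \<longleftrightarrow> (\<forall>i. U i \<omega> \<notin> B)" for \<omega>
    by (auto simp: point_count_def emeasure_count_space split: if_splits dest: not_finite_existsD)
  have "enexp (emeasure \<mu> B) = (\<integral>\<^sup>+\<omega>. enexp (point_count (\<lambda>_. UNIV) U B \<omega> * \<infinity>) \<partial>M)"
    by (subst nn_integral_enexp_point_count[OF assms]) simp
  also have "\<dots> = (\<integral>\<^sup>+\<omega>. indicator {\<omega>\<in>space M. \<forall>i. U i \<omega> \<notin> B} \<omega> \<partial>M)"
    by (intro nn_integral_cong) (auto simp: enexp_mult_top iff indicator_def)
  also have "\<dots> = emeasure M {\<omega>\<in>space M. \<forall>i. U i \<omega> \<notin> B}"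
    by (rule nn_integral_indicator) measurable
  finally show ?thesis by simp
qed

section \<open>Orthants determine laws and independence\<close>

lemma sets_PiM_real_eq_orthants:
  "sets (\<Pi>\<^sub>M t\<in>I. borel :: real measure) = sigma_sets (space (\<Pi>\<^sub>M t\<in>I. borel :: real measure))
    {{w \<in> space (\<Pi>\<^sub>M t\<in>I. borel). \<forall>t\<in>T. w t \<le> a t} | T a. finite T \<and> T \<subseteq> I}"
    (is "_ = sigma_sets ?\<Omega> ?E")
proof (intro antisym)
  have E: "?E \<subseteq> Pow ?\<Omega>" by auto
  have sets_sigma: "sets (sigma ?\<Omega> ?E) = sigma_sets ?\<Omega> ?E" and space_sigma: "space (sigma ?\<Omega> ?E) = ?\<Omega>"
    using E by (auto simp: sets_measure_of space_measure_of)
  have comp: "(\<lambda>w. w t) \<in> borel_measurable (sigma ?\<Omega> ?E)" if t: "t \<in> I" for t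
  proof (rule borel_measurableI_le)
    fix y :: real
    have "{w \<in> ?\<Omega>. w t \<le> y} \<in> ?E"
      using t by (intro CollectI exI[of _ "{t}"] exI[of _ "\<lambda>_. y"]) auto
    then show "{w \<in> space (sigma ?\<Omega> ?E). w t \<le> y} \<in> sets (sigma ?\<Omega> ?E)"
      unfolding sets_sigma space_sigma by (rule sigma_sets.Basic)
  qed
  have "sigma_sets ?\<Omega> {{w \<in> ?\<Omega>. w t \<in> A} | t A. t \<in> I \<and> A \<in> sets borel} \<subseteq> sigma_sets ?\<Omega> ?E"
  proof (intro sigma_sets_mono subsetI)
    fix S assume "S \<in> {{w \<in> ?\<Omega>. w t \<in> A} | t A. t \<in> I \<and> A \<in> sets borel}"
    then obtain t A where "S = {w \<in> ?\<Omega>. w t \<in> A}" "t \<in> I" "A \<in> sets borel" by auto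
    moreover have "(\<lambda>w. w t) -` A \<inter> ?\<Omega> = {w \<in> ?\<Omega>. w t \<in> A}" by auto
    ultimately show "S \<in> sigma_sets ?\<Omega> ?E"
      using measurable_sets[OF comp, of t A] unfolding sets_sigma space_sigma by simp
  qed
  then show "sets (\<Pi>\<^sub>M t\<in>I. borel :: real measure) \<subseteq> sigma_sets ?\<Omega> ?E"
    by (simp add: sets_PiM_single space_PiM)
  show "sigma_sets ?\<Omega> ?E \<subseteq> sets (\<Pi>\<^sub>M t\<in>I. borel :: real measure)"
  proof (rule sets.sigma_sets_subset, safe)
    fix T :: "'a set" and a :: "'a \<Rightarrow> real" assume T: "finite T" "T \<subseteq> I"
    have "{w \<in> ?\<Omega>. w t \<le> a t} \<in> sets (\<Pi>\<^sub>M t\<in>I. borel :: real measure)" if "t \<in> T" for t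
      using measurable_component_singleton[of t I "\<lambda>_. borel :: real measure"] T(2) that
      by (intro borel_measurable_le) auto
    then show "{w \<in> ?\<Omega>. \<forall>t\<in>T. w t \<le> a t} \<in> sets (\<Pi>\<^sub>M t\<in>I. borel :: real measure)"
      using T(1) by (intro sets.sets_Collect_finite_All) auto
  qed
qed

lemma Int_stable_orthants:
  "Int_stable {{w \<in> \<Omega>. \<forall>t\<in>T. w t \<le> (a t :: real)} | T a. finite T \<and> T \<subseteq> I}"
proof (rule Int_stableI, clarify)
  fix T T' :: "'a set" and a a' :: "'a \<Rightarrow> real"
  assume T: "finite T" "T \<subseteq> I" "finite T'" "T' \<subseteq> I"
  let ?b = "\<lambda>t. if t \<in> T then if t \<in> T' then min (a t) (a' t) else a t else a' t"
  have "{w \<in> \<Omega>. \<forall>t\<in>T. w t \<le> a t} \<inter> {w \<in> \<Omega>. \<forall>t\<in>T'. w t \<le> a' t} = {w \<in> \<Omega>. \<forall>t\<in>T \<union> T'. w t \<le> ?b t}"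
    by (auto split: if_splits)
  then show "\<exists>T'' b. {w \<in> \<Omega>. \<forall>t\<in>T. w t \<le> a t} \<inter> {w \<in> \<Omega>. \<forall>t\<in>T'. w t \<le> a' t} = {w \<in> \<Omega>. \<forall>t\<in>T''. w t \<le> b t} \<and> finite T'' \<and> T'' \<subseteq> I"
    using T by (intro exI[of _ "T \<union> T'"] exI[of _ ?b]) auto
qed

text \<open>Lower orthants form a generating \<pi>-system, and they suit suprema over Poisson
  points, whose orthant events are void events.\<close>

lemma fdd_eqI:
  assumes "prob_space M" "prob_space N"
    and Y [measurable]: "\<And>t. Y t \<in> borel_measurable M" and Z [measurable]: "\<And>t. Z t \<in> borel_measurable N"
    and eq: "\<And>T a. finite T \<Longrightarrow> emeasure M {\<omega>\<in>space M. \<forall>t\<in>T. Y t \<omega> \<le> a t} = emeasure N {\<omega>\<in>space N. \<forall>t\<in>T. Z t \<omega> \<le> a t}"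
  shows "fdd_eq M Y N Z"
  unfolding fdd_eq_def
proof (intro conjI allI impI)
  interpret M: prob_space M by fact
  interpret N: prob_space N by fact
  fix T :: "real set" assume T: "finite T"
  let ?P = "\<Pi>\<^sub>M t\<in>T. borel :: real measure"
  let ?E = "{{w \<in> space ?P. \<forall>t\<in>S. w t \<le> a t} | S a. finite S \<and> S \<subseteq> T}"
  have Ym: "(\<lambda>\<omega>. \<lambda>t\<in>T. Y t \<omega>) \<in> M \<rightarrow>\<^sub>M ?P" and Zm: "(\<lambda>\<omega>. \<lambda>t\<in>T. Z t \<omega>) \<in> N \<rightarrow>\<^sub>M ?P"
    by (auto intro!: measurable_restrict)
  have E_sets: "?E \<subseteq> sets ?P"
    unfolding sets_PiM_real_eq_orthants[of T] by auto
  show "distr M ?P (\<lambda>\<omega>. \<lambda>t\<in>T. Y t \<omega>) = distr N ?P (\<lambda>\<omega>. \<lambda>t\<in>T. Z t \<omega>)"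
  proof (rule measure_eqI_generator_eq[where A="\<lambda>_. space ?P"])
    show "Int_stable ?E" by (rule Int_stable_orthants)
    show "?E \<subseteq> Pow (space ?P)" by auto
    fix S assume S: "S \<in> ?E"
    then obtain T' a where S_eq: "S = {w \<in> space ?P. \<forall>t\<in>T'. w t \<le> a t}" "finite T'" "T' \<subseteq> T" by auto
    have "(\<lambda>\<omega>. \<lambda>t\<in>T. Y t \<omega>) -` S \<inter> space M = {\<omega>\<in>space M. \<forall>t\<in>T'. Y t \<omega> \<le> a t}"
      "(\<lambda>\<omega>. \<lambda>t\<in>T. Z t \<omega>) -` S \<inter> space N = {\<omega>\<in>space N. \<forall>t\<in>T'. Z t \<omega> \<le> a t}"
      using S_eq by (auto simp: space_PiM subset_eq)
    moreover have "S \<in> sets ?P" using E_sets S by (rule subsetD)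
    ultimately show "emeasure (distr M ?P (\<lambda>\<omega>. \<lambda>t\<in>T. Y t \<omega>)) S = emeasure (distr N ?P (\<lambda>\<omega>. \<lambda>t\<in>T. Z t \<omega>)) S"
      using eq[OF S_eq(2), of a] by (simp only: emeasure_distr[OF Ym] emeasure_distr[OF Zm])
  next
    have "space ?P \<in> ?E" by (intro CollectI exI[of _ "{}"]) auto
    then show "range (\<lambda>_::nat. space ?P) \<subseteq> ?E" by auto
    show "emeasure (distr M ?P (\<lambda>\<omega>. \<lambda>t\<in>T. Y t \<omega>)) (space ?P) \<noteq> \<infinity>"
      using prob_space.emeasure_space_1[OF M.prob_space_distr[OF Ym]] by simp
    show "sets (distr M ?P (\<lambda>\<omega>. \<lambda>t\<in>T. Y t \<omega>)) = sigma_sets (space ?P) ?E"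
      "sets (distr N ?P (\<lambda>\<omega>. \<lambda>t\<in>T. Z t \<omega>)) = sigma_sets (space ?P) ?E"
      using sets_PiM_real_eq_orthants[of T] by simp_all
  qed auto
qed (use Y Z in auto)

text \<open>An empty set of times gives the whole space, so the orthants form a \<pi>-system that
  contains it; the product rule on orthants then extends to the product \<sigma>-algebras.\<close>

lemma indep_processesI:
  fixes Z :: "nat \<Rightarrow> real \<Rightarrow> 'a \<Rightarrow> real"
  assumes "prob_space N" "0 < n" and Z [measurable]: "\<And>j t. Z j t \<in> borel_measurable N"
    and prod: "\<And>T a. (\<And>j. j < n \<Longrightarrow> finite (T j)) \<Longrightarrow>
      emeasure N {\<omega>\<in>space N. \<forall>j<n. \<forall>t\<in>T j. Z j t \<omega> \<le> a j t} =
      (\<Prod>j<n. emeasure N {\<omega>\<in>space N. \<forall>t\<in>T j. Z j t \<omega> \<le> a j t})"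
  shows "prob_space.indep_vars N (\<lambda>_. \<Pi>\<^sub>M t\<in>UNIV. borel) (\<lambda>j \<omega> t. Z j t \<omega>) {..<n}"
proof -
  interpret prob_space N by fact
  let ?P = "\<Pi>\<^sub>M t\<in>(UNIV::real set). borel :: real measure"
  let ?E = "{{w \<in> space ?P. \<forall>t\<in>S. w t \<le> a t} | S a. finite S \<and> S \<subseteq> UNIV}"
  have rv: "(\<lambda>\<omega> t. Z j t \<omega>) \<in> N \<rightarrow>\<^sub>M ?P" for j
    by (intro measurable_abs_UNIV) simp
  have "space ?P \<in> ?E" by (intro CollectI exI[of _ "{}"]) auto
  moreover have "prob (\<Inter>j\<in>{..<n}. (\<lambda>\<omega> t. Z j t \<omega>) -` A j \<inter> space N) = (\<Prod>j<n. prob ((\<lambda>\<omega> t. Z j t \<omega>) -` A j \<inter> space N))"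
    if A: "A \<in> {..<n} \<rightarrow> ?E" for A
  proof -
    have "\<exists>p. j < n \<longrightarrow> A j = {w \<in> space ?P. \<forall>t\<in>fst p. w t \<le> snd p t} \<and> finite (fst p)" for j
    proof (cases "j < n")
      case True
      then have "A j \<in> ?E" using A by (auto simp: Pi_iff)
      then obtain S a where "A j = {w \<in> space ?P. \<forall>t\<in>S. w t \<le> a t}" "finite S" by blast
      then show ?thesis by (intro exI[of _ "(S, a)"]) simp
    qed simp
    then have "\<exists>p. \<forall>j. j < n \<longrightarrow> A j = {w \<in> space ?P. \<forall>t\<in>fst (p j). w t \<le> snd (p j) t} \<and> finite (fst (p j))"
      by (intro choice allI)
    then obtain p where p: "\<forall>j. j < n \<longrightarrow> A j = {w \<in> space ?P. \<forall>t\<in>fst (p j). w t \<le> snd (p j) t} \<and> finite (fst (p j))"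
      by blast
    define T where "T = (\<lambda>j. fst (p j))"
    define a where "a = (\<lambda>j. snd (p j))"
    have T: "A j = {w \<in> space ?P. \<forall>t\<in>T j. w t \<le> a j t}" "finite (T j)" if "j < n" for j
      using p that by (auto simp: T_def a_def)
    have single: "(\<lambda>\<omega> t. Z j t \<omega>) -` A j \<inter> space N = {\<omega>\<in>space N. \<forall>t\<in>T j. Z j t \<omega> \<le> a j t}" if "j < n" for j
      using T(1)[OF that] by (auto simp: space_PiM)
    have "(\<Inter>j\<in>{..<n}. (\<lambda>\<omega> t. Z j t \<omega>) -` A j \<inter> space N) = {\<omega>\<in>space N. \<forall>j<n. \<forall>t\<in>T j. Z j t \<omega> \<le> a j t}"
      using assms(2) by (auto simp: single)
    then have "ennreal (prob (\<Inter>j\<in>{..<n}. (\<lambda>\<omega> t. Z j t \<omega>) -` A j \<inter> space N)) = (\<Prod>j<n. ennreal (prob ((\<lambda>\<omega> t. Z j t \<omega>) -` A j \<inter> space N)))"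
      using prod[of T a, OF T(2)] by (simp add: emeasure_eq_measure single)
    then show ?thesis by (simp add: prod_ennreal prod_nonneg)
  qed
  ultimately show ?thesis
    using rv assms(2) Int_stable_orthants[of "space ?P" UNIV] sets_PiM_real_eq_orthants[of UNIV]
    by (subst indep_vars_finite[where E="\<lambda>_. ?E"]) auto
qed

lemma measurable_Collect_eq:
  fixes f g :: "'a \<Rightarrow> 'b::euclidean_space"
  assumes [measurable]: "f \<in> borel_measurable M" "g \<in> borel_measurable M"
  shows "{x \<in> space M. f x = g x} \<in> sets M"
proof -
  have "{x \<in> space M. norm (f x - g x) = 0} \<in> sets M" by measurable
  then show ?thesis by simp
qed

text \<open>The map \<open>exp (- x)\<close> is continuous and reverses the order. Nonnegativity
  bounds the infimum below by 0 and the supremum above by 1, as real-valued \<open>INF\<close> and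
  \<open>SUP\<close> demand.\<close>

lemma SUP_exp_uminus:
  fixes g :: "'i \<Rightarrow> real"
  assumes g: "\<And>i. 0 \<le> g i"
  shows "(SUP i. exp (- g i)) = exp (- (INF i. g i))"
proof (rule antisym)
  have bdd: "bdd_below (range g)" using g by (auto intro: bdd_belowI[of _ 0])
  have bdd': "bdd_above (range (\<lambda>i. exp (- g i)))" using g by (auto intro!: bdd_aboveI[of _ 1])
  show "(SUP i. exp (- g i)) \<le> exp (- (INF i. g i))"
    using bdd by (intro cSUP_least) (auto intro: cINF_lower)
  let ?S = "SUP i. exp (- g i)"
  have le: "exp (- g i) \<le> ?S" for i using bdd' by (intro cSUP_upper) auto
  then have S: "0 < ?S" by (meson exp_gt_zero less_le_trans)
  have "- ln ?S \<le> g i" for i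
    using le[of i] S by (metis exp_ln ln_exp ln_le_cancel_iff exp_gt_zero minus_le_iff)
  then have "- ln ?S \<le> (INF i. g i)" by (intro cINF_greatest) auto
  then have "exp (- (INF i. g i)) \<le> exp (ln ?S)" by simp
  then show "exp (- (INF i. g i)) \<le> ?S" using S by simp
qed

text \<open>The paths that come closer to the origin than \<open>- a t\<close> at some time t in
  \<open>T\<close>. That no particle path lies here means \<open>- X t \<le> a t\<close> for all t
  in \<open>T\<close>; a time with \<open>a t \<ge> 0\<close> imposes no condition.\<close>

abbreviation low :: "('x \<Rightarrow> real \<Rightarrow> 'b::real_normed_vector) \<Rightarrow> real set \<Rightarrow> (real \<Rightarrow> real) \<Rightarrow> 'x set" where
  "low e T a \<equiv> {x. \<exists>t\<in>T. norm (e x t) < - a t}"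

definition spectral :: "('x \<Rightarrow> real \<Rightarrow> 'b::real_normed_vector) \<Rightarrow> real \<Rightarrow> 'x \<Rightarrow> real" where
  "spectral e t x = exp (- norm (e x t))"

text \<open>\<open>Q i\<close> is the code of a particle path. The motion W may belong to one of the
  particles, because only its law enters \<open>path_measure\<close>. The equation for X is almost
  sure, as decoding is exact on continuous paths.\<close>

locale brownian_points = brownian_paths M W l
  for M :: "'a measure" and W :: "real \<Rightarrow> 'a \<Rightarrow> real ^ 'k::finite" and l +
  fixes Q :: "nat \<Rightarrow> 'a \<Rightarrow> nat \<Rightarrow> real" and X :: "real \<Rightarrow> 'a \<Rightarrow> real"
  assumes Q: "poisson_process M path_measure (\<lambda>_. UNIV) Q"
    and X_measurable [measurable]: "\<And>t. X t \<in> borel_measurable M"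
    and X_eq: "\<And>t. AE \<omega> in M. X t \<omega> = (INF i. norm (pos (Q i \<omega>) t))"
begin

lemma Q_measurable [measurable]: "Q i \<in> M \<rightarrow>\<^sub>M borel"
  using poisson_process_measurable[OF Q, of i] measurable_cong_sets[OF refl sets_path_measure] by blast

lemma INF_norm_ge: "c \<le> (INF i. norm (pos (q i) t)) \<longleftrightarrow> (\<forall>i::nat. c \<le> norm (pos (q i) t))"
  by (subst le_cINF_iff) (auto intro!: bdd_belowI[of _ 0])

lemma cdf_X:
  assumes T: "finite T"
  shows "emeasure M {\<omega>\<in>space M. \<forall>t\<in>T. - X t \<omega> \<le> a t} = enexp (emeasure path_measure (low pos T a))"
proof -
  have "emeasure M {\<omega>\<in>space M. \<forall>t\<in>T. - X t \<omega> \<le> a t} = emeasure M {\<omega>\<in>space M. \<forall>i. Q i \<omega> \<notin> low pos T a}"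
  proof (rule emeasure_eq_AE)
    have "AE \<omega> in M. \<forall>t\<in>T. X t \<omega> = (INF i. norm (pos (Q i \<omega>) t))"
      using T X_eq by (intro AE_finite_allI) auto
    then show "AE \<omega> in M. \<omega> \<in> {\<omega>\<in>space M. \<forall>t\<in>T. - X t \<omega> \<le> a t} \<longleftrightarrow> \<omega> \<in> {\<omega>\<in>space M. \<forall>i. Q i \<omega> \<notin> low pos T a}"
    proof eventually_elim
      case (elim \<omega>)
      have "- X t \<omega> \<le> a t \<longleftrightarrow> (\<forall>i. \<not> norm (pos (Q i \<omega>) t) < - a t)" if "t \<in> T" for t
        using elim that INF_norm_ge[of "- a t" "\<lambda>i. Q i \<omega>" t] by (auto simp: not_less minus_le_iff)
      then show ?case by auto
    qed
  qed (use T in measurable)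
  also have "\<dots> = enexp (emeasure path_measure (low pos T a))"
    using T by (intro void_probability prob_space_axioms Q) auto
  finally show ?thesis .
qed

text \<open>Shifting the paths by s moves the constrained times by s, and the shift preserves the
  path measure.\<close>

lemma emeasure_low_shift:
  assumes T: "finite T"
  shows "emeasure path_measure (low pos ((\<lambda>t. t + s) ` T) (\<lambda>t. a (t - s))) = emeasure path_measure (low pos T a)"
proof -
  have [measurable]: "path_shift TYPE('k) s \<in> path_measure \<rightarrow>\<^sub>M path_measure" by measurable
  have "emeasure path_measure (low pos T a) = emeasure (distr path_measure path_measure (path_shift TYPE('k) s)) (low pos T a)"
    by (simp add: distr_path_shift)
  also have "\<dots> = emeasure path_measure (path_shift TYPE('k) s -` low pos T a \<inter> space path_measure)"
    using T by (intro emeasure_distr) auto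
  also have "\<dots> = emeasure path_measure (low pos ((\<lambda>t. t + s) ` T) (\<lambda>t. a (t - s)))"
  proof (rule emeasure_eq_AE)
    show "AE x in path_measure. x \<in> path_shift TYPE('k) s -` low pos T a \<inter> space path_measure \<longleftrightarrow> x \<in> low pos ((\<lambda>t. t + s) ` T) (\<lambda>t. a (t - s))"
    proof -
      have "AE x in path_measure. \<forall>t\<in>T. pos (path_shift TYPE('k) s x) t = pos x (t + s)"
      proof (rule AE_path_measure)
        have "{x \<in> space borel. \<forall>t\<in>T. pos (path_shift TYPE('k) s x) t = pos x (t + s)} \<in> sets (borel :: (nat \<Rightarrow> real) measure)"
          using T by (intro sets.sets_Collect_finite_All measurable_Collect_eq) measurable
        then show "{x. \<forall>t\<in>T. pos (path_shift TYPE('k) s x) t = pos x (t + s)} \<in> sets borel" by simp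
        fix p :: "real \<Rightarrow> real ^ 'k" assume p: "continuous_on UNIV p"
        have "continuous_on UNIV (\<lambda>r. p (r + s))"
          by (rule continuous_on_compose2[OF p]) (auto intro!: continuous_intros)
        then show "\<forall>t\<in>T. pos (path_shift TYPE('k) s (path_code p)) t = pos (path_code p) (t + s)"
          using p by (simp add: path_shift_path_code path_eval_path_code)
      qed
      then show ?thesis by eventually_elim auto
    qed
    show "path_shift TYPE('k) s -` low pos T a \<inter> space path_measure \<in> sets path_measure"
      using T by (intro measurable_sets[of _ path_measure path_measure]) auto
  qed (use T in auto)
  finally show ?thesis by simp
qed

lemma stationary_X: "stationary M (\<lambda>t \<omega>. - X t \<omega>)"
  unfolding stationary_def
proof (intro allI fdd_eqI prob_space_axioms)
  fix s and T :: "real set" and a assume T: "finite T"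
  have "emeasure M {\<omega>\<in>space M. \<forall>t\<in>T. - X (t + s) \<omega> \<le> a t} =
      emeasure M {\<omega>\<in>space M. \<forall>t\<in>(\<lambda>t. t + s) ` T. - X t \<omega> \<le> a (t - s)}"
    by simp
  also have "\<dots> = emeasure M {\<omega>\<in>space M. \<forall>t\<in>T. - X t \<omega> \<le> a t}"
    using T by (subst cdf_X) (simp, simp only: emeasure_low_shift cdf_X)
  finally show "emeasure M {\<omega>\<in>space M. \<forall>t\<in>T. - X (t + s) \<omega> \<le> a t} = emeasure M {\<omega>\<in>space M. \<forall>t\<in>T. - X t \<omega> \<le> a t}" .
qed measurable

text \<open>The ball of radius 1 - r has finite \<nu>-measure, so with positive probability it
  contains no particle at time t. Then \<open>- X t \<le> r - 1\<close>, which contradicts a lower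
  bound r.\<close>

lemma essinf_X: "essinf M (\<lambda>\<omega>. - X t \<omega>) = - \<infinity>"
proof -
  have "a = - \<infinity>" if a: "AE \<omega> in M. a \<le> ereal (- X t \<omega>)" for a
  proof (rule ccontr)
    assume "a \<noteq> - \<infinity>"
    then obtain r where r: "ereal r \<le> a"
      by (cases a) auto
    have "AE \<omega> in M. \<not> - X t \<omega> \<le> r - 1"
      using a
    proof eventually_elim
      case (elim \<omega>)
      then have "ereal r \<le> ereal (- X t \<omega>)" using r by (rule order_trans[rotated])
      then show ?case by simp
    qed
    then have "emeasure M {\<omega>\<in>space M. - X t \<omega> \<le> r - 1} = 0"
      by (intro emeasure_eq_0_AE)
    then have "enexp (emeasure path_measure (low pos {t} (\<lambda>_. r - 1))) = 0"
      using cdf_X[of "{t}" "\<lambda>_. r - 1"] by simp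
    moreover have "low pos {t} (\<lambda>_. r - 1) = {x. pos x t \<in> ball 0 (1 - r)}"
      by auto
    ultimately show False
      using emeasure_\<nu>_ball[of "1 - r"] emeasure_path_eval[of "ball 0 (1 - r)" t]
      by (auto simp: enexp_eq_0_iff)
  qed
  then show ?thesis
    unfolding essinf_def by (intro antisym Sup_least) auto
qed

lemma spectral_measurable [measurable]: "spectral pos t \<in> borel_measurable borel"
  unfolding spectral_def by measurable

lemma spectral_L_vee: "spectral pos t \<in> L_vee path_measure"
proof -
  have "emeasure path_measure {x. spectral pos t x > a} < \<infinity>" if "a > 0" for a
  proof -
    have "a < exp (- r) \<longleftrightarrow> r < - ln a" for r
      using that by (metis exp_gt_zero exp_ln ln_exp ln_less_cancel_iff less_minus_iff)
    then have "{x. spectral pos t x > a} = {x. pos x t \<in> ball 0 (- ln a)}"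
      by (auto simp: spectral_def)
    then show ?thesis
      using emeasure_\<nu>_ball[of "- ln a"] emeasure_path_eval[of "ball 0 (- ln a)" t] by simp
  qed
  then show ?thesis
    by (auto simp: L_vee_def) (auto simp: spectral_def)
qed

text \<open>Exponentials vanish nowhere, so the time 0 alone rules out every set of positive
  measure.\<close>

lemma full_support_spectral: "full_support path_measure (spectral pos)"
proof -
  have False if "B \<in> sets path_measure" "0 < emeasure path_measure B" "AE x in path_measure. x \<in> B \<longrightarrow> spectral pos 0 x = 0" for B
  proof -
    have "AE x in path_measure. x \<notin> B"
      using that(3) by (simp add: spectral_def)
    then have "emeasure path_measure B = 0"
      using AE_iff_measurable[of B path_measure "\<lambda>x. x \<notin> B"] that(1) by simp
    then show False using that(2) by simp
  qed
  then show ?thesis unfolding full_support_def by blast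
qed

text \<open>A Poisson process on the prescribed sample space of optional points arises by
  transporting Q along \<phi>, which declares every point present. The \<sigma>-algebra there is
  pulled back from the coordinates, which makes \<phi> and all point maps measurable.\<close>

lemma spectral_representation_X: "spectral_representation M (\<lambda>t \<omega>. exp (- X t \<omega>)) path_measure (spectral pos)"
  unfolding spectral_representation_def
proof (intro conjI allI spectral_L_vee exI)
  let ?P = "\<Pi>\<^sub>M i\<in>(UNIV :: nat set). (borel :: (nat \<Rightarrow> real) measure)"
  let ?U = "\<lambda>n (w :: nat \<Rightarrow> (nat \<Rightarrow> real) option). the (w n)"
  define \<Sigma> where "\<Sigma> = vimage_algebra UNIV (\<lambda>w n. ?U n w) ?P"
  define \<phi> where "\<phi> \<omega> n = Some (Q n \<omega>)" for \<omega> n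
  let ?N = "distr M \<Sigma> \<phi>"
  have \<phi> [measurable]: "\<phi> \<in> M \<rightarrow>\<^sub>M \<Sigma>"
    unfolding \<Sigma>_def by (rule measurable_vimage_algebra2) (auto simp: \<phi>_def intro!: measurable_abs_UNIV)
  have U [measurable]: "?U n \<in> \<Sigma> \<rightarrow>\<^sub>M borel" for n
  proof -
    have "(\<lambda>w n. ?U n w) \<in> \<Sigma> \<rightarrow>\<^sub>M ?P"
      unfolding \<Sigma>_def by (rule measurable_vimage_algebra1) (auto simp: space_PiM)
    from measurable_compose[OF this measurable_component_singleton[of n]] show ?thesis by simp
  qed
  then have U': "?U n \<in> \<Sigma> \<rightarrow>\<^sub>M path_measure" for n by simp
  show "prob_space ?N" by (rule prob_space_distr) measurable
  show "poisson_process ?N path_measure (\<lambda>_. UNIV) ?U"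
    using Q by (subst poisson_process_distr_iff[OF prob_space_axioms \<phi> U']) (simp add: \<phi>_def)
  have ext: "extremal_integral (\<lambda>_. UNIV) ?U (spectral pos t) = (\<lambda>w. SUP n. spectral pos t (?U n w))" for t
    by (simp add: extremal_integral_def fun_eq_iff)
  have ext_meas [measurable]: "extremal_integral (\<lambda>_. UNIV) ?U (spectral pos t) \<in> borel_measurable \<Sigma>" for t
    unfolding ext by (intro borel_measurable_cSUP) (auto intro!: bdd_aboveI[of _ 1] simp: spectral_def)
  have ext_\<phi>: "AE \<omega> in M. exp (- X t \<omega>) = extremal_integral (\<lambda>_. UNIV) ?U (spectral pos t) (\<phi> \<omega>)" for t
    using X_eq[of t] by eventually_elim (simp add: ext \<phi>_def spectral_def SUP_exp_uminus)
  show "fdd_eq M (\<lambda>t \<omega>. exp (- X t \<omega>)) ?N (\<lambda>t. extremal_integral (\<lambda>_. UNIV) ?U (spectral pos t))"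
    unfolding fdd_eq_def
  proof (intro conjI allI impI)
    fix T :: "real set" assume T: "finite T"
    have "distr ?N (\<Pi>\<^sub>M t\<in>T. borel) (\<lambda>w. \<lambda>t\<in>T. extremal_integral (\<lambda>_. UNIV) ?U (spectral pos t) w) =
        distr M (\<Pi>\<^sub>M t\<in>T. borel) (\<lambda>\<omega>. \<lambda>t\<in>T. extremal_integral (\<lambda>_. UNIV) ?U (spectral pos t) (\<phi> \<omega>))"
      by (subst distr_distr) (auto intro!: measurable_restrict simp: comp_def)
    also have "\<dots> = distr M (\<Pi>\<^sub>M t\<in>T. borel) (\<lambda>\<omega>. \<lambda>t\<in>T. exp (- X t \<omega>))"
    proof (rule distr_cong_AE)
      have "AE \<omega> in M. \<forall>t\<in>T. exp (- X t \<omega>) = extremal_integral (\<lambda>_. UNIV) ?U (spectral pos t) (\<phi> \<omega>)"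
        using T ext_\<phi> by (intro AE_finite_allI) auto
      then show "AE \<omega> in M. (\<lambda>t\<in>T. extremal_integral (\<lambda>_. UNIV) ?U (spectral pos t) (\<phi> \<omega>)) = (\<lambda>t\<in>T. exp (- X t \<omega>))"
        by eventually_elim (auto simp: restrict_def fun_eq_iff)
    qed (auto intro!: measurable_restrict measurable_compose[OF \<phi>])
    finally show "distr M (\<Pi>\<^sub>M t\<in>T. borel) (\<lambda>\<omega>. \<lambda>t\<in>T. exp (- X t \<omega>)) =
      distr ?N (\<Pi>\<^sub>M t\<in>T. borel) (\<lambda>w. \<lambda>t\<in>T. extremal_integral (\<lambda>_. UNIV) ?U (spectral pos t) w)" by simp
  qed auto
qed

lemma flow_represented_X:
  assumes "P path_measure (path_shift TYPE('k))"
  shows "flow_represented P M (\<lambda>t \<omega>. exp (- X t \<omega>))"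
  unfolding flow_represented_def
  using assms sigma_finite_borel_space_path_measure spectral_representation_X full_support_spectral
  by (intro exI[of _ path_measure] exI[of _ "spectral pos"] exI[of _ "path_shift TYPE('k)"])
    (simp add: spectral_def path_eval_path_shift)

end

section \<open>Max-infinite divisibility by thinning\<close>

lemma distr_pair_snd:
  assumes "prob_space M" "prob_space L"
  shows "distr (M \<Otimes>\<^sub>M L) L snd = L"
proof (rule measure_eqI)
  interpret M: prob_space M by fact
  interpret L: prob_space L by fact
  fix A assume "A \<in> sets (distr (M \<Otimes>\<^sub>M L) L snd)"
  then have A [measurable]: "A \<in> sets L" by simp
  have "snd -` A \<inter> space (M \<Otimes>\<^sub>M L) = space M \<times> A"
    using sets.sets_into_space[OF A] by (auto simp: space_pair_measure)
  then show "emeasure (distr (M \<Otimes>\<^sub>M L) L snd) A = emeasure L A"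
    by (subst emeasure_distr) (auto simp: L.emeasure_pair_measure_Times M.emeasure_space_1)
qed simp

lemma distr_pair_measure_rectangle:
  assumes "prob_space M" "prob_space L" and [measurable]: "f \<in> M \<rightarrow>\<^sub>M S" "g \<in> L \<rightarrow>\<^sub>M T"
  shows "distr (M \<Otimes>\<^sub>M L) (S \<Otimes>\<^sub>M T) (\<lambda>z. (f (fst z), g (snd z))) =
    distr (M \<Otimes>\<^sub>M L) S (\<lambda>z. f (fst z)) \<Otimes>\<^sub>M distr (M \<Otimes>\<^sub>M L) T (\<lambda>z. g (snd z))"
proof -
  interpret M: prob_space M by fact
  interpret L: prob_space L by fact
  interpret P: pair_prob_space M L ..
  interpret T: prob_space "distr L T g" by (rule L.prob_space_distr) simp
  have fst: "distr (M \<Otimes>\<^sub>M L) S (\<lambda>z. f (fst z)) = distr M S f"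
    by (subst L.distr_pair_fst[of M, symmetric]) (subst distr_distr, auto simp: comp_def)
  have snd: "distr (M \<Otimes>\<^sub>M L) T (\<lambda>z. g (snd z)) = distr L T g"
  proof -
    have "distr (M \<Otimes>\<^sub>M L) T (\<lambda>z. g (snd z)) = distr (distr (M \<Otimes>\<^sub>M L) L snd) T g"
      by (subst distr_distr) (auto simp: comp_def)
    then show ?thesis by (simp only: distr_pair_snd[OF assms(1,2)])
  qed
  show ?thesis
    unfolding fst snd
    by (subst pair_measure_distr) (auto simp: T.sigma_finite_measure_axioms case_prod_unfold)
qed

text \<open>The infimum over one label class is formed in \<open>ereal\<close>, where particles of
  other classes count as \<infinity>; one finite value makes it a real number.\<close>

lemma real_of_ereal_INF_le:
  fixes h :: "'i \<Rightarrow> ereal"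
  assumes "\<And>i. 0 \<le> h i" "h k < \<infinity>"
  shows "- real_of_ereal (INF i. h i) \<le> a \<longleftrightarrow> (\<forall>i. ereal (- a) \<le> h i)"
proof -
  have "0 \<le> (INF i. h i)" by (rule INF_greatest) (rule assms(1))
  moreover have "(INF i. h i) < \<infinity>"
    using assms(2) by (rule order_le_less_trans[OF INF_lower, rotated]) simp
  ultimately obtain r where r: "(INF i. h i) = ereal r" by (cases "INF i. h i") auto
  have "- real_of_ereal (INF i. h i) \<le> a \<longleftrightarrow> ereal (- a) \<le> (INF i. h i)"
    unfolding r by (auto simp: minus_le_iff)
  then show ?thesis by (simp add: le_INF_iff)
qed

context brownian_points
begin

lemma emeasure_path_measure_UNIV: "emeasure path_measure UNIV = \<infinity>"
  using emeasure_path_eval[of UNIV 0] l by (simp add: emeasure_\<nu> ennreal_mult_top)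

text \<open>Every particle receives an independent label, uniform on \<open>{..<n}\<close>, and by
  marking the labelled particles form a Poisson process. The condition on \<open>Z j\<close> says
  that no particle labelled j lies in \<open>low pos (T j) (a j)\<close>; so the joint orthant event
  of all \<open>Z j\<close> is a single void event, whose exponent is a sum over j.\<close>

lemma thinning:
  fixes n :: nat
  assumes n: "0 < n"
  obtains M' :: "('a \<times> (nat \<Rightarrow> nat)) measure" and Z :: "nat \<Rightarrow> real \<Rightarrow> 'a \<times> (nat \<Rightarrow> nat) \<Rightarrow> real"
  where "prob_space M'" "\<And>j t. Z j t \<in> borel_measurable M'"
    "\<And>T a. (\<And>j. j < n \<Longrightarrow> finite (T j)) \<Longrightarrow>
      emeasure M' {z\<in>space M'. \<forall>j<n. \<forall>t\<in>T j. Z j t z \<le> a j t} =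
      enexp (\<Sum>j<n. emeasure path_measure (low pos (T j) (a j)) * ennreal (1 / real n))"
proof -
  define K where "K = uniform_count_measure {..<n}"
  have spaceK: "space K = {..<n}" and setsK: "sets K = Pow {..<n}"
    by (auto simp: K_def space_uniform_count_measure sets_uniform_count_measure)
  have sing: "emeasure K {j} = ennreal (1 / real n)" "{j} \<in> sets K" if "j < n" for j
    using that by (auto simp: K_def emeasure_uniform_count_measure sets_uniform_count_measure)
  interpret K: prob_space K
    unfolding K_def using n by (intro prob_space_uniform_count_measure) auto
  define L where "L = (\<Pi>\<^sub>M i\<in>(UNIV::nat set). K)"
  interpret L: prob_space L unfolding L_def by (intro prob_space_PiM K.prob_space_axioms)
  define M' where "M' = M \<Otimes>\<^sub>M L"
  interpret P: pair_prob_space M L ..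
  have M': "prob_space M'" unfolding M'_def by (rule P.prob_space_axioms)
  then interpret M': prob_space M' .
  have fst_m [measurable]: "fst \<in> M' \<rightarrow>\<^sub>M M" unfolding M'_def by simp
  have snd_m [measurable]: "snd \<in> M' \<rightarrow>\<^sub>M (\<Pi>\<^sub>M i\<in>(UNIV::nat set). K)" unfolding M'_def L_def by simp
  have lab [measurable]: "(\<lambda>z. snd z i) \<in> M' \<rightarrow>\<^sub>M K" for i
    using measurable_compose[OF snd_m measurable_component_singleton[of i UNIV "\<lambda>_. K"]] by simp
  have distr_fst: "distr M' M fst = M"
    unfolding M'_def by (rule L.distr_pair_fst)
  have distr_snd: "distr M' L snd = L"
    unfolding M'_def by (rule distr_pair_snd[OF prob_space_axioms L.prob_space_axioms])
  have Q': "poisson_process M' path_measure (\<lambda>_. UNIV) (\<lambda>i z. Q i (fst z))"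
    using poisson_process_distr_iff[OF M' fst_m, of Q path_measure] Q poisson_process_measurable[OF Q]
    by (simp add: distr_fst)
  have labels: "distr M' K (\<lambda>z. snd z i) = K" for i
  proof -
    have "distr M' K (\<lambda>z. snd z i) = distr (distr M' L snd) K (\<lambda>w. w i)"
      by (subst distr_distr) (auto simp: comp_def L_def)
    also have "\<dots> = K"
      unfolding distr_snd unfolding L_def by (rule distr_PiM_component) (auto simp: K.prob_space_axioms)
    finally show ?thesis .
  qed
  have indep: "M'.indep_vars (\<lambda>_. K) (\<lambda>i z. snd z i) UNIV"
    using distr_snd by (subst M'.indep_vars_iff_distr_eq_PiM) (auto simp: labels restrict_UNIV L_def)
  have Qs: "(\<lambda>\<omega> i. Q i \<omega>) \<in> M \<rightarrow>\<^sub>M (\<Pi>\<^sub>M i\<in>UNIV. path_measure)"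
    by (intro measurable_abs_UNIV poisson_process_measurable[OF Q])
  have prod: "distr M' ((\<Pi>\<^sub>M i\<in>UNIV. path_measure) \<Otimes>\<^sub>M (\<Pi>\<^sub>M i\<in>UNIV. K)) (\<lambda>z. (\<lambda>i. Q i (fst z), \<lambda>i. snd z i)) =
      distr M' (\<Pi>\<^sub>M i\<in>UNIV. path_measure) (\<lambda>z i. Q i (fst z)) \<Otimes>\<^sub>M distr M' (\<Pi>\<^sub>M i\<in>UNIV. K) (\<lambda>z i. snd z i)"
    unfolding M'_def
    using distr_pair_measure_rectangle[OF prob_space_axioms L.prob_space_axioms Qs, of "\<lambda>w. w" "\<Pi>\<^sub>M i\<in>UNIV. K"]
    by (simp add: L_def)
  define R where "R i z = (Q i (fst z), snd z i)" for i and z :: "'a \<times> (nat \<Rightarrow> nat)"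
  have R: "poisson_process M' (path_measure \<Otimes>\<^sub>M K) (\<lambda>_. UNIV) R"
    unfolding R_def by (rule poisson_process_marking[OF M' Q' indep labels prod])
  \<comment> \<open>A label class has infinite mass and is therefore almost surely nonempty. An
    empty class would have infimum \<infinity>, which \<open>real_of_ereal\<close> sends to
    0.\<close>
  have "AE z in M'. \<forall>j\<in>{..<n}. \<exists>i. snd z i = j"
  proof (intro AE_finite_allI)
    fix j assume j: "j \<in> {..<n}"
    have "emeasure M' {z\<in>space M'. \<forall>i. R i z \<notin> UNIV \<times> {j}} = enexp (emeasure (path_measure \<Otimes>\<^sub>M K) (UNIV \<times> {j}))"
      using sing[of j] j by (intro void_probability[OF M' R] pair_measureI) auto
    also have "\<dots> = 0"
      using sing[of j] j n emeasure_path_measure_UNIV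
      by (subst K.emeasure_pair_measure_Times) (auto simp: ennreal_top_mult)
    finally have "emeasure M' {z\<in>space M'. \<forall>i. snd z i \<noteq> j} = 0"
      by (simp add: R_def)
    moreover have "{z\<in>space M'. \<forall>i. snd z i \<noteq> j} \<in> sets M'"
    proof -
      have "{z\<in>space M'. snd z i \<noteq> j} \<in> sets M'" for i
        using measurable_sets[OF lab, of "{..<n} - {j}" i] measurable_space[OF lab]
        by (auto simp: setsK spaceK vimage_def Int_def conj_commute cong: conj_cong)
      then show ?thesis by (rule sets.sets_Collect_countable_All)
    qed
    ultimately show "AE z in M'. \<exists>i. snd z i = j"
      by (intro AE_I[of _ _ "{z\<in>space M'. \<forall>i. snd z i \<noteq> j}"]) auto
  qed simp
  define h where "h j t z i = (if snd z i = j then ereal (norm (pos (Q i (fst z)) t)) else \<infinity>)"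
    for j :: nat and t and z :: "'a \<times> (nat \<Rightarrow> nat)" and i
  define Z where "Z j t z = - real_of_ereal (INF i. h j t z i)" for j t z
  have Zm [measurable]: "Z j t \<in> borel_measurable M'" for j t
  proof -
    have [measurable]: "Measurable.pred M' (\<lambda>z. snd z i = j)" for i
    proof -
      have "(\<lambda>z. snd z i) -` ({..<n} \<inter> {j}) \<inter> space M' \<in> sets M'"
        by (rule measurable_sets[OF lab]) (auto simp: setsK)
      also have "(\<lambda>z. snd z i) -` ({..<n} \<inter> {j}) \<inter> space M' = {z\<in>space M'. snd z i = j}"
        using measurable_space[OF lab] by (auto simp: spaceK)
      finally show ?thesis by (simp add: pred_def)
    qed
    show ?thesis unfolding Z_def h_def by measurable
  qed
  show ?thesis
  proof (rule that[OF M' Zm])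
    fix T :: "nat \<Rightarrow> real set" and a assume T: "\<And>j. j < n \<Longrightarrow> finite (T j)"
    \<comment> \<open>Different labels make the pieces disjoint, so their masses add up; each
      carries the factor 1 / n of its label.\<close>
    define B where "B = (\<Union>j<n. low pos (T j) (a j) \<times> {j})"
    have Bj: "low pos (T j) (a j) \<times> {j} \<in> sets (path_measure \<Otimes>\<^sub>M K)" if "j < n" for j
      using that T sing by (intro pair_measureI) auto
    then have B: "B \<in> sets (path_measure \<Otimes>\<^sub>M K)" unfolding B_def by (intro sets.finite_UN) auto
    have "emeasure (path_measure \<Otimes>\<^sub>M K) B = (\<Sum>j<n. emeasure (path_measure \<Otimes>\<^sub>M K) (low pos (T j) (a j) \<times> {j}))"
      unfolding B_def using Bj by (intro sum_emeasure[symmetric]) (auto simp: disjoint_family_on_def)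
    also have "\<dots> = (\<Sum>j<n. emeasure path_measure (low pos (T j) (a j)) * ennreal (1 / real n))"
      using T sing by (intro sum.cong refl) (subst K.emeasure_pair_measure_Times, auto)
    finally have EB: "emeasure (path_measure \<Otimes>\<^sub>M K) B = (\<Sum>j<n. emeasure path_measure (low pos (T j) (a j)) * ennreal (1 / real n))" .
    have "emeasure M' {z\<in>space M'. \<forall>j<n. \<forall>t\<in>T j. Z j t z \<le> a j t} = emeasure M' {z\<in>space M'. \<forall>i. R i z \<notin> B}"
    proof (rule emeasure_eq_AE)
      show "AE z in M'. z \<in> {z\<in>space M'. \<forall>j<n. \<forall>t\<in>T j. Z j t z \<le> a j t} \<longleftrightarrow> z \<in> {z\<in>space M'. \<forall>i. R i z \<notin> B}"
        using \<open>AE z in M'. \<forall>j\<in>{..<n}. \<exists>i. snd z i = j\<close>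
      proof eventually_elim
        case (elim z)
        have "Z j t z \<le> a j t \<longleftrightarrow> (\<forall>i. snd z i = j \<longrightarrow> \<not> norm (pos (Q i (fst z)) t) < - a j t)" if j: "j < n" for j t
        proof -
          obtain k where "snd z k = j" using elim j by auto
          then have "h j t z k < \<infinity>" by (simp add: h_def)
          then show ?thesis
            unfolding Z_def by (subst real_of_ereal_INF_le) (auto simp: h_def not_less)
        qed
        then have Z_iff: "(\<forall>j<n. \<forall>t\<in>T j. Z j t z \<le> a j t) \<longleftrightarrow>
            (\<forall>j<n. \<forall>t\<in>T j. \<forall>i. snd z i = j \<longrightarrow> \<not> norm (pos (Q i (fst z)) t) < - a j t)"
          by simp
        have R_iff: "R i z \<in> B \<longleftrightarrow> snd z i < n \<and> (\<exists>t\<in>T (snd z i). norm (pos (Q i (fst z)) t) < - a (snd z i) t)" for i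
          by (auto simp: B_def R_def)
        have "(\<forall>j<n. \<forall>t\<in>T j. Z j t z \<le> a j t) \<longleftrightarrow> (\<forall>i. R i z \<notin> B)"
          unfolding Z_iff R_iff by metis
        then show ?case by simp
      qed
      have "{z\<in>space M'. Z j t z \<le> a j t} \<in> sets M'" for j t
        by measurable
      then have "{z\<in>space M'. \<forall>t\<in>T j. Z j t z \<le> a j t} \<in> sets M'" if "j < n" for j
        using T[OF that] by (rule sets.sets_Collect_finite_All)
      then have "{z\<in>space M'. \<forall>j\<in>{..<n}. \<forall>t\<in>T j. Z j t z \<le> a j t} \<in> sets M'"
        by (rule sets.sets_Collect_finite_All) auto
      then show "{z\<in>space M'. \<forall>j<n. \<forall>t\<in>T j. Z j t z \<le> a j t} \<in> sets M'"
        by (simp only: Ball_def lessThan_iff)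
      have [measurable]: "R i \<in> M' \<rightarrow>\<^sub>M path_measure \<Otimes>\<^sub>M K" for i
        by (rule poisson_process_measurable[OF R])
      show "{z\<in>space M'. \<forall>i. R i z \<notin> B} \<in> sets M'"
        using B by measurable
    qed
    also have "\<dots> = enexp (emeasure (path_measure \<Otimes>\<^sub>M K) B)"
      by (rule void_probability[OF M' R B])
    finally show "emeasure M' {z\<in>space M'. \<forall>j<n. \<forall>t\<in>T j. Z j t z \<le> a j t} =
      enexp (\<Sum>j<n. emeasure path_measure (low pos (T j) (a j)) * ennreal (1 / real n))"
      by (simp add: EB)
  qed
qed

text \<open>The processes of \<open>thinning\<close> are moved to their law on sequences of paths,
  the sample space that the definition prescribes. The exponent of the joint orthant event is
  additive over the labels, which gives independence; each summand is 1 / n of the exponent for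
  \<open>- X\<close>, so n equal ones restore its law.\<close>

lemma max_id_X: "max_id M (\<lambda>t \<omega>. - X t \<omega>)"
  unfolding max_id_def
proof (intro allI impI)
  fix n :: nat assume "n \<ge> 1"
  then have n: "0 < n" by simp
  obtain M' :: "('a \<times> (nat \<Rightarrow> nat)) measure" and Z where M': "prob_space M'"
    and Z [measurable]: "\<And>j t. Z j t \<in> borel_measurable M'"
    and cdf: "\<And>T a. (\<And>j. j < n \<Longrightarrow> finite (T j)) \<Longrightarrow>
      emeasure M' {z\<in>space M'. \<forall>j<n. \<forall>t\<in>T j. Z j t z \<le> a j t} =
      enexp (\<Sum>j<n. emeasure path_measure (low pos (T j) (a j)) * ennreal (1 / real n))"
    by (rule thinning[OF n]) blast
  let ?S = "\<Pi>\<^sub>M j\<in>(UNIV::nat set). \<Pi>\<^sub>M t\<in>(UNIV::real set). (borel :: real measure)"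
  define N where "N = distr M' ?S (\<lambda>z j t. Z j t z)"
  have Zs [measurable]: "(\<lambda>z j t. Z j t z) \<in> M' \<rightarrow>\<^sub>M ?S"
    by (intro measurable_abs_UNIV Z)
  have coord: "(\<lambda>w. w j t) \<in> borel_measurable ?S" for j t
    using measurable_compose[OF measurable_component_singleton[of j UNIV] measurable_component_singleton[of t UNIV]]
    by simp
  then have coordN [measurable]: "(\<lambda>w. w j t) \<in> borel_measurable N" for j t by (simp add: N_def)
  have N: "prob_space N" unfolding N_def by (rule prob_space.prob_space_distr[OF M' Zs])
  have cdfN: "emeasure N {w\<in>space N. \<forall>j<n. \<forall>t\<in>T j. w j t \<le> a j t} =
      enexp (\<Sum>j<n. emeasure path_measure (low pos (T j) (a j)) * ennreal (1 / real n))"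
    if T: "\<And>j. j < n \<Longrightarrow> finite (T j)" for T a
  proof -
    have "{w\<in>space ?S. \<forall>t\<in>T j. w j t \<le> a j t} \<in> sets ?S" if "j < n" for j
      using T[OF that] coord by (intro sets.sets_Collect_finite_All borel_measurable_le) auto
    then have "{w\<in>space ?S. \<forall>j\<in>{..<n}. \<forall>t\<in>T j. w j t \<le> a j t} \<in> sets ?S"
      by (rule sets.sets_Collect_finite_All) auto
    then have S: "{w\<in>space N. \<forall>j<n. \<forall>t\<in>T j. w j t \<le> a j t} \<in> sets ?S"
      by (simp only: N_def space_distr Ball_def lessThan_iff)
    have "(\<lambda>z j t. Z j t z) -` {w\<in>space N. \<forall>j<n. \<forall>t\<in>T j. w j t \<le> a j t} \<inter> space M' = {z\<in>space M'. \<forall>j<n. \<forall>t\<in>T j. Z j t z \<le> a j t}"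
      by (auto simp: N_def space_PiM)
    then show ?thesis
      using cdf[of T a, OF T] emeasure_distr[OF Zs S] by (simp add: N_def)
  qed
  have cdf1: "emeasure N {w\<in>space N. \<forall>t\<in>T. w j t \<le> a t} = enexp (emeasure path_measure (low pos T a) * ennreal (1 / real n))"
    if T: "finite T" and j: "j < n" for T a j
  proof -
    \<comment> \<open>With no times, the other labels contribute the mass of the empty set, which is
      0.\<close>
    let ?T = "\<lambda>i. if i = j then T else {}"
    have "emeasure N {w\<in>space N. \<forall>t\<in>T. w j t \<le> a t} = emeasure N {w\<in>space N. \<forall>i<n. \<forall>t\<in>?T i. w i t \<le> a t}"
      using j by (intro arg_cong[where f="emeasure N"]) (auto split: if_splits)
    also have "\<dots> = enexp (\<Sum>i<n. emeasure path_measure (low pos (?T i) a) * ennreal (1 / real n))"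
      using T by (intro cdfN) auto
    also have "(\<Sum>i<n. emeasure path_measure (low pos (?T i) a) * ennreal (1 / real n)) =
        (\<Sum>i<n. if i = j then emeasure path_measure (low pos T a) * ennreal (1 / real n) else 0)"
      by (intro sum.cong) auto
    finally show ?thesis using j by simp
  qed
  show "\<exists>(N :: (nat \<Rightarrow> real \<Rightarrow> real) measure) Z. prob_space N \<and>
      prob_space.indep_vars N (\<lambda>_. \<Pi>\<^sub>M t\<in>UNIV. borel) (\<lambda>j \<omega> t. Z j t \<omega>) {..<n} \<and>
      (\<forall>i<n. \<forall>j<n. fdd_eq N (Z i) N (Z j)) \<and>
      fdd_eq M (\<lambda>t \<omega>. - X t \<omega>) N (\<lambda>t \<omega>. MAX j\<in>{..<n}. Z j t \<omega>)"
  proof (intro exI[of _ N] exI[of _ "\<lambda>j t w. w j t"] conjI allI impI N)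
    show "prob_space.indep_vars N (\<lambda>_. \<Pi>\<^sub>M t\<in>UNIV. borel) (\<lambda>j w t. w j t) {..<n}"
      by (intro indep_processesI[OF N n] coordN) (simp add: cdfN cdf1 enexp_sum)
    show "fdd_eq N (\<lambda>t w. w i t) N (\<lambda>t w. w j t)" if "i < n" "j < n" for i j
      using that by (intro fdd_eqI N coordN) (simp add: cdf1)
    show "fdd_eq M (\<lambda>t \<omega>. - X t \<omega>) N (\<lambda>t w. MAX j\<in>{..<n}. w j t)"
    proof (intro fdd_eqI prob_space_axioms N)
      show "(\<lambda>w. MAX j\<in>{..<n}. w j t) \<in> borel_measurable N" for t
        by (intro borel_measurable_Max) auto
      fix T :: "real set" and a assume T: "finite T"
      have "(MAX j\<in>{..<n}. w j t) \<le> a t \<longleftrightarrow> (\<forall>j<n. w j t \<le> a t)" for w :: "nat \<Rightarrow> real \<Rightarrow> real" and t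
        using n by (subst Max_le_iff) auto
      then have "emeasure N {w\<in>space N. \<forall>t\<in>T. (MAX j\<in>{..<n}. w j t) \<le> a t} = emeasure N {w\<in>space N. \<forall>j<n. \<forall>t\<in>T. w j t \<le> a t}"
        by (intro arg_cong[where f="emeasure N"]) auto
      also have "\<dots> = enexp (\<Sum>j<n. emeasure path_measure (low pos T a) * ennreal (1 / real n))"
        using T by (rule cdfN)
      also have "(\<Sum>j<n. emeasure path_measure (low pos T a) * ennreal (1 / real n)) = emeasure path_measure (low pos T a) * (of_nat n * ennreal (1 / real n))"
        by (simp add: ac_simps)
      also have "of_nat n * ennreal (1 / real n) = 1"
        using n by (simp add: ennreal_of_nat_eq_real_of_nat ennreal_mult[symmetric])
      finally show "emeasure M {\<omega>\<in>space M. \<forall>t\<in>T. - X t \<omega> \<le> a t} = emeasure N {w\<in>space N. \<forall>t\<in>T. (MAX j\<in>{..<n}. w j t) \<le> a t}"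
        using T by (simp add: cdf_X)
    qed measurable
  qed
qed

end

section \<open>Dissipativity in high dimension\<close>

definition gauss :: "real \<Rightarrow> real ^ 'k::finite \<Rightarrow> real" where
  "gauss v x = (\<Prod>i\<in>UNIV. normal_density 0 (sqrt v) (x $ i))"

lemma gauss_pos: "0 < v \<Longrightarrow> 0 < gauss v x"
  unfolding gauss_def by (intro prod_pos) (simp add: normal_density_pos)

lemma gauss_nonneg: "0 \<le> gauss v x"
  unfolding gauss_def by (intro prod_nonneg) simp

lemma gauss_uminus: "gauss v (- x) = gauss v x"
  by (simp add: gauss_def normal_density_def)

lemma measurable_gauss [measurable]: "gauss v \<in> borel_measurable borel"
  unfolding gauss_def[abs_def] by (intro borel_measurable_prod) measurable

text \<open>Only the decay in v matters, so the factor 2 pi > 1 under the root is dropped.\<close>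

lemma normal_density_le:
  assumes "0 < v" shows "normal_density 0 (sqrt v) x \<le> 1 / sqrt v"
proof -
  have "normal_density 0 (sqrt v) x = exp (- x\<^sup>2 / (2 * v)) / sqrt (2 * pi * v)"
    using assms by (simp add: normal_density_def)
  also have "\<dots> \<le> 1 / sqrt (2 * pi * v)"
    using assms by (intro divide_right_mono) auto
  also have "\<dots> \<le> 1 / sqrt v"
    using assms pi_gt3 by (intro divide_left_mono) (auto intro!: mult_pos_pos)
  finally show ?thesis .
qed

lemma gauss_le: "0 < v \<Longrightarrow> gauss v (x :: real ^ 'k::finite) \<le> (1 / sqrt v) ^ CARD('k)"
  using prod_mono[of UNIV "\<lambda>i. normal_density 0 (sqrt v) (x $ i)" "\<lambda>_. 1 / sqrt v"] normal_density_le[of v]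
  by (simp add: gauss_def)

lemma gauss_ge:
  assumes "0 < v" and x: "norm (x :: real ^ 'k::finite) \<le> r"
  shows "(exp (- r\<^sup>2 / (2 * v)) / sqrt (2 * pi * v)) ^ CARD('k) \<le> gauss v x"
proof -
  have "exp (- r\<^sup>2 / (2 * v)) / sqrt (2 * pi * v) \<le> normal_density 0 (sqrt v) (x $ i)" for i
  proof -
    have "\<bar>x $ i\<bar> \<le> r" using x component_le_norm_cart[of x i] by linarith
    then have "(x $ i)\<^sup>2 \<le> r\<^sup>2" by (rule abs_le_square_iff[THEN iffD1, OF order_trans[OF _ abs_ge_self]])
    then show ?thesis
      using assms(1) by (auto simp: normal_density_def intro!: divide_right_mono)
  qed
  then have "(\<Prod>i\<in>(UNIV::'k set). exp (- r\<^sup>2 / (2 * v)) / sqrt (2 * pi * v)) \<le> gauss v x"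
    unfolding gauss_def using assms(1) by (intro prod_mono) auto
  then show ?thesis by simp
qed

text \<open>The exponent is - k / 2 for k = 3, the slowest decay to be integrated; beyond time 1
  higher dimensions decay faster.\<close>

lemma nn_integral_powr_tail:
  "(\<integral>\<^sup>+t. ennreal (t powr (- 3 / 2)) * indicator {1..} t \<partial>lborel) < \<infinity>"
proof -
  have "(\<integral>\<^sup>+t. ennreal (t powr (- 3 / 2)) * indicator {1..} t \<partial>lborel) = ennreal (0 - (- 2 * 1 powr (- 1 / 2)))"
  proof (rule nn_integral_FTC_atLeast[where F="\<lambda>t. - 2 * t powr (- 1 / 2)"])
    fix x :: real assume "1 \<le> x"
    then show "((\<lambda>t. - 2 * t powr (- 1 / 2)) has_real_derivative x powr (- 3 / 2)) (at x)"
      using DERIV_cmult[OF has_real_derivative_powr[of x "- 1 / 2"], of "- 2"] by simp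
  next
    show "((\<lambda>t::real. - 2 * t powr (- 1 / 2)) \<longlongrightarrow> 0) at_top"
      using tendsto_mult_right_zero[OF tendsto_neg_powr[OF _ filterlim_ident], of "- 1 / 2" "- 2"] by simp
  qed auto
  then show ?thesis by simp
qed

lemma nn_integral_increment:
  fixes W :: "real \<Rightarrow> 'a \<Rightarrow> real ^ 'k::finite"
  assumes "standard_brownian_motion M W" "s < t" and [measurable]: "f \<in> borel_measurable borel"
  shows "(\<integral>\<^sup>+\<omega>. f (W t \<omega> - W s \<omega>) \<partial>M) = (\<integral>\<^sup>+x. ennreal (gauss (t - s) x) * f x \<partial>lborel)"
proof -
  have D: "distributed M lborel (\<lambda>\<omega>. W t \<omega> - W s \<omega>) (gauss_density (t - s))"
    using assms(1,2) unfolding standard_brownian_motion_def by blast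
  show ?thesis
    using distributed_nn_integral[OF D, of f] by (simp add: gauss_def)
qed

text \<open>On the unit ball the density at time t is at least of order
  \<open>t powr (- k / 2)\<close>, which for k \<le> 2 and t \<ge> 1 is no smaller than 1 / t: the
  harmonic bound behind recurrence. The factor exp (- 1 / 2) bounds exp (- 1 / (2 t)) from
  below.\<close>

lemma emeasure_increment_ball_ge:
  fixes W :: "real \<Rightarrow> 'a \<Rightarrow> real ^ 'k::finite"
  assumes bm: "standard_brownian_motion M W" and k: "CARD('k) \<le> 2" and m: "1 \<le> t"
  shows "ennreal ((exp (- 1 / 2) / sqrt (2 * pi)) ^ CARD('k) * (1 / t)) * emeasure lborel (ball 0 1 :: (real ^ 'k) set) \<le>
    emeasure M {\<omega>\<in>space M. norm (W t \<omega> - W 0 \<omega>) < 1}"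
proof -
  note [measurable] = bm_measurable[OF bm]
  let ?c = "exp (- 1 / 2) / sqrt (2 * pi)"
  have *: "?c ^ CARD('k) * (1 / t) \<le> gauss t x" if "x \<in> ball 0 1" for x :: "real ^ 'k"
  proof -
    have "(1 / sqrt t) ^ 2 \<le> (1 / sqrt t) ^ CARD('k)"
      using k m by (intro power_decreasing) auto
    then have "?c ^ CARD('k) * (1 / t) \<le> ?c ^ CARD('k) * (1 / sqrt t) ^ CARD('k)"
      using m by (intro mult_left_mono) (auto simp: power_divide)
    also have "\<dots> = (exp (- 1 / 2) / sqrt (2 * pi * t)) ^ CARD('k)"
      by (simp add: power_mult_distrib[symmetric] real_sqrt_mult)
    also have "\<dots> \<le> (exp (- 1\<^sup>2 / (2 * t)) / sqrt (2 * pi * t)) ^ CARD('k)"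
      using m by (intro power_mono divide_right_mono) auto
    also have "\<dots> \<le> gauss t x"
      using m that by (intro gauss_ge) auto
    finally show ?thesis .
  qed
  have "ennreal (?c ^ CARD('k) * (1 / t)) * emeasure lborel (ball 0 1 :: (real ^ 'k) set) =
      (\<integral>\<^sup>+x. ennreal (?c ^ CARD('k) * (1 / t)) * indicator (ball 0 1 :: (real ^ 'k) set) x \<partial>lborel)"
    by (simp add: nn_integral_cmult_indicator)
  also have "\<dots> \<le> (\<integral>\<^sup>+x. ennreal (gauss (t - 0) x) * indicator (ball 0 1 :: (real ^ 'k) set) x \<partial>lborel)"
    using * by (intro nn_integral_mono) (auto simp: indicator_def intro!: ennreal_leI)
  also have "\<dots> = (\<integral>\<^sup>+\<omega>. indicator (ball 0 1) (W t \<omega> - W 0 \<omega>) \<partial>M)"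
    using m by (intro nn_integral_increment[OF bm, symmetric] borel_measurable_indicator) auto
  also have "\<dots> = (\<integral>\<^sup>+\<omega>. indicator {\<omega>\<in>space M. norm (W t \<omega> - W 0 \<omega>) < 1} \<omega> \<partial>M)"
    by (intro nn_integral_cong) (auto simp: indicator_def)
  also have "\<dots> = emeasure M {\<omega>\<in>space M. norm (W t \<omega> - W 0 \<omega>) < 1}"
    by (rule nn_integral_indicator) measurable
  finally show ?thesis .
qed

context brownian_paths
begin

text \<open>Fubini reduces a property of almost every path to a fixed starting point, where the
  Brownian estimates apply.\<close>

lemma AE_path_measure_fiber:
  assumes "{x. P x} \<in> sets borel" "\<And>u. AE \<omega> in M. P (path_code (\<lambda>t. u + W t \<omega>))"
  shows "AE x in path_measure. P x"
proof -
  interpret \<nu>: sigma_finite_measure \<nu> by (rule sigma_finite_\<nu>)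
  interpret P: pair_sigma_finite \<nu> M ..
  have [measurable]: "Measurable.pred borel P" using assms(1) by (simp add: pred_def)
  have "AE u in \<nu>. AE \<omega> in M. P (path_code (\<lambda>t. u + W t \<omega>))"
    using assms(2) by simp
  then have "AE z in \<nu> \<Otimes>\<^sub>M M. P (case z of (u, \<omega>) \<Rightarrow> path_code (\<lambda>t. u + W t \<omega>))"
    using measurable_compose[OF measurable_coded_path \<open>Measurable.pred borel P\<close>]
    by (intro P.AE_pair_measure) (auto simp: pred_def)
  then show ?thesis
    unfolding path_measure_def by (subst AE_distr_iff) (auto simp: case_prod_beta)
qed

lemma coded_path_measurable [measurable]:
  "(\<lambda>\<omega>. path_code (\<lambda>t. u + W t \<omega>)) \<in> M \<rightarrow>\<^sub>M borel"
  by (intro measurable_path_code) measurable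

lemma AE_pos_coded_path: "AE \<omega> in M. \<forall>t. pos (path_code (\<lambda>t. u + W t \<omega>)) t = u + W t \<omega>"
  using continuous_W
proof eventually_elim
  case (elim \<omega>)
  then have "continuous_on UNIV (\<lambda>t. u + W t \<omega>)" by (intro continuous_intros)
  then show ?case by (simp add: path_eval_path_code)
qed

lemma W_0: "AE \<omega> in M. W 0 \<omega> = 0"
  using bm by (auto simp: standard_brownian_motion_def)

text \<open>This density is the law of a Brownian increment, hence has total mass 1.\<close>

lemma nn_integral_gauss: "0 < v \<Longrightarrow> (\<integral>\<^sup>+x. ennreal (gauss v (x :: real ^ 'k)) \<partial>lborel) = 1"
  using nn_integral_increment[OF bm, of 0 v "\<lambda>_. 1"] by (simp add: emeasure_space_1)

text \<open>By symmetry of the Gaussian density, negative times behave like positive ones.\<close>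

lemma nn_integral_W_le:
  assumes "t \<noteq> 0"
  shows "(\<integral>\<^sup>+\<omega>. ennreal (gauss 1 (u + W t \<omega>)) \<partial>M) \<le> ennreal ((1 / sqrt \<bar>t\<bar>) ^ CARD('k))"
proof -
  define c where "c = (if t > 0 then u else - u)"
  have "(\<integral>\<^sup>+\<omega>. ennreal (gauss 1 (u + W t \<omega>)) \<partial>M) =
      (\<integral>\<^sup>+\<omega>. ennreal (gauss 1 (c + (W (max t 0) \<omega> - W (min t 0) \<omega>))) \<partial>M)"
    using W_0
  proof (intro nn_integral_cong_AE, eventually_elim)
    case (elim \<omega>)
    have "gauss 1 (- u - W t \<omega>) = gauss 1 (u + W t \<omega>)"
      using gauss_uminus[of 1 "u + W t \<omega>"] by simp
    then show ?case using elim assms by (auto simp: c_def max_def min_def)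
  qed
  also have "\<dots> = (\<integral>\<^sup>+x. ennreal (gauss \<bar>t\<bar> x) * ennreal (gauss 1 (c + x)) \<partial>lborel)"
  proof -
    have "max t 0 - min t 0 = \<bar>t\<bar>" by auto
    then show ?thesis
      using nn_integral_increment[OF bm, of "min t 0" "max t 0" "\<lambda>x. ennreal (gauss 1 (c + x))"] assms by auto
  qed
  \<comment> \<open>The density of the increment is replaced by its uniform bound; the remaining
    translate of \<open>gauss 1\<close> integrates to 1.\<close>
  also have "\<dots> \<le> (\<integral>\<^sup>+x. ennreal ((1 / sqrt \<bar>t\<bar>) ^ CARD('k)) * ennreal (gauss 1 (c + x)) \<partial>lborel)"
    using assms by (intro nn_integral_mono mult_right_mono ennreal_leI gauss_le) auto
  also have "\<dots> = ennreal ((1 / sqrt \<bar>t\<bar>) ^ CARD('k))"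
    using nn_integral_lborel_translate[of "\<lambda>x :: real ^ 'k. ennreal (gauss 1 x)" c]
    by (simp add: nn_integral_cmult nn_integral_gauss)
  finally show ?thesis .
qed

lemma integrable_weight: "integrable path_measure (\<lambda>x. gauss 1 (pos x 0))"
proof (rule integrableI_nonneg)
  have "(\<integral>\<^sup>+x. ennreal (gauss 1 (pos x 0)) \<partial>path_measure) = (\<integral>\<^sup>+u. ennreal (gauss 1 (u :: real ^ 'k)) \<partial>\<nu>)"
    by (rule nn_integral_path_eval) measurable
  also have "\<dots> = ennreal l"
    by (simp add: nn_integral_density nn_integral_cmult nn_integral_gauss)
  finally show "(\<integral>\<^sup>+x. ennreal (gauss 1 (pos x 0)) \<partial>path_measure) < \<infinity>" by simp
qed (auto simp: gauss_nonneg)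

lemma measurable_occupation [measurable]:
  "(\<lambda>(x, t). ennreal (gauss 1 (pos x t))) \<in> borel_measurable (borel \<Otimes>\<^sub>M borel)"
  unfolding case_prod_beta by (intro measurable_compose[OF _ measurable_gauss] measurable_compose[OF _ measurable_ennreal]) measurable

lemma measurable_occupation_time [measurable]:
  "(\<lambda>x. \<integral>\<^sup>+t. ennreal (gauss 1 (pos x t)) \<partial>lborel) \<in> borel_measurable borel"
  by (rule lborel.borel_measurable_nn_integral) (use measurable_occupation in measurable)

text \<open>At every x the shift by t carries the position at time t to time 0, so the orbit
  integral of the weight is the time the path spends near the origin, with Gaussian
  weighting.\<close>

lemma conservative_part_weight:
  "conservative_part path_measure (path_shift TYPE('k)) (\<lambda>x. gauss 1 (pos x 0)) =
    {x. (\<integral>\<^sup>+t. ennreal (gauss 1 (pos x t)) \<partial>lborel) = \<infinity>}"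
  by (simp add: conservative_part_def path_eval_path_shift)

lemma dissipative_shift:
  assumes k: "3 \<le> CARD('k)"
  shows "dissipative_flow path_measure (path_shift TYPE('k))"
  unfolding dissipative_flow_def
proof (intro conjI exI[of _ "\<lambda>x. gauss 1 (pos x 0)"] measure_preserving_flow_shift integrable_weight)
  show "AE x in path_measure. 0 < gauss 1 (pos x 0)"
    by (simp add: gauss_pos)
  have "AE x in path_measure. (\<integral>\<^sup>+t. ennreal (gauss 1 (pos x t)) \<partial>lborel) \<noteq> \<infinity>"
  proof (rule AE_path_measure_fiber)
    show "{x. (\<integral>\<^sup>+t. ennreal (gauss 1 (pos x t)) \<partial>lborel) \<noteq> \<infinity>} \<in> sets borel"
      using measurable_occupation_time by measurable
    fix u :: "real ^ 'k"
    let ?c = "\<lambda>\<omega>. path_code (\<lambda>t. u + W t \<omega>)"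
    interpret P: pair_sigma_finite M lborel ..
    have [measurable]: "(\<lambda>(\<omega>, t). ennreal (gauss 1 (pos (?c \<omega>) t))) \<in> borel_measurable (M \<Otimes>\<^sub>M lborel)"
      unfolding case_prod_beta
      by (intro measurable_compose[OF _ measurable_gauss] measurable_compose[OF _ measurable_ennreal]) measurable
    define g where "g t = ennreal (t powr (- 3 / 2)) * indicator {1..} t" for t :: real
    have [measurable]: "g \<in> borel_measurable borel" unfolding g_def by measurable
    \<comment> \<open>The bound \<open>nn_integral_W_le\<close> blows up at time 0, so on [- 1, 1]
      the trivial \<open>gauss 1 \<le> 1\<close> is used; \<open>g t\<close> and
      \<open>g (- t)\<close> dominate the two tails.\<close>
    have bound: "(\<integral>\<^sup>+\<omega>. ennreal (gauss 1 (pos (?c \<omega>) t)) \<partial>M) \<le> indicator {- 1..1} t + (g t + g (- t))" for t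
    proof -
      have eq: "(\<integral>\<^sup>+\<omega>. ennreal (gauss 1 (pos (?c \<omega>) t)) \<partial>M) = (\<integral>\<^sup>+\<omega>. ennreal (gauss 1 (u + W t \<omega>)) \<partial>M)"
        using AE_pos_coded_path[of u] by (intro nn_integral_cong_AE) (auto elim!: eventually_mono)
      show ?thesis
      proof (cases "\<bar>t\<bar> \<le> 1")
        case True
        have "(\<integral>\<^sup>+\<omega>. ennreal (gauss 1 (u + W t \<omega>)) \<partial>M) \<le> (\<integral>\<^sup>+\<omega>. 1 \<partial>M)"
          using gauss_le[of 1 "u + W t \<omega>" for \<omega>] by (intro nn_integral_mono) (simp add: ennreal_le_1)
        then show ?thesis
          unfolding eq emeasure_space_1 using True
          by (elim order_trans) (auto simp: emeasure_space_1 abs_le_iff add_increasing2)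
      next
        case False
        have "(1 / sqrt \<bar>t\<bar>) ^ CARD('k) \<le> (1 / sqrt \<bar>t\<bar>) ^ 3"
          using False k by (intro power_decreasing) auto
        also have "\<dots> = \<bar>t\<bar> powr (- 3 / 2)"
          using False by (simp add: powr_minus powr_half_sqrt[symmetric] powr_power field_simps)
        finally have "(\<integral>\<^sup>+\<omega>. ennreal (gauss 1 (u + W t \<omega>)) \<partial>M) \<le> ennreal (\<bar>t\<bar> powr (- 3 / 2))"
          using False by (intro order_trans[OF nn_integral_W_le] ennreal_leI) auto
        also have "\<dots> \<le> g t + g (- t)"
          using False by (auto simp: g_def abs_if split: if_splits)
        finally show ?thesis
          unfolding eq by (simp add: add_increasing)
      qed
    qed
    have "(\<integral>\<^sup>+t. g (- t) \<partial>lborel) = (\<integral>\<^sup>+t. g t \<partial>lborel)"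
      using nn_integral_real_affine[of g "- 1" 0] by simp
    moreover have "(\<integral>\<^sup>+t. g t \<partial>lborel) < \<infinity>"
      unfolding g_def by (rule nn_integral_powr_tail)
    ultimately have fin: "(\<integral>\<^sup>+t. indicator {- 1..1} t + (g t + g (- t)) \<partial>lborel) < \<infinity>"
      by (simp add: nn_integral_add)
    have "(\<integral>\<^sup>+\<omega>. \<integral>\<^sup>+t. ennreal (gauss 1 (pos (?c \<omega>) t)) \<partial>lborel \<partial>M) =
        (\<integral>\<^sup>+t. \<integral>\<^sup>+\<omega>. ennreal (gauss 1 (pos (?c \<omega>) t)) \<partial>M \<partial>lborel)"
      by (rule P.Fubini'[symmetric]) measurable
    also have "\<dots> \<le> (\<integral>\<^sup>+t. indicator {- 1..1} t + (g t + g (- t)) \<partial>lborel)"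
      by (intro nn_integral_mono bound)
    finally have "(\<integral>\<^sup>+\<omega>. \<integral>\<^sup>+t. ennreal (gauss 1 (pos (?c \<omega>) t)) \<partial>lborel \<partial>M) \<noteq> \<infinity>"
      using fin by (simp add: less_top[symmetric] top_unique neq_top_trans)
    then show "AE \<omega> in M. (\<integral>\<^sup>+t. ennreal (gauss 1 (pos (?c \<omega>) t)) \<partial>lborel) \<noteq> \<infinity>"
      by (intro nn_integral_PInf_AE) (auto intro: measurable_compose[OF coded_path_measurable measurable_occupation_time])
  qed
  then show "conservative_part path_measure (path_shift TYPE('k)) (\<lambda>x. gauss 1 (pos x 0)) \<in> null_sets path_measure"
    unfolding conservative_part_weight
    using measurable_occupation_time by (intro AE_iff_null_sets[THEN iffD2]) auto
qed

end

section \<open>Recurrence and conservativity in low dimension\<close>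

lemma suminf_eq_top_if_infinitely_often:
  fixes f :: "nat \<Rightarrow> ennreal"
  assumes inf: "\<exists>\<^sub>\<infinity>n. c \<le> f n" and c: "0 < c"
  shows "(\<Sum>n. f n) = \<infinity>"
proof -
  have "infinite {n. c \<le> f n}" using inf by (simp add: frequently_cofinite)
  then have "\<infinity> = c * (\<integral>\<^sup>+n. indicator {n. c \<le> f n} n \<partial>count_space UNIV)"
    using c by (simp add: ennreal_mult_top)
  also have "\<dots> = (\<integral>\<^sup>+n. c * indicator {n. c \<le> f n} n \<partial>count_space UNIV)"
    by (simp add: nn_integral_cmult)
  also have "\<dots> \<le> (\<integral>\<^sup>+n. f n \<partial>count_space UNIV)"
    by (intro nn_integral_mono) (auto simp: indicator_def)
  finally show ?thesis by (simp add: nn_integral_count_space_nat top_unique)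
qed

text \<open>Chung--Fuchs: decompose according to the last visit to the unit ball.\<close>

lemma bm_recurrent:
  fixes V :: "real \<Rightarrow> 'a \<Rightarrow> real ^ 'k::finite"
  assumes "prob_space M" and bm: "standard_brownian_motion M V" and V0: "\<And>\<omega>. V 0 \<omega> = 0"
    and k: "CARD('k) \<le> 2"
  shows "AE \<omega> in M. \<exists>\<^sub>\<infinity>n. norm (V (real n) \<omega>) < 2"
proof -
  interpret prob_space M by fact
  note [measurable] = bm_measurable[OF bm]
  define S where "S n = V (real n)" for n
  have [measurable]: "S n \<in> borel_measurable M" for n by (simp add: S_def)
  define \<Delta> where "\<Delta> j \<omega> = S (Suc j) \<omega> - S j \<omega>" for j \<omega>
  have [measurable]: "\<Delta> j \<in> borel_measurable M" for j unfolding \<Delta>_def by measurable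
  have S_sum: "S (m + n) \<omega> - S m \<omega> = (\<Sum>j\<in>{m..<m + n}. \<Delta> j \<omega>)" for m n \<omega>
    unfolding \<Delta>_def by (subst sum_Suc_diff') auto
  have S_0: "S 0 \<omega> = 0" for \<omega> using V0 by (simp add: S_def)
  have fin_indep: "indep_vars (\<lambda>_. borel) \<Delta> {..<n}" for n
  proof -
    have "strict_mono_on {..n} real" by (auto simp: strict_mono_on_def)
    with bm have "indep_vars (\<lambda>_. borel) (\<lambda>j \<omega>. V (real (Suc j)) \<omega> - V (real j) \<omega>) {..<n}"
      unfolding standard_brownian_motion_def by blast
    moreover have "\<Delta> = (\<lambda>j \<omega>. V (real (Suc j)) \<omega> - V (real j) \<omega>)"
      by (simp add: fun_eq_iff \<Delta>_def S_def)
    ultimately show ?thesis by simp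
  qed
  have indep: "indep_vars (\<lambda>_. borel) \<Delta> UNIV"
    unfolding indep_vars_def2
  proof (intro conjI ballI)
    show "indep_sets (\<lambda>i. {\<Delta> i -` A \<inter> space M |A. A \<in> sets borel}) UNIV"
    proof (subst indep_sets_finite_index_sets, intro allI impI)
      fix J :: "nat set" assume "finite J"
      then obtain n where "J \<subseteq> {..<n}" using finite_nat_iff_bounded by blast
      from indep_vars_subset[OF fin_indep this]
      show "indep_sets (\<lambda>i. {\<Delta> i -` A \<inter> space M |A. A \<in> sets borel}) J"
        by (simp add: indep_vars_def2)
    qed
  qed simp
  \<comment> \<open>If with positive probability p the walk stayed outside the ball of radius 2 from
    time r on, the expected number of visits to the unit ball would be at most r / p, against the
    harmonic lower bound.\<close>
  have escape: "prob {\<omega>\<in>space M. \<forall>n\<ge>r. 2 \<le> norm (S n \<omega>)} = 0" for r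
  proof (rule ccontr)
    define p where "p = prob {\<omega>\<in>space M. \<forall>n\<ge>r. 2 \<le> norm (S n \<omega>)}"
    assume "prob {\<omega>\<in>space M. \<forall>n\<ge>r. 2 \<le> norm (S n \<omega>)} \<noteq> 0"
    then have p: "0 < p" unfolding p_def using zero_less_measure_iff by blast
    define q where "q m = prob {\<omega>\<in>space M. norm (S m \<omega>) < 1}" for m
    \<comment> \<open>The walk is in the unit ball at time m and keeps distance at least 2 from
      \<open>S m\<close> from time m + r on. Two points of the unit ball are less than 2 apart, so
      there is no visit to the unit ball from time m + r on; this explains the radius 2.\<close>
    define F where "F m = {\<omega>\<in>space M. norm (S m \<omega>) < 1 \<and> (\<forall>n\<ge>r. 2 \<le> norm (S (m + n) \<omega> - S m \<omega>))}" for m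
    have [measurable]: "F m \<in> sets M" for m unfolding F_def by measurable
    \<comment> \<open>The increments before m and from m on are independent, and the walk restarted
      at m has the law of the original one.\<close>
    have prob_F: "prob (F m) = q m * p" for m
    proof -
      let ?A = "{x \<in> space (\<Pi>\<^sub>M j\<in>{..<m}. borel :: (real ^ 'k) measure). norm (\<Sum>j\<in>{0..<0 + m}. x j) < 1}"
      let ?B = "{x \<in> space (\<Pi>\<^sub>M j\<in>{m..}. borel :: (real ^ 'k) measure). \<forall>n\<ge>r. 2 \<le> norm (\<Sum>j\<in>{m..<m + n}. x j)}"
      let ?X = "\<lambda>\<omega>. restrict (\<lambda>j. \<Delta> j \<omega>) {..<m}" and ?Y = "\<lambda>\<omega>. restrict (\<lambda>j. \<Delta> j \<omega>) {m..}"
      have XY: "indep_var (\<Pi>\<^sub>M j\<in>{..<m}. borel) ?X (\<Pi>\<^sub>M j\<in>{m..}. borel) ?Y"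
        by (rule indep_var_restrict[OF indep]) auto
      have A: "?A \<in> sets (\<Pi>\<^sub>M j\<in>{..<m}. borel)"
      proof -
        have [measurable]: "(\<lambda>x. \<Sum>j\<in>{0..<0 + m}. x j) \<in> borel_measurable (\<Pi>\<^sub>M j\<in>{..<m}. borel :: (real ^ 'k) measure)"
          by (intro borel_measurable_sum measurable_component_singleton) auto
        show ?thesis by measurable
      qed
      have B: "?B \<in> sets (\<Pi>\<^sub>M j\<in>{m..}. borel)"
      proof -
        have [measurable]: "(\<lambda>x. \<Sum>j\<in>{m..<m + n}. x j) \<in> borel_measurable (\<Pi>\<^sub>M j\<in>{m..}. borel :: (real ^ 'k) measure)" for n
          by (intro borel_measurable_sum measurable_component_singleton) auto
        show ?thesis by measurable
      qed
      have XA: "?X -` ?A \<inter> space M = {\<omega>\<in>space M. norm (S m \<omega>) < 1}"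
        using S_sum[of 0 m] by (auto simp: space_PiM S_0)
      have YB: "?Y -` ?B \<inter> space M = {\<omega>\<in>space M. \<forall>n\<ge>r. 2 \<le> norm (S (m + n) \<omega> - S m \<omega>)}"
        by (auto simp: space_PiM S_sum)
      have "prob ((\<lambda>\<omega>. (?X \<omega>, ?Y \<omega>)) -` (?A \<times> ?B) \<inter> space M) = q m * prob (?Y -` ?B \<inter> space M)"
        unfolding indep_varD[OF XY A B] XA q_def ..
      also have "(\<lambda>\<omega>. (?X \<omega>, ?Y \<omega>)) -` (?A \<times> ?B) \<inter> space M = (?X -` ?A \<inter> space M) \<inter> (?Y -` ?B \<inter> space M)"
        by blast
      also have "\<dots> = F m"
        unfolding XA YB F_def by auto
      also have "prob (?Y -` ?B \<inter> space M) = p"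
      proof -
        define V' where "V' t \<omega> = V (t + real m) \<omega> - V (real m) \<omega>" for t \<omega>
        have V': "standard_brownian_motion M V'"
          using bm_shift[OF bm, of "real m"] unfolding V'_def by simp
        let ?P = "\<Pi>\<^sub>M t\<in>(UNIV::real set). borel :: (real ^ 'k) measure"
        let ?G = "{w \<in> space ?P. \<forall>n\<ge>r. 2 \<le> norm (w (real n))}"
        have G: "?G \<in> sets ?P"
        proof -
          have [measurable]: "(\<lambda>w. w (real n)) \<in> borel_measurable ?P" for n
            by (rule measurable_component_singleton) simp
          show ?thesis by measurable
        qed
        have "prob (?Y -` ?B \<inter> space M) = measure (distr M ?P (\<lambda>\<omega> t. V' t \<omega>)) ?G"
          unfolding YB measure_distr[OF bm_path_measurable[OF V'] G]
          by (intro arg_cong[where f=prob]) (auto simp: space_PiM V'_def S_def add.commute)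
        also have "\<dots> = measure (distr M ?P (\<lambda>\<omega> t. V t \<omega>)) ?G"
          by (simp only: bm_law_unique[OF prob_space_axioms V' prob_space_axioms bm])
        also have "\<dots> = p"
          unfolding p_def measure_distr[OF bm_path_measurable[OF bm] G]
          by (intro arg_cong[where f=prob]) (auto simp: space_PiM S_def)
        finally show ?thesis .
      qed
      finally show ?thesis .
    qed
    \<comment> \<open>All m for which \<open>F m\<close> occurs lie within fewer than r steps of the
      first one.\<close>
    have count: "(\<Sum>m<N. indicator (F m) \<omega>) \<le> (of_nat r :: ennreal)" for N \<omega>
    proof -
      define I where "I = {m. m < N \<and> \<omega> \<in> F m}"
      have "finite I" by (simp add: I_def)
      have "card I \<le> r"
      proof (cases "I = {}")
        case False
        define m0 where "m0 = Min I"
        have m0: "m0 \<in> I" "\<And>m. m \<in> I \<Longrightarrow> m0 \<le> m"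
          using False \<open>finite I\<close> by (auto simp: m0_def)
        have "m < m0 + r" if m: "m \<in> I" for m
        proof (rule ccontr)
          assume "\<not> m < m0 + r"
          moreover have "\<forall>n\<ge>r. 2 \<le> norm (S (m0 + n) \<omega> - S m0 \<omega>)"
            using m0(1) by (simp add: I_def F_def)
          ultimately have "2 \<le> norm (S (m0 + (m - m0)) \<omega> - S m0 \<omega>)"
            by (metis le_add_diff_inverse le_diff_conv2 m0(2) m add.commute not_less)
          moreover have "m0 + (m - m0) = m" using m0(2)[OF m] by simp
          moreover have "norm (S m \<omega>) < 1" "norm (S m0 \<omega>) < 1"
            using m m0(1) by (auto simp: I_def F_def)
          ultimately show False
            using norm_triangle_ineq4[of "S m \<omega>" "S m0 \<omega>"] by simp
        qed
        then have "I \<subseteq> {m0..<m0 + r}" using m0(2) by auto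
        from card_mono[OF _ this] show ?thesis by simp
      qed simp
      moreover have "(\<Sum>m<N. indicator (F m) \<omega>) = (of_nat (card I) :: ennreal)"
        by (simp add: indicator_def sum.If_cases I_def Int_def lessThan_def)
      ultimately show ?thesis by (simp add: of_nat_mono)
    qed
    have bound: "(\<Sum>m<N. q m) \<le> real r / p" for N
    proof -
      have "(\<Sum>m<N. emeasure M (F m)) = (\<integral>\<^sup>+\<omega>. (\<Sum>m<N. indicator (F m) \<omega>) \<partial>M)"
        by (subst nn_integral_sum) auto
      also have "\<dots> \<le> (\<integral>\<^sup>+\<omega>. of_nat r \<partial>M)"
        by (intro nn_integral_mono count)
      also have "\<dots> = ennreal (real r)"
        by (simp add: emeasure_space_1 ennreal_of_nat_eq_real_of_nat)
      also have "(\<Sum>m<N. emeasure M (F m)) = ennreal (\<Sum>m<N. q m * p)"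
        unfolding emeasure_eq_measure prob_F by (intro sum_ennreal) (simp add: q_def p_def)
      finally have "ennreal (\<Sum>m<N. q m * p) \<le> ennreal (real r)" .
      then have "(\<Sum>m<N. q m) * p \<le> real r"
        by (simp add: sum_distrib_right)
      then show ?thesis using p by (simp add: field_simps)
    qed
    have "summable q"
      by (rule summableI_nonneg_bounded[OF _ bound]) (simp add: q_def)
    define c where "c = (exp (- 1 / 2) / sqrt (2 * pi)) ^ CARD('k) * measure lborel (ball 0 1 :: (real ^ 'k) set)"
    have vol: "emeasure lborel (ball 0 1 :: (real ^ 'k) set) = ennreal (measure lborel (ball 0 1 :: (real ^ 'k) set))"
      using emeasure_lborel_ball_finite[of "0 :: real ^ 'k" 1] by (intro emeasure_eq_ennreal_measure) auto
    have "0 < c"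
    proof -
      have "0 < measure lborel (ball 0 1 :: (real ^ 'k) set)"
        using content_ball_pos[of 1 "0 :: real ^ 'k"] by simp
      then show ?thesis by (simp add: c_def)
    qed
    \<comment> \<open>The lower bound holds from time 1 on, hence the index \<open>Suc m\<close>;
      one term does not affect summability.\<close>
    have q_ge: "c * (1 / real (Suc m)) \<le> q (Suc m)" for m
    proof -
      have "ennreal (c * (1 / real (Suc m))) \<le> ennreal (q (Suc m))"
        using emeasure_increment_ball_ge[OF bm k, of "real (Suc m)"]
        unfolding vol by (simp add: V0 c_def q_def S_def emeasure_eq_measure ennreal_mult[symmetric] mult_ac)
      then show ?thesis by (simp add: q_def)
    qed
    have "summable (\<lambda>m. q (Suc m))" using \<open>summable q\<close> by (subst summable_Suc_iff)
    moreover have "norm (c * (1 / real (Suc m))) \<le> q (Suc m)" for m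
      using q_ge[of m] \<open>0 < c\<close> by simp
    ultimately have "summable (\<lambda>m. c * (1 / real (Suc m)))"
      by (rule summable_comparison_test'[where N=0])
    then have "summable (\<lambda>m. 1 / real (Suc m))"
      using \<open>0 < c\<close> by (elim summable_mult_D) simp
    then have "summable (\<lambda>m. inverse (real (Suc m)))"
      by (simp only: inverse_eq_divide)
    then have "summable (\<lambda>m. inverse (real m))"
      by (subst (asm) summable_Suc_iff)
    then show False
      using not_summable_harmonic[where 'a=real] by simp
  qed
  have "AE \<omega> in M. \<not> (\<forall>n\<ge>r. 2 \<le> norm (S n \<omega>))" for r
    using escape[of r] by (intro AE_I[of _ _ "{\<omega>\<in>space M. \<forall>n\<ge>r. 2 \<le> norm (S n \<omega>)}"]) (auto simp: emeasure_eq_measure)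
  then have "AE \<omega> in M. \<forall>r. \<not> (\<forall>n\<ge>r. 2 \<le> norm (S n \<omega>))"
    by (simp add: AE_all_countable)
  then show ?thesis
    by eventually_elim (auto simp: INFM_nat_le S_def not_le)
qed

text \<open>Cutting t \<ge> 0 into unit intervals and translating them to [0, 1) turns the integral
  into one over s of the sum over all s + n. Negative times can only add to it.\<close>

lemma nn_integral_eq_top_if_suminf_translates:
  assumes [measurable]: "f \<in> borel_measurable (borel :: real measure)"
    and top: "AE s in lborel. (\<Sum>n. f (s + real n)) = \<infinity>"
  shows "(\<integral>\<^sup>+t. f t \<partial>lborel) = (\<infinity> :: ennreal)"
proof -
  have "(\<infinity> :: ennreal) = (\<integral>\<^sup>+s. \<infinity> * indicator {0..<1::real} s \<partial>lborel)"
    by (subst nn_integral_cmult_indicator) (auto simp: ennreal_top_mult)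
  also have "\<dots> = (\<integral>\<^sup>+s. (\<Sum>n. f (s + real n) * indicator {0..<1} s) \<partial>lborel)"
    using top by (intro nn_integral_cong_AE) (auto elim!: eventually_mono)
  also have "\<dots> = (\<Sum>n. \<integral>\<^sup>+s. f (s + real n) * indicator {0..<1} s \<partial>lborel)"
    by (rule nn_integral_suminf) measurable
  also have "\<dots> = (\<Sum>n. \<integral>\<^sup>+t. f t * indicator {real n..<real n + 1} t \<partial>lborel)"
  proof (intro suminf_cong)
    fix n
    have "(\<integral>\<^sup>+t. f t * indicator {real n..<real n + 1} t \<partial>lborel) =
        (\<integral>\<^sup>+s. f (real n + s) * indicator {real n..<real n + 1} (real n + s) \<partial>lborel)"
      by (rule nn_integral_lborel_translate[symmetric]) measurable
    also have "\<dots> = (\<integral>\<^sup>+s. f (s + real n) * indicator {0..<1} s \<partial>lborel)"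
      by (intro nn_integral_cong) (auto simp: indicator_def add.commute)
    finally show "(\<integral>\<^sup>+s. f (s + real n) * indicator {0..<1} s \<partial>lborel) =
        (\<integral>\<^sup>+t. f t * indicator {real n..<real n + 1} t \<partial>lborel)" ..
  qed
  also have "\<dots> = (\<integral>\<^sup>+t. (\<Sum>n. f t * indicator {real n..<real n + 1} t) \<partial>lborel)"
    by (rule nn_integral_suminf[symmetric]) measurable
  also have "\<dots> \<le> (\<integral>\<^sup>+t. f t \<partial>lborel)"
  proof (intro nn_integral_mono)
    fix t :: real
    have "disjoint_family (\<lambda>n. {real n..<real n + 1})"
      unfolding disjoint_family_on_def
    proof (intro ballI impI)
      fix m n :: nat assume "m \<noteq> n"
      then have "m + 1 \<le> n \<or> n + 1 \<le> m" by auto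
      then have "real m + 1 \<le> real n \<or> real n + 1 \<le> real m" by linarith
      then show "{real m..<real m + 1} \<inter> {real n..<real n + 1} = {}" by auto
    qed
    then have "(\<Sum>n. indicator {real n..<real n + 1} t) = (indicator (\<Union>n. {real n..<real n + 1}) t :: ennreal)"
      by (rule suminf_indicator)
    then show "(\<Sum>n. f t * indicator {real n..<real n + 1} t) \<le> f t"
      by (simp add: indicator_def)
  qed
  finally show ?thesis by (simp add: top_unique)
qed

context brownian_paths
begin

text \<open>The walk \<open>W (s + n) - W s\<close> visits the ball of radius 2 infinitely often.
  Each visit puts the particle within distance r of the origin, where the Gaussian weight is at
  least c > 0; both r and c depend on \<omega> but not on n.\<close>

lemma AE_suminf_gauss:
  assumes k: "CARD('k) \<le> 2"
  shows "AE \<omega> in M. (\<Sum>n. ennreal (gauss 1 (u + W (s + real n) \<omega>))) = \<infinity>"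
proof -
  define V where "V t \<omega> = W (t + s) \<omega> - W s \<omega>" for t \<omega>
  have "standard_brownian_motion M V"
    using bm_shift[OF bm] unfolding V_def by simp
  then have "AE \<omega> in M. \<exists>\<^sub>\<infinity>n. norm (V (real n) \<omega>) < 2"
    by (rule bm_recurrent[OF prob_space_axioms _ _ k]) (simp add: V_def)
  then show ?thesis
  proof eventually_elim
    case (elim \<omega>)
    define r where "r = norm (u + W s \<omega>) + 2"
    define c where "c = (exp (- r\<^sup>2 / (2 * 1)) / sqrt (2 * pi * 1)) ^ CARD('k)"
    have "\<exists>\<^sub>\<infinity>n. ennreal c \<le> ennreal (gauss 1 (u + W (s + real n) \<omega>))"
      using elim
    proof (rule frequently_elim1)
      fix n assume "norm (V (real n) \<omega>) < 2"
      moreover have "u + W (s + real n) \<omega> = (u + W s \<omega>) + V (real n) \<omega>"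
        by (simp add: V_def add.commute)
      ultimately have "norm (u + W (s + real n) \<omega>) \<le> r"
        using norm_triangle_ineq[of "u + W s \<omega>" "V (real n) \<omega>"] by (simp add: r_def add.assoc)
      then show "ennreal c \<le> ennreal (gauss 1 (u + W (s + real n) \<omega>))"
        unfolding c_def by (intro ennreal_leI gauss_ge) auto
    qed
    then show ?case
      by (rule suminf_eq_top_if_infinitely_often) (simp add: c_def)
  qed
qed

text \<open>For each fixed s the sum over s + n is almost surely infinite. Fubini exchanges the
  quantifiers: almost surely it is infinite for almost every s, and this makes the integral over t
  infinite.\<close>

lemma conservative_shift:
  assumes k: "CARD('k) \<le> 2"
  shows "conservative_flow path_measure (path_shift TYPE('k))"
  unfolding conservative_flow_def
proof (intro conjI exI[of _ "\<lambda>x. gauss 1 (pos x 0)"] measure_preserving_flow_shift integrable_weight)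
  show "AE x in path_measure. 0 < gauss 1 (pos x 0)"
    by (simp add: gauss_pos)
  have "AE x in path_measure. (\<integral>\<^sup>+t. ennreal (gauss 1 (pos x t)) \<partial>lborel) = \<infinity>"
  proof (rule AE_path_measure_fiber)
    show "{x. (\<integral>\<^sup>+t. ennreal (gauss 1 (pos x t)) \<partial>lborel) = \<infinity>} \<in> sets borel"
      using measurable_occupation_time by measurable
    fix u :: "real ^ 'k"
    let ?c = "\<lambda>\<omega>. path_code (\<lambda>t. u + W t \<omega>)"
    interpret P: pair_sigma_finite M lborel ..
    have [measurable]: "(\<lambda>z. \<Sum>n. ennreal (gauss 1 (pos (?c (fst z)) (snd z + real n)))) \<in> borel_measurable (M \<Otimes>\<^sub>M lborel)"
      by (intro borel_measurable_suminf_order measurable_compose[OF _ measurable_gauss] measurable_compose[OF _ measurable_ennreal]) measurable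
    have meas: "{z \<in> space (M \<Otimes>\<^sub>M lborel). (\<Sum>n. ennreal (gauss 1 (pos (?c (fst z)) (snd z + real n)))) = \<infinity>} \<in> sets (M \<Otimes>\<^sub>M lborel)"
      by measurable
    have "AE \<omega> in M. (\<Sum>n. ennreal (gauss 1 (pos (?c \<omega>) (s + real n)))) = \<infinity>" for s
      using AE_suminf_gauss[OF k, of u s] AE_pos_coded_path[of u] by eventually_elim simp
    then have "AE s in lborel. AE \<omega> in M. (\<Sum>n. ennreal (gauss 1 (pos (?c \<omega>) (s + real n)))) = \<infinity>"
      by simp
    then have "AE \<omega> in M. AE s in lborel. (\<Sum>n. ennreal (gauss 1 (pos (?c \<omega>) (s + real n)))) = \<infinity>"
      using P.AE_commute[OF meas] by simp
    then show "AE \<omega> in M. (\<integral>\<^sup>+t. ennreal (gauss 1 (pos (?c \<omega>) t)) \<partial>lborel) = \<infinity>"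
    proof eventually_elim
      case (elim \<omega>)
      have "(\<lambda>t. ennreal (gauss 1 (pos (?c \<omega>) t))) \<in> borel_measurable borel"
        by (intro measurable_compose[OF _ measurable_gauss] measurable_compose[OF _ measurable_ennreal]) measurable
      then show ?case using elim by (rule nn_integral_eq_top_if_suminf_translates)
    qed
  qed
  then show "dissipative_part path_measure (path_shift TYPE('k)) (\<lambda>x. gauss 1 (pos x 0)) \<in> null_sets path_measure"
    unfolding dissipative_part_def conservative_part_weight
    using measurable_occupation_time by (intro AE_iff_null_sets[THEN iffD2]) auto
qed

end

section \<open>The point process of Brownian particles\<close>

lemma (in prob_space) indep_vars_reindex_inj:
  assumes indep: "indep_vars (\<lambda>_. N) X UNIV" and h: "inj h"
  shows "indep_vars (\<lambda>_. N) (\<lambda>j. X (h j)) UNIV"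
proof -
  let ?F = "\<lambda>i. {X i -` A \<inter> space M | A. A \<in> sets N}"
  have F: "?F i \<subseteq> events" and prod: "\<And>J A. J \<noteq> {} \<Longrightarrow> finite J \<Longrightarrow> A \<in> Pi J ?F \<Longrightarrow> prob (\<Inter>j\<in>J. A j) = (\<Prod>j\<in>J. prob (A j))" for i
    using indep by (auto simp: indep_vars_def2 indep_sets_def)
  have "prob (\<Inter>j\<in>J. A j) = (\<Prod>j\<in>J. prob (A j))"
    if J: "J \<noteq> {}" "finite J" and A: "A \<in> Pi J (\<lambda>j. ?F (h j))" for J A
  proof -
    have inv: "inv h (h j) = j" for j using h by simp
    have "(\<lambda>i. A (inv h i)) \<in> Pi (h ` J) ?F"
      using A by (auto simp: Pi_iff inv)
    from prod[OF _ _ this] J have "prob (\<Inter>i\<in>h ` J. A (inv h i)) = (\<Prod>i\<in>h ` J. prob (A (inv h i)))"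
      by simp
    then show ?thesis
      using h by (subst (asm) prod.reindex) (auto simp: inv inj_on_def)
  qed
  then show ?thesis
    using indep F by (auto simp: indep_vars_def2 indep_sets_def)
qed

text \<open>Independence of the generated \<sigma>-algebras passes to measurable functions of the
  generators. Here R will reindex the points and D will code the marks, and the result is the
  product form that marking requires.\<close>

lemma (in prob_space) distr_pair_indep_set:
  assumes indep: "indep_set (sets (vimage_algebra (space M) f S)) (sets (vimage_algebra (space M) g T))"
    and f: "f \<in> M \<rightarrow>\<^sub>M S" and g: "g \<in> M \<rightarrow>\<^sub>M T" and R: "R \<in> S \<rightarrow>\<^sub>M S'" and D: "D \<in> T \<rightarrow>\<^sub>M T'"
  shows "distr M (S' \<Otimes>\<^sub>M T') (\<lambda>\<omega>. (R (f \<omega>), D (g \<omega>))) = distr M S' (\<lambda>\<omega>. R (f \<omega>)) \<Otimes>\<^sub>M distr M T' (\<lambda>\<omega>. D (g \<omega>))"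
proof (rule pair_measure_eqI[symmetric])
  note [measurable] = f g R D
  interpret S: prob_space "distr M S' (\<lambda>\<omega>. R (f \<omega>))" by (rule prob_space_distr) measurable
  interpret T: prob_space "distr M T' (\<lambda>\<omega>. D (g \<omega>))" by (rule prob_space_distr) measurable
  show "sigma_finite_measure (distr M S' (\<lambda>\<omega>. R (f \<omega>)))" "sigma_finite_measure (distr M T' (\<lambda>\<omega>. D (g \<omega>)))" ..
  fix A B assume "A \<in> sets (distr M S' (\<lambda>\<omega>. R (f \<omega>)))" "B \<in> sets (distr M T' (\<lambda>\<omega>. D (g \<omega>)))"
  then have [measurable]: "A \<in> sets S'" "B \<in> sets T'" by auto
  let ?a = "f -` (R -` A \<inter> space S) \<inter> space M" and ?b = "g -` (D -` B \<inter> space T) \<inter> space M"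
  have a: "(\<lambda>\<omega>. R (f \<omega>)) -` A \<inter> space M = ?a" and b: "(\<lambda>\<omega>. D (g \<omega>)) -` B \<inter> space M = ?b"
    using measurable_space[OF f] measurable_space[OF g] by auto
  have "prob (?a \<inter> ?b) = prob ?a * prob ?b"
    by (intro indep_setD[OF indep] in_vimage_algebra measurable_sets[OF R] measurable_sets[OF D]) measurable
  moreover have "(\<lambda>\<omega>. (R (f \<omega>), D (g \<omega>))) -` (A \<times> B) \<inter> space M = ?a \<inter> ?b"
    using a b by blast
  ultimately show "emeasure (distr M S' (\<lambda>\<omega>. R (f \<omega>))) A * emeasure (distr M T' (\<lambda>\<omega>. D (g \<omega>))) B =
      emeasure (distr M (S' \<Otimes>\<^sub>M T') (\<lambda>\<omega>. (R (f \<omega>), D (g \<omega>)))) (A \<times> B)"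
    by (simp add: emeasure_distr a b emeasure_eq_measure ennreal_mult')
qed simp

text \<open>Coding acts by evaluation and is therefore additive, so a starting point can be added
  after the path has been coded.\<close>

lemma path_code_add: "path_code (\<lambda>t. p t + q t) n = path_code p n + path_code q n"
  by (simp add: path_code_def split: prod.split)

text \<open>Each point is marked with the code of its motion, and the particle system is the image
  of the marked process under F. All motions share one law, so \<xi> 0 can represent it in the path
  measure.\<close>

lemma brownian_pointsI:
  fixes M :: "'a measure" and l :: real
    and U :: "int \<Rightarrow> 'a \<Rightarrow> real ^ 'k::finite"
    and \<xi> :: "int \<Rightarrow> real \<Rightarrow> 'a \<Rightarrow> real ^ 'k"
    and X :: "real \<Rightarrow> 'a \<Rightarrow> real"
  assumes M: "prob_space M" and l: "l > 0"
    and U: "poisson_process M (density lborel (\<lambda>_. ennreal l)) (\<lambda>_. UNIV) U"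
    and bm: "\<And>i. standard_brownian_motion M (\<xi> i)"
    and indep: "prob_space.indep_vars M (\<lambda>_. \<Pi>\<^sub>M t\<in>UNIV. borel) (\<lambda>i \<omega> t. \<xi> i t \<omega>) UNIV"
    and U_indep: "prob_space.indep_set M
           (sets (vimage_algebra (space M) (\<lambda>\<omega> i. U i \<omega>) (\<Pi>\<^sub>M i\<in>UNIV. borel)))
           (sets (vimage_algebra (space M) (\<lambda>\<omega> i t. \<xi> i t \<omega>)
              (\<Pi>\<^sub>M i\<in>UNIV. \<Pi>\<^sub>M t\<in>UNIV. borel)))"
    and X: "\<And>t \<omega>. X t \<omega> = (INF i. norm (U i \<omega> + \<xi> i t \<omega>))"
  shows "brownian_points M (\<xi> 0) l (\<lambda>n \<omega>. path_code (\<lambda>t. U (int_decode n) \<omega> + \<xi> (int_decode n) t \<omega>)) X"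
proof -
  interpret prob_space M by fact
  interpret B: brownian_paths M "\<xi> 0" l
    using bm l by unfold_locales auto
  let ?d = int_decode
  let ?PB = "\<Pi>\<^sub>M t\<in>(UNIV::real set). borel :: (real ^ 'k) measure"
  have U_meas [measurable]: "U i \<in> borel_measurable M" for i
    using poisson_process_measurable[OF U, of i] by simp
  have bm_meas [measurable]: "\<xi> i t \<in> borel_measurable M" for i t
    using bm by (rule bm_measurable)
  have pc [measurable]: "path_code \<in> ?PB \<rightarrow>\<^sub>M borel"
    by (rule measurable_path_code) (rule measurable_component_singleton, simp)
  define \<kappa> where "\<kappa> = distr M borel (\<lambda>\<omega>. path_code (\<lambda>t. \<xi> 0 t \<omega>))"
  have sets_\<kappa> [measurable_cong, simp]: "sets \<kappa> = sets borel" and [simp]: "space \<kappa> = UNIV"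
    by (simp_all add: \<kappa>_def)
  have marks_meas [measurable]: "(\<lambda>\<omega>. path_code (\<lambda>t. \<xi> i t \<omega>)) \<in> M \<rightarrow>\<^sub>M borel" for i
    by (intro measurable_path_code) measurable
  interpret K: prob_space \<kappa> unfolding \<kappa>_def by (rule prob_space_distr) measurable
  have pU: "poisson_process M B.\<nu> (\<lambda>_. UNIV) (\<lambda>n. U (?d n))"
    by (rule poisson_process_reindex[OF U bij_int_decode])
  have marks_indep: "indep_vars (\<lambda>_. \<kappa>) (\<lambda>n \<omega>. path_code (\<lambda>t. \<xi> (?d n) t \<omega>)) UNIV"
    by (rule indep_vars_compose2[OF indep_vars_reindex_inj[OF indep inj_int_decode], where Y="\<lambda>_. path_code"]) simp
  have marks_law: "distr M \<kappa> (\<lambda>\<omega>. path_code (\<lambda>t. \<xi> i t \<omega>)) = \<kappa>" for i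
  proof -
    have eq: "distr M borel (\<lambda>\<omega>. path_code (\<lambda>t. \<xi> i t \<omega>)) = distr (distr M ?PB (\<lambda>\<omega> t. \<xi> i t \<omega>)) borel path_code" for i
      by (subst distr_distr[OF pc bm_path_measurable[OF bm]]) (simp add: comp_def)
    have "distr M \<kappa> (\<lambda>\<omega>. path_code (\<lambda>t. \<xi> i t \<omega>)) = distr M borel (\<lambda>\<omega>. path_code (\<lambda>t. \<xi> i t \<omega>))"
      by (rule distr_cong) auto
    also have "\<dots> = \<kappa>"
      unfolding \<kappa>_def eq by (subst bm_law_unique[OF M bm[of i] M bm[of 0]]) (rule refl)
    finally show ?thesis .
  qed
  have "distr M ((\<Pi>\<^sub>M n\<in>UNIV. B.\<nu>) \<Otimes>\<^sub>M (\<Pi>\<^sub>M n\<in>UNIV. \<kappa>)) (\<lambda>\<omega>. (\<lambda>n. U (?d n) \<omega>, \<lambda>n. path_code (\<lambda>t. \<xi> (?d n) t \<omega>))) =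
      distr M (\<Pi>\<^sub>M n\<in>UNIV. B.\<nu>) (\<lambda>\<omega> n. U (?d n) \<omega>) \<Otimes>\<^sub>M distr M (\<Pi>\<^sub>M n\<in>UNIV. \<kappa>) (\<lambda>\<omega> n. path_code (\<lambda>t. \<xi> (?d n) t \<omega>))"
  proof (rule distr_pair_indep_set[OF U_indep, where R="\<lambda>u n. u (?d n)" and D="\<lambda>w n. path_code (w (?d n))"])
    show "(\<lambda>\<omega> i. U i \<omega>) \<in> M \<rightarrow>\<^sub>M (\<Pi>\<^sub>M i\<in>UNIV. borel)"
      by (intro measurable_abs_UNIV U_meas)
    show "(\<lambda>\<omega> i t. \<xi> i t \<omega>) \<in> M \<rightarrow>\<^sub>M (\<Pi>\<^sub>M i\<in>UNIV. ?PB)"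
      by (intro measurable_abs_UNIV bm_meas)
    show "(\<lambda>u n. u (?d n)) \<in> (\<Pi>\<^sub>M i\<in>UNIV. borel) \<rightarrow>\<^sub>M (\<Pi>\<^sub>M n\<in>UNIV. B.\<nu>)"
    proof (rule measurable_abs_UNIV)
      fix n
      have "(\<lambda>u. u (?d n)) \<in> (\<Pi>\<^sub>M i\<in>UNIV. borel :: (real ^ 'k) measure) \<rightarrow>\<^sub>M borel"
        by (rule measurable_component_singleton) simp
      then show "(\<lambda>u. u (?d n)) \<in> (\<Pi>\<^sub>M i\<in>UNIV. borel) \<rightarrow>\<^sub>M B.\<nu>" by simp
    qed
    show "(\<lambda>w n. path_code (w (?d n))) \<in> (\<Pi>\<^sub>M i\<in>UNIV. ?PB) \<rightarrow>\<^sub>M (\<Pi>\<^sub>M n\<in>UNIV. \<kappa>)"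
    proof (rule measurable_abs_UNIV)
      fix n
      have "(\<lambda>w. w (?d n)) \<in> (\<Pi>\<^sub>M i\<in>UNIV. ?PB) \<rightarrow>\<^sub>M ?PB"
        by (rule measurable_component_singleton) simp
      from measurable_compose[OF this pc]
      show "(\<lambda>w. path_code (w (?d n))) \<in> (\<Pi>\<^sub>M i\<in>UNIV. ?PB) \<rightarrow>\<^sub>M \<kappa>" by simp
    qed
  qed
  from poisson_process_marking[OF M pU marks_indep marks_law this]
  have marked: "poisson_process M (B.\<nu> \<Otimes>\<^sub>M \<kappa>) (\<lambda>_. UNIV) (\<lambda>n \<omega>. (U (?d n) \<omega>, path_code (\<lambda>t. \<xi> (?d n) t \<omega>)))" .
  \<comment> \<open>The starting point enters as the code of a constant path, so that F merely adds
    codes coordinatewise and is measurable.\<close>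
  define F where "F = (\<lambda>(u :: real ^ 'k, v) n. path_code (\<lambda>_. u) n + v n :: real)"
  have F_code: "F (u, path_code p) = path_code (\<lambda>t. u + p t)" for u p
    by (simp add: F_def path_code_add fun_eq_iff)
  have F_meas [measurable]: "F \<in> B.\<nu> \<Otimes>\<^sub>M \<kappa> \<rightarrow>\<^sub>M borel"
  proof (rule measurable_coordinatewise_then_product)
    fix n
    have 1: "(\<lambda>z. path_code (\<lambda>_. fst z) n) \<in> borel_measurable (B.\<nu> \<Otimes>\<^sub>M \<kappa>)"
      by (rule measurable_compose[OF measurable_path_code measurable_product_coordinates]) measurable
    have "snd \<in> B.\<nu> \<Otimes>\<^sub>M \<kappa> \<rightarrow>\<^sub>M (borel :: (nat \<Rightarrow> real) measure)"
      by measurable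
    then have 2: "(\<lambda>z. snd z n) \<in> borel_measurable (B.\<nu> \<Otimes>\<^sub>M \<kappa>)"
      by (rule measurable_compose[OF _ measurable_product_coordinates])
    show "(\<lambda>z. F z n) \<in> borel_measurable (B.\<nu> \<Otimes>\<^sub>M \<kappa>)"
      using borel_measurable_add[OF 1 2] by (simp add: F_def case_prod_beta)
  qed
  have "distr (B.\<nu> \<Otimes>\<^sub>M \<kappa>) borel F = B.path_measure"
  proof -
    have "B.\<nu> \<Otimes>\<^sub>M \<kappa> = distr (B.\<nu> \<Otimes>\<^sub>M M) (B.\<nu> \<Otimes>\<^sub>M borel) (\<lambda>(u, \<omega>). (u, path_code (\<lambda>t. \<xi> 0 t \<omega>)))"
      using pair_measure_distr[of "\<lambda>u. u" B.\<nu> B.\<nu> "\<lambda>\<omega>. path_code (\<lambda>t. \<xi> 0 t \<omega>)" M borel] K.sigma_finite_measure_axioms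
      by (simp add: \<kappa>_def distr_id2)
    then have "distr (B.\<nu> \<Otimes>\<^sub>M \<kappa>) borel F = distr (distr (B.\<nu> \<Otimes>\<^sub>M M) (B.\<nu> \<Otimes>\<^sub>M borel) (\<lambda>(u, \<omega>). (u, path_code (\<lambda>t. \<xi> 0 t \<omega>)))) borel F"
      by simp
    also have "\<dots> = distr (B.\<nu> \<Otimes>\<^sub>M M) borel (F \<circ> (\<lambda>(u, \<omega>). (u, path_code (\<lambda>t. \<xi> 0 t \<omega>))))"
    proof (rule distr_distr)
      show "F \<in> B.\<nu> \<Otimes>\<^sub>M borel \<rightarrow>\<^sub>M borel"
        using F_meas measurable_cong_sets[OF sets_pair_measure_cong[OF refl sets_\<kappa>] refl] by blast
    qed measurable
    also have "F \<circ> (\<lambda>(u, \<omega>). (u, path_code (\<lambda>t. \<xi> 0 t \<omega>))) = (\<lambda>(u, \<omega>). path_code (\<lambda>t. u + \<xi> 0 t \<omega>))"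
      by (simp add: fun_eq_iff F_code)
    finally show ?thesis by (simp add: B.path_measure_def)
  qed
  then have Q: "poisson_process M B.path_measure (\<lambda>_. UNIV) (\<lambda>n \<omega>. path_code (\<lambda>t. U (?d n) \<omega> + \<xi> (?d n) t \<omega>))"
    using poisson_process_map[OF M marked F_meas] by (simp add: F_code)
  show ?thesis
  proof (intro brownian_points.intro brownian_points_axioms.intro B.brownian_paths_axioms Q)
    fix t
    have "(\<lambda>\<omega>. INF i. norm (U i \<omega> + \<xi> i t \<omega>)) \<in> borel_measurable M"
      by (intro borel_measurable_cINF) (auto intro!: bdd_belowI[of _ 0])
    then show "X t \<in> borel_measurable M" using X by (simp add: fun_eq_iff[symmetric] cong: measurable_cong)
    have "AE \<omega> in M. continuous_on UNIV (\<lambda>t. \<xi> i t \<omega>)" for i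
      using bm[of i] by (auto simp: standard_brownian_motion_def)
    then have "AE \<omega> in M. \<forall>i. continuous_on UNIV (\<lambda>t. \<xi> i t \<omega>)"
      by (simp add: AE_all_countable)
    then show "AE \<omega> in M. X t \<omega> = (INF n. norm (path_eval (path_code (\<lambda>t. U (?d n) \<omega> + \<xi> (?d n) t \<omega>)) t :: real ^ 'k))"
    proof eventually_elim
      case (elim \<omega>)
      have "path_eval (path_code (\<lambda>t. U i \<omega> + \<xi> i t \<omega>)) t = U i \<omega> + \<xi> i t \<omega>" for i
        using elim by (intro path_eval_path_code continuous_intros) auto
      moreover have "range (\<lambda>n. norm (U (?d n) \<omega> + \<xi> (?d n) t \<omega>)) = range (\<lambda>i. norm (U i \<omega> + \<xi> i t \<omega>))"
        using surj_int_decode image_image[of "\<lambda>i. norm (U i \<omega> + \<xi> i t \<omega>)" ?d UNIV] by simp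
      ultimately show ?case by (simp add: X)
    qed
  qed
qed

theorem proposition4p8:
  fixes M :: "'a measure" and l :: real
    and U :: "int \<Rightarrow> 'a \<Rightarrow> real ^ 'k::finite"
    and \<xi> :: "int \<Rightarrow> real \<Rightarrow> 'a \<Rightarrow> real ^ 'k"
    and X :: "real \<Rightarrow> 'a \<Rightarrow> real"
  assumes "prob_space M"
    and "l > 0"
    and "poisson_process M (density lborel (\<lambda>_. ennreal l)) (\<lambda>_. UNIV) U"
    and "\<And>i. standard_brownian_motion M (\<xi> i)"
    and "prob_space.indep_vars M (\<lambda>_. \<Pi>\<^sub>M t\<in>UNIV. borel) (\<lambda>i \<omega> t. \<xi> i t \<omega>) UNIV"
    and "prob_space.indep_set M
           (sets (vimage_algebra (space M) (\<lambda>\<omega> i. U i \<omega>) (\<Pi>\<^sub>M i\<in>UNIV. borel)))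
           (sets (vimage_algebra (space M) (\<lambda>\<omega> i t. \<xi> i t \<omega>)
              (\<Pi>\<^sub>M i\<in>UNIV. \<Pi>\<^sub>M t\<in>UNIV. borel)))"
    and "\<And>t \<omega>. X t \<omega> = (INF i. norm (U i \<omega> + \<xi> i t \<omega>))"
  shows "(CARD('k) \<in> {1, 2} \<longrightarrow> generated_by_conservative_flow M (\<lambda>t \<omega>. - X t \<omega>)) \<and>
         (CARD('k) \<ge> 3 \<longrightarrow> generated_by_dissipative_flow M (\<lambda>t \<omega>. - X t \<omega>))"
proof -
  interpret brownian_points M "\<xi> 0" l "\<lambda>n \<omega>. path_code (\<lambda>t. U (int_decode n) \<omega> + \<xi> (int_decode n) t \<omega>)" X
    by (rule brownian_pointsI[OF assms])
  \<comment> \<open>All ingredients except the type of the shift flow hold in every dimension, so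
    only P depends on k.\<close>
  have "generated_by P M (\<lambda>t \<omega>. - X t \<omega>)" if "P path_measure (path_shift TYPE('k))" for P
    unfolding generated_by_def
    using stationary_X max_id_X essinf_X flow_represented_X[of P] that by simp
  then show ?thesis
    using conservative_shift dissipative_shift by auto
qed

end
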